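(* Let $H$ be a cocommutative Hopf algebra over a field $\mathbf{k}$ and let $(\mathcal{A},\{\mu_k\}_{k\ge1})$ be an $A_\infty$ $H$-pseudoalgebra. Then $(\mathcal{A},\{\beta_k\}_{k\ge1})$ is an $L_\infty$ $H$-pseudoalgebra, where for $k\ge1$ and homogeneous $a_1,\dots,a_k\in\mathcal{A}$, $$\beta_k(a_1,\dots,a_k)=\sum_{\sigma\in S_k}(-1)^\sigma\epsilon(\sigma)\,(\sigma\otimes_H1)\,\mu_k(a_{\sigma^{-1}(1)},\dots,a_{\sigma^{-1}(k)}).$$
   Context: Polylinear maps. $H^{\otimes n}$ is a right $H$-module via $(h_1\otimes\cdots\otimes h_n)h=h_1h_{(1)}\otimes\cdots\otimes h_nh_{(n)}$ (iterated coproduct). For a graded left $H$-module $\mathcal{A}=\oplus_{n\in\mathbb{Z}}\mathcal{A}^n$, $\mathrm{Hom}^p_{H^{\otimes n}}(\mathcal{A}^{\boxtimes n},H^{\otimes n}\otimes_H\mathcal{A})$ is the space of degree $p$, $H^{\otimes n}$-linear maps $\mathcal{A}^{\otimes n}\to H^{\otimes n}\otimes_H\mathcal{A}$ ($H^{\otimes n}$ acts factorwise on the source, by left multiplication on the target; $H$ in degree $0$). Signs and permutations. $(-1)^\sigma$ is the signature and $\epsilon(\sigma)$ the Koszul sign of the rearrangement of the homogeneous arguments in the term where it occurs. In $(\sigma\otimes_H1)\mu_k(a_{\sigma^{-1}(1)},\dots,a_{\sigma^{-1}(k)})$ the permutation $\sigma$ acts on $H^{\otimes k}$ so that the tensor factor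 attached to $a_r$ is placed in position $r$, i.e. $h_1\otimes\cdots\otimes h_k\mapsto h_{\sigma(1)}\otimes\cdots\otimes h_{\sigma(k)}$ (well defined on $H^{\otimes k}\otimes_H\mathcal{A}$ by cocommutativity). Composition: if $\psi(y_1,\dots,y_l)=\sum_i(h_i^1\otimes\cdots\otimes h_i^l)\otimes_He_i$ and $\varphi(x_1,\dots,x_{m-1},e_i,x_{m+1},\dots,x_k)=\sum_j(f^1_{ij}\otimes\cdots\otimes f^k_{ij})\otimes_He_{ij}$, then $\varphi(x_1,\dots,x_{m-1},\psi(y_1,\dots,y_l),x_{m+1},\dots,x_k)=\sum_{i,j}(f^1_{ij}\otimes\cdots\otimes f^{m-1}_{ij}\otimes h_i^1f^m_{ij(1)}\otimes\cdots\otimes h^l_if^m_{ij(l)}\otimes f^{m+1}_{ij}\otimes\cdots\otimes f^k_{ij})\otimes_He_{ij}$. $A_\infty$ $H$-pseudoalgebra: a graded left $H$-module $\mathcal{A}$ with $\mu_k\in\mathrm{Hom}^{k-2}_{H^{\otimes k}}(\mathcal{A}^{\boxtimes k},H^{\otimes k}\otimes_H\mathcal{A})$, $k\ge1$, such that for every $N\ge1$ and homogeneous $a_1,\dots,a_N$, $$\sum_{k+l=N+1}\sum_{\lambda=1}^k(-1)^{\lambda(l+1)+l(|a_1|+\cdots+|a_{\lambda-1}|)}\mu_k\big(a_1,\dots,a_{\lambda-1},\mu_l(a_\lambda,\dots,a_{\lambda+l-1}),a_{\lambda+l},\dots,a_N\big)=0.$$ $L_\infty$ $H$-pseudoalgebra: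 a graded left $H$-module $\mathcal{L}$ with $\beta_k\in\mathrm{Hom}^{k-2}_{H^{\otimes k}}(\mathcal{L}^{\boxtimes k},H^{\otimes k}\otimes_H\mathcal{L})$, $k\ge1$, that are graded skew-symmetric, i.e. $\beta_k(x_1,\dots,x_k)=(-1)^\sigma\epsilon(\sigma)(\sigma\otimes_H1)\beta_k(x_{\sigma^{-1}(1)},\dots,x_{\sigma^{-1}(k)})$ for all $\sigma\in S_k$, and satisfy, for every $N\ge1$ and homogeneous $x_1,\dots,x_N$, $$\sum_{k+l=N+1}\sum_{\sigma\in\mathrm{Sh}(l,k-1)}(-1)^\sigma\epsilon(\sigma)(-1)^{l(k-1)}\,\beta_k\big(\beta_l(x_{\sigma(1)},\dots,x_{\sigma(l)}),x_{\sigma(l+1)},\dots,x_{\sigma(N)}\big)=0,$$ where $\mathrm{Sh}(l,k-1)$ is the set of $\sigma\in S_N$ with $\sigma(1)<\cdots<\sigma(l)$ and $\sigma(l+1)<\cdots<\sigma(N)$, and the terms are compared in the category of polylinear maps, in which permuting arguments simultaneously permutes the attached factors of $H^{\otimes N}$.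
   Formalization: The sign exponent in the A∞ identity is taken as λ(l+1)+lN+l(|a_1|+…+|a_{λ-1}|), with an extra summand lN, since with the printed exponent the claim fails at N=3 in characteristic ≠ 2; the two notions differ by rescaling μ_k by (-1)^{k(k-1)/2}. *)

theory Defs
  imports "HOL-Library.Poly_Mapping" "HOL-Combinatorics.Combinatorics"
begin

text \<open>
  Tensor products are quotients of free abelian groups \<open>'x \<Rightarrow>\<^sub>0 int\<close> by the subgroup generated by
  the usual relations. Their elements are cosets; \<open>rep\<close> chooses a representative, which plays the
  role of writing a tensor as a sum of pure tensors (Sweedler notation).
\<close>

global_interpretation int_frag: module "frag_cmul :: int \<Rightarrow> ('x \<Rightarrow>\<^sub>0 int) \<Rightarrow> ('x \<Rightarrow>\<^sub>0 int)"
  by unfold_locales (simp_all add: frag_cmul_distrib frag_cmul_distrib2)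

definition cls :: "('x \<Rightarrow>\<^sub>0 int) set \<Rightarrow> ('x \<Rightarrow>\<^sub>0 int) \<Rightarrow> ('x \<Rightarrow>\<^sub>0 int) set" where
  "cls R u = {v. v - u \<in> int_frag.span R}"

definition rep :: "('x \<Rightarrow>\<^sub>0 int) set \<Rightarrow> ('x \<Rightarrow>\<^sub>0 int)" where
  "rep C = (SOME u. u \<in> C)"

definition lincomb ::
  "('x \<Rightarrow>\<^sub>0 int) set \<Rightarrow> 'i set \<Rightarrow> ('i \<Rightarrow> int) \<Rightarrow> ('i \<Rightarrow> ('x \<Rightarrow>\<^sub>0 int) set) \<Rightarrow> ('x \<Rightarrow>\<^sub>0 int) set" where
  "lincomb R I c f = cls R (\<Sum>i\<in>I. frag_cmul (c i) (rep (f i)))"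

definition ring_eval :: "('x \<Rightarrow> 'h::ring_1) \<Rightarrow> ('x \<Rightarrow>\<^sub>0 int) \<Rightarrow> 'h" where
  "ring_eval g u = (\<Sum>x\<in>Poly_Mapping.keys u. of_int (Poly_Mapping.lookup u x) * g x)"

definition msign :: "int \<Rightarrow> int" where
  "msign e = (if even e then 1 else - 1)"

text \<open>
  Positions are counted from 0. \<open>koszul \<tau> ds\<close> is the Koszul sign of rearranging arguments of
  degrees \<open>ds\<close> into the order \<open>\<tau> 0, \<tau> 1, \<dots>\<close>, i.e. into \<open>permute_list \<tau>\<close> of the argument list.
\<close>

definition koszul :: "(nat \<Rightarrow> nat) \<Rightarrow> int list \<Rightarrow> int" where
  "koszul \<tau> ds = (\<Prod>(i, j) \<in> {(i, j). i < j \<and> j < length ds \<and> \<tau> j < \<tau> i}. msign (ds ! \<tau> i * ds ! \<tau> j))"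

definition shuffles_of :: "nat \<Rightarrow> nat \<Rightarrow> (nat \<Rightarrow> nat) set" where
  "shuffles_of l N = {\<sigma>. \<sigma> permutes {..<N} \<and> strict_mono_on {..<l} \<sigma> \<and> strict_mono_on {l..<N} \<sigma>}"


locale unital_algebra = vector_space scale
  for scale :: "'k::field \<Rightarrow> 'h::ring_1 \<Rightarrow> 'h" (infixr "*s" 75) +
  assumes scale_mult_left: "(c *s x) * y = c *s (x * y)"
    and scale_mult_right: "x * (c *s y) = c *s (x * y)"
begin

text \<open>\<open>H\<^sup>\<otimes>\<^sup>n\<close> over \<open>k\<close> for \<open>n \<ge> 1\<close>; the pure tensor \<open>h\<^sub>1 \<otimes> \<dots> \<otimes> h\<^sub>n\<close> is the list of its factors.\<close>

definition hrel :: "nat \<Rightarrow> ('h list \<Rightarrow>\<^sub>0 int) set" where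
  "hrel n =
     {frag_of (hs[i := x + y]) - frag_of (hs[i := x]) - frag_of (hs[i := y]) | hs i x y.
        length hs = n \<and> i < n} \<union>
     {frag_of (hs[i := c *s hs ! i]) - frag_of (hs[j := c *s hs ! j]) | hs i j c.
        length hs = n \<and> i < n \<and> j < n}"

definition hpow :: "nat \<Rightarrow> ('h list \<Rightarrow>\<^sub>0 int) set set" where
  "hpow n = cls (hrel n) ` {u. Poly_Mapping.keys u \<subseteq> {hs. length hs = n}}"

end


text \<open>Applies \<open>F\<close> to the factor in position \<open>i\<close>.\<close>

definition slot :: "nat \<Rightarrow> ('h \<Rightarrow> 'h list \<Rightarrow>\<^sub>0 int) \<Rightarrow> ('h list \<Rightarrow>\<^sub>0 int) \<Rightarrow> ('h list \<Rightarrow>\<^sub>0 int)" where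
  "slot i F = frag_extend (\<lambda>hs. frag_extend (\<lambda>gs. frag_of (take i hs @ gs @ drop (Suc i) hs)) (F (hs ! i)))"

locale cocommutative_hopf_algebra = unital_algebra scale
  for scale :: "'k::field \<Rightarrow> 'h::ring_1 \<Rightarrow> 'h" (infixr "*s" 75) +
  fixes \<Delta> :: "'h \<Rightarrow> ('h list \<Rightarrow>\<^sub>0 int) set"
    and \<epsilon> :: "'h \<Rightarrow> 'k"
    and S :: "'h \<Rightarrow> 'h"
  assumes comult_in: "\<Delta> h \<in> hpow 2"
    and comult_add: "\<Delta> (x + y) = cls (hrel 2) (rep (\<Delta> x) + rep (\<Delta> y))"
    and comult_scale: "\<Delta> (c *s x) = cls (hrel 2) (frag_extend (\<lambda>hs. frag_of (hs[0 := c *s hs ! 0])) (rep (\<Delta> x)))"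
    and comult_mult: "\<Delta> (x * y) =
        cls (hrel 2) (frag_extend (\<lambda>hs. frag_extend (\<lambda>gs. frag_of (map2 (*) hs gs)) (rep (\<Delta> y))) (rep (\<Delta> x)))"
    and comult_one: "\<Delta> 1 = cls (hrel 2) (frag_of [1, 1])"
    and coassoc: "cls (hrel 3) (slot 0 (\<lambda>x. rep (\<Delta> x)) (rep (\<Delta> h))) =
        cls (hrel 3) (slot 1 (\<lambda>x. rep (\<Delta> x)) (rep (\<Delta> h)))"
    and counit_add: "\<epsilon> (x + y) = \<epsilon> x + \<epsilon> y"
    and counit_scale: "\<epsilon> (c *s x) = c * \<epsilon> x"
    and counit_mult: "\<epsilon> (x * y) = \<epsilon> x * \<epsilon> y"
    and counit_one: "\<epsilon> 1 = 1"
    and counit_left: "ring_eval (\<lambda>hs. \<epsilon> (hs ! 0) *s hs ! 1) (rep (\<Delta> h)) = h"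
    and counit_right: "ring_eval (\<lambda>hs. \<epsilon> (hs ! 1) *s hs ! 0) (rep (\<Delta> h)) = h"
    and antipode_add: "S (x + y) = S x + S y"
    and antipode_scale: "S (c *s x) = c *s S x"
    and antipode_left: "ring_eval (\<lambda>hs. S (hs ! 0) * hs ! 1) (rep (\<Delta> h)) = \<epsilon> h *s 1"
    and antipode_right: "ring_eval (\<lambda>hs. hs ! 0 * S (hs ! 1)) (rep (\<Delta> h)) = \<epsilon> h *s 1"
    and cocommutative: "cls (hrel 2) (frag_extend (\<lambda>hs. frag_of (rev hs)) (rep (\<Delta> h))) = \<Delta> h"
begin

text \<open>\<open>iter_comult n h\<close> represents \<open>h\<^sub>(\<^sub>1\<^sub>) \<otimes> \<dots> \<otimes> h\<^sub>(\<^sub>n\<^sub>+\<^sub>1\<^sub>)\<close>, with \<open>n + 1\<close> factors.\<close>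

primrec iter_comult :: "nat \<Rightarrow> 'h \<Rightarrow> 'h list \<Rightarrow>\<^sub>0 int" where
  "iter_comult 0 h = frag_of [h]"
| "iter_comult (Suc n) h = slot 0 (\<lambda>x. rep (\<Delta> x)) (iter_comult n h)"

text \<open>The right action of \<open>H\<close> on \<open>H\<^sup>\<otimes>\<^sup>n\<close>, on a pure tensor.\<close>

definition ract :: "'h list \<Rightarrow> 'h \<Rightarrow> 'h list \<Rightarrow>\<^sub>0 int" where
  "ract hs h = frag_extend (\<lambda>gs. frag_of (map2 (*) hs gs)) (iter_comult (length hs - 1) h)"

end


text \<open>The \<open>k\<close>-structure of a left \<open>H\<close>-module is the one induced by \<open>k \<rightarrow> H\<close>.\<close>

locale graded_hopf_module = cocommutative_hopf_algebra scale \<Delta> \<epsilon> S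
  for scale :: "'k::field \<Rightarrow> 'h::ring_1 \<Rightarrow> 'h" (infixr "*s" 75) and \<Delta> \<epsilon> S +
  fixes act :: "'h \<Rightarrow> 'a::ab_group_add \<Rightarrow> 'a" (infixr "\<cdot>" 75)
    and A :: "int \<Rightarrow> 'a set"
  assumes act_add_right: "h \<cdot> (a + b) = h \<cdot> a + h \<cdot> b"
    and act_add_left: "(h + g) \<cdot> a = h \<cdot> a + g \<cdot> a"
    and act_mult: "(h * g) \<cdot> a = h \<cdot> (g \<cdot> a)"
    and act_one: "1 \<cdot> a = a"
    and grade_zero: "0 \<in> A d"
    and grade_add: "a \<in> A d \<Longrightarrow> b \<in> A d \<Longrightarrow> a + b \<in> A d"
    and grade_act: "a \<in> A d \<Longrightarrow> h \<cdot> a \<in> A d"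
    and direct_sum: "\<exists>!c. (\<forall>d. c d \<in> A d) \<and> finite {d. c d \<noteq> 0} \<and> a = (\<Sum>d | c d \<noteq> 0. c d)"
begin

definition hcomp :: "'a \<Rightarrow> int \<Rightarrow> 'a" where
  "hcomp a = (THE c. (\<forall>d. c d \<in> A d) \<and> finite {d. c d \<noteq> 0} \<and> a = (\<Sum>d | c d \<noteq> 0. c d))"

definition homogeneous :: "int list \<Rightarrow> 'a list \<Rightarrow> bool" where
  "homogeneous ds xs \<longleftrightarrow> list_all2 (\<lambda>d x. x \<in> A d) ds xs"

text \<open>\<open>H\<^sup>\<otimes>\<^sup>n \<otimes>\<^sub>H A\<close> for \<open>n \<ge> 1\<close>; the pair \<open>(hs, a)\<close> is the pure tensor \<open>(h\<^sub>1 \<otimes> \<dots> \<otimes> h\<^sub>n) \<otimes>\<^sub>H a\<close>.\<close>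

definition trel :: "nat \<Rightarrow> ('h list \<times> 'a \<Rightarrow>\<^sub>0 int) set" where
  "trel n =
     {frag_of (hs[i := x + y], a) - frag_of (hs[i := x], a) - frag_of (hs[i := y], a) | hs i x y a.
        length hs = n \<and> i < n} \<union>
     {frag_of (hs[i := c *s hs ! i], a) - frag_of (hs[j := c *s hs ! j], a) | hs i j c a.
        length hs = n \<and> i < n \<and> j < n} \<union>
     {frag_of (hs, a + b) - frag_of (hs, a) - frag_of (hs, b) | hs a b. length hs = n} \<union>
     {frag_extend (\<lambda>gs. frag_of (gs, a)) (ract hs h) - frag_of (hs, h \<cdot> a) | hs h a. length hs = n}"

definition tens :: "nat \<Rightarrow> ('h list \<times> 'a \<Rightarrow>\<^sub>0 int) set set" where
  "tens n = cls (trel n) ` {u. Poly_Mapping.keys u \<subseteq> {hs. length hs = n} \<times> UNIV}"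

definition tens_deg :: "nat \<Rightarrow> int \<Rightarrow> ('h list \<times> 'a \<Rightarrow>\<^sub>0 int) set set" where
  "tens_deg n d = cls (trel n) ` {u. Poly_Mapping.keys u \<subseteq> {hs. length hs = n} \<times> A d}"

definition lmult :: "'h list \<Rightarrow> ('h list \<times> 'a \<Rightarrow>\<^sub>0 int) set \<Rightarrow> ('h list \<times> 'a \<Rightarrow>\<^sub>0 int) set" where
  "lmult hs C = cls (trel (length hs)) (frag_extend (\<lambda>(gs, a). frag_of (map2 (*) hs gs, a)) (rep C))"

text \<open>\<open>\<sigma> \<otimes>\<^sub>H 1\<close>: the factor in position \<open>\<sigma> r\<close> is placed in position \<open>r\<close>.\<close>

definition perm :: "nat \<Rightarrow> (nat \<Rightarrow> nat) \<Rightarrow> ('h list \<times> 'a \<Rightarrow>\<^sub>0 int) set \<Rightarrow> ('h list \<times> 'a \<Rightarrow>\<^sub>0 int) set" where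
  "perm n \<sigma> C = cls (trel n) (frag_extend (\<lambda>(hs, a). frag_of (permute_list \<sigma> hs, a)) (rep C))"

text \<open>
  \<open>H\<^sup>\<otimes>\<^sup>n\<close>-linear maps of degree \<open>p\<close> from the \<open>n\<close>-fold tensor power of \<open>A\<close> over \<open>k\<close>, given as
  multiadditive maps on lists of length \<open>n\<close>. Linearity over \<open>k\<close> in each argument is contained in
  \<open>H\<^sup>\<otimes>\<^sup>n\<close>-linearity.
\<close>

definition polylinear :: "nat \<Rightarrow> int \<Rightarrow> ('a list \<Rightarrow> ('h list \<times> 'a \<Rightarrow>\<^sub>0 int) set) \<Rightarrow> bool" where
  "polylinear n p f \<longleftrightarrow>
     (\<forall>xs. length xs = n \<longrightarrow> f xs \<in> tens n) \<and>
     (\<forall>xs i x y. length xs = n \<longrightarrow> i < n \<longrightarrow>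
        f (xs[i := x + y]) = cls (trel n) (rep (f (xs[i := x])) + rep (f (xs[i := y])))) \<and>
     (\<forall>hs xs. length hs = n \<longrightarrow> length xs = n \<longrightarrow> f (map2 (\<cdot>) hs xs) = lmult hs (f xs)) \<and>
     (\<forall>ds xs. length xs = n \<longrightarrow> homogeneous ds xs \<longrightarrow> f xs \<in> tens_deg n (sum_list ds + p))"

text \<open>
  \<open>compose l m \<phi> \<psi> xs\<close> is \<open>\<phi>(x\<^sub>0, \<dots>, x\<^sub>m\<^sub>-\<^sub>1, \<psi>(x\<^sub>m, \<dots>, x\<^sub>m\<^sub>+\<^sub>l\<^sub>-\<^sub>1), x\<^sub>m\<^sub>+\<^sub>l, \<dots>)\<close>. Below, \<open>(hs, e)\<close> runs
  through the terms of \<open>\<psi>\<close> and \<open>(fs, b)\<close> through those of \<open>\<phi>\<close>; the factor \<open>fs ! m\<close> of the inserted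
  argument is replaced by its iterated coproduct multiplied by \<open>hs\<close> from the left.
\<close>

definition compose ::
  "nat \<Rightarrow> nat \<Rightarrow> ('a list \<Rightarrow> ('h list \<times> 'a \<Rightarrow>\<^sub>0 int) set) \<Rightarrow> ('a list \<Rightarrow> ('h list \<times> 'a \<Rightarrow>\<^sub>0 int) set) \<Rightarrow>
   'a list \<Rightarrow> ('h list \<times> 'a \<Rightarrow>\<^sub>0 int) set" where
  "compose l m \<phi> \<psi> xs = cls (trel (length xs))
     (frag_extend (\<lambda>(hs, e).
        frag_extend (\<lambda>(fs, b).
          frag_extend (\<lambda>gs. frag_of (take m fs @ gs @ drop (Suc m) fs, b)) (ract hs (fs ! m)))
        (rep (\<phi> (take m xs @ e # drop (m + l) xs))))
      (rep (\<psi> (take l (drop m xs)))))"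

definition skew_sum ::
  "(nat \<Rightarrow> 'a list \<Rightarrow> ('h list \<times> 'a \<Rightarrow>\<^sub>0 int) set) \<Rightarrow> nat \<Rightarrow> int list \<Rightarrow> 'a list \<Rightarrow> ('h list \<times> 'a \<Rightarrow>\<^sub>0 int) set" where
  "skew_sum \<mu> k ds as = lincomb (trel k) {\<sigma>. \<sigma> permutes {..<k}}
     (\<lambda>\<sigma>. sign \<sigma> * koszul (inv \<sigma>) ds)
     (\<lambda>\<sigma>. perm k \<sigma> (\<mu> k (permute_list (inv \<sigma>) as)))"

text \<open>The multiadditive extension of \<open>skew_sum\<close> from homogeneous to arbitrary arguments.\<close>

definition skew_symmetrization ::
  "(nat \<Rightarrow> 'a list \<Rightarrow> ('h list \<times> 'a \<Rightarrow>\<^sub>0 int) set) \<Rightarrow> nat \<Rightarrow> 'a list \<Rightarrow> ('h list \<times> 'a \<Rightarrow>\<^sub>0 int) set" where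
  "skew_symmetrization \<mu> k as = lincomb (trel k)
     {ds. length ds = k \<and> (\<forall>i<k. hcomp (as ! i) (ds ! i) \<noteq> 0)}
     (\<lambda>ds. 1)
     (\<lambda>ds. skew_sum \<mu> k ds (map2 hcomp as ds))"

end


text \<open>
  Here \<open>l\<close> is the arity of the inner operation and \<open>k = N + 1 - l\<close> that of the outer one.

  The sign contains the summand \<open>l N\<close>, so that it is the Stasheff sign
  \<open>(-1)^(r + l t)\<close>, \<open>r = \<lambda> - 1\<close>, \<open>t = N - l - r\<close>, up to a global factor \<open>-1\<close> and the Koszul part.
  Without \<open>l N\<close> one obtains an isomorphic notion (replace \<open>\<mu>\<^sub>k\<close> by \<open>(-1)^(k(k-1)/2) \<mu>\<^sub>k\<close>), but it does
  not fit the sign \<open>(-1)^(l(k-1))\<close> of the \<open>L\<^sub>\<infinity>\<close> identities: for \<open>N = 3\<close> and arguments of degree 0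
  annihilated by \<open>\<mu>\<^sub>1\<close>, it gives \<open>\<mu>\<^sub>1 \<mu>\<^sub>3(a,b,c) = (ab)c - a(bc)\<close>, so \<open>\<beta>\<^sub>1 \<beta>\<^sub>3\<close> and the sum of the \<open>\<beta>\<^sub>2 \<beta>\<^sub>2\<close>
  both equal the alternating sum of the associator, and the \<open>L\<^sub>\<infinity>\<close> identity would require twice
  this sum to vanish.
\<close>

locale A_infinity_pseudoalgebra = graded_hopf_module scale \<Delta> \<epsilon> S act A
  for scale :: "'k::field \<Rightarrow> 'h::ring_1 \<Rightarrow> 'h" (infixr "*s" 75) and \<Delta> \<epsilon> S
    and act :: "'h \<Rightarrow> 'a::ab_group_add \<Rightarrow> 'a" and A +
  fixes \<mu> :: "nat \<Rightarrow> 'a list \<Rightarrow> ('h list \<times> 'a \<Rightarrow>\<^sub>0 int) set"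
  assumes polylinear_mu: "k \<ge> 1 \<Longrightarrow> polylinear k (int k - 2) (\<mu> k)"
    and A_infinity_identity: "N \<ge> 1 \<Longrightarrow> length as = N \<Longrightarrow> homogeneous ds as \<Longrightarrow>
      lincomb (trel N)
        {(k, l, q). 1 \<le> k \<and> 1 \<le> l \<and> k + l = N + 1 \<and> 1 \<le> q \<and> q \<le> k}
        (\<lambda>(k, l, q). msign (int q * (int l + 1) + int l * int N + int l * sum_list (take (q - 1) ds)))
        (\<lambda>(k, l, q). compose l (q - 1) (\<mu> k) (\<mu> l) as)
      = cls (trel N) 0"


text \<open>
  In the term of \<open>\<sigma>\<close> the factor in position \<open>i\<close> is attached to \<open>x\<^bsub>\<sigma> i\<^esub>\<close>; applying \<open>perm N (inv \<sigma>)\<close>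
  puts it in position \<open>\<sigma> i\<close>, so that all terms lie in \<open>H\<^sup>\<otimes>\<^sup>N \<otimes>\<^sub>H L\<close> with the \<open>r\<close>-th factor attached
  to \<open>x\<^sub>r\<close>.
\<close>

locale L_infinity_pseudoalgebra = graded_hopf_module scale \<Delta> \<epsilon> S act L
  for scale :: "'k::field \<Rightarrow> 'h::ring_1 \<Rightarrow> 'h" (infixr "*s" 75) and \<Delta> \<epsilon> S
    and act :: "'h \<Rightarrow> 'a::ab_group_add \<Rightarrow> 'a" and L +
  fixes \<beta> :: "nat \<Rightarrow> 'a list \<Rightarrow> ('h list \<times> 'a \<Rightarrow>\<^sub>0 int) set"
  assumes polylinear_beta: "k \<ge> 1 \<Longrightarrow> polylinear k (int k - 2) (\<beta> k)"
    and skew_symmetric: "k \<ge> 1 \<Longrightarrow> length xs = k \<Longrightarrow> homogeneous ds xs \<Longrightarrow> \<sigma> permutes {..<k} \<Longrightarrow>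
      \<beta> k xs = cls (trel k)
        (frag_cmul (sign \<sigma> * koszul (inv \<sigma>) ds) (rep (perm k \<sigma> (\<beta> k (permute_list (inv \<sigma>) xs)))))"
    and L_infinity_identity: "N \<ge> 1 \<Longrightarrow> length xs = N \<Longrightarrow> homogeneous ds xs \<Longrightarrow>
      lincomb (trel N)
        {(k, l, \<sigma>). 1 \<le> k \<and> 1 \<le> l \<and> k + l = N + 1 \<and> \<sigma> \<in> shuffles_of l N}
        (\<lambda>(k, l, \<sigma>). sign \<sigma> * koszul \<sigma> ds * msign (int l * (int k - 1)))
        (\<lambda>(k, l, \<sigma>). perm N (inv \<sigma>) (compose l 0 (\<beta> k) (\<beta> l) (permute_list \<sigma> xs)))
      = cls (trel N) 0"

end

theory Submission
  imports Defs
begin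

text \<open>
  Expanding \<open>\<beta>\<^sub>k(\<beta>\<^sub>l(\<dots>), \<dots>)\<close> for a shuffle \<open>\<sigma>\<close> gives one term for each ordering \<open>\<rho>\<close> of the
  inner and each ordering \<open>\<tau>\<close> of the outer arguments. If \<open>\<tau>\<close> moves the inner operation to
  position \<open>q\<close>, the term is \<open>\<mu>\<^sub>k(\<dots>, \<mu>\<^sub>l(\<dots>), \<dots>)\<close> with the inner operation in position \<open>q\<close>, its
  arguments being reordered by some \<open>\<pi> \<in> S\<^sub>N\<close>, and \<open>(\<sigma>, \<rho>, \<tau>) \<mapsto> (\<pi>, q)\<close> is a bijection. The
  signs agree up to a global \<open>-1\<close>, because moving the inner operation past the \<open>q\<close> arguments
  before it, instead of moving its \<open>l\<close> arguments past them, changes the sign by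
  \<open>(-1)^((l + 1) q + l s)\<close>, where \<open>s\<close> is the total degree of these \<open>q\<close> arguments. Hence the
  \<open>L\<^sub>\<infinity>\<close> sum is minus the signed sum over \<open>\<pi>\<close> of the \<open>A\<^sub>\<infinity>\<close> sums for the reordered arguments.

  Composition is well defined on cosets since \<open>\<Delta>\<close> is multiplicative and coassociative, and
  permuting tensor factors is well defined since \<open>\<Delta>\<close> is also cocommutative.
\<close>

section \<open>Congruence of formal integer combinations\<close>

text \<open>Every operation is defined through \<open>rep\<close>, an unspecified choice in a coset.
  The proof therefore computes with formal sums modulo \<open>eqv\<close>, after showing once for
  each operation that it respects the relations.

  Degrees are the delicate point. The sign formula for \<open>\<beta>_k\<close> holds for
  homogeneous arguments only, but a composition applies the outer operation to every term of a
  chosen representative of the inner value, and such terms may be inhomogeneous. So the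
  representative is first exchanged for a homogeneous one. This is legitimate because
  \<open>\<beta>_k\<close> is extended to all arguments as a polylinear map, which makes the
  composition independent of the representative.

  The correcting sign arises argument by argument. Let the inner arguments have total degree
  \<open>S\<close>. The inner operation is one argument of degree \<open>S + l - 2\<close>, so an
  argument \<open>b\<close> that moves in front of it contributes the exponent
  \<open>(S + l - 2) |b| + 1\<close>; in front of the \<open>l\<close> separate arguments it
  contributes \<open>S |b| + l\<close>. These differ by \<open>l + 1 + l |b|\<close> modulo
  2.\<close>

definition eqv :: "('x \<Rightarrow>\<^sub>0 int) set \<Rightarrow> ('x \<Rightarrow>\<^sub>0 int) \<Rightarrow> ('x \<Rightarrow>\<^sub>0 int) \<Rightarrow> bool" where
  "eqv R u v \<longleftrightarrow> u - v \<in> int_frag.span R"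

lemma eqv_refl [simp, intro]: "eqv R u u"
  by (simp add: eqv_def int_frag.span_zero)

lemma eqv_sym: "eqv R u v \<Longrightarrow> eqv R v u"
  unfolding eqv_def by (metis int_frag.span_neg minus_diff_eq)

lemma eqv_trans [trans]: "eqv R u v \<Longrightarrow> eqv R v w \<Longrightarrow> eqv R u w"
  unfolding eqv_def by (drule (1) int_frag.span_add) simp

lemma eqv_trans_eq [trans]: "eqv R u v \<Longrightarrow> v = w \<Longrightarrow> eqv R u w"
  "u = v \<Longrightarrow> eqv R v w \<Longrightarrow> eqv R u w"
  by auto

lemma eqv_add: "eqv R u v \<Longrightarrow> eqv R u' v' \<Longrightarrow> eqv R (u + u') (v + v')"
  unfolding eqv_def by (drule (1) int_frag.span_add) (simp add: algebra_simps)

lemma eqv_diff: "eqv R u v \<Longrightarrow> eqv R u' v' \<Longrightarrow> eqv R (u - u') (v - v')"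
  unfolding eqv_def by (drule (1) int_frag.span_diff) (simp add: algebra_simps)

lemma frag_cmul_minus_right: "frag_cmul c (u - v) = frag_cmul c u - frag_cmul c v"
  by (metis add_diff_cancel_right' diff_add_cancel frag_cmul_distrib2)

lemma eqv_cmul: "eqv R u v \<Longrightarrow> eqv R (frag_cmul c u) (frag_cmul c v)"
  unfolding eqv_def frag_cmul_minus_right [symmetric] by (rule int_frag.span_scale)

lemma eqv_sum: "(\<And>i. i \<in> I \<Longrightarrow> eqv R (f i) (g i)) \<Longrightarrow> eqv R (sum f I) (sum g I)"
  by (induction I rule: infinite_finite_induct) (auto intro: eqv_add)

lemma eqv_base: "u - v \<in> R \<Longrightarrow> eqv R u v"
  by (simp add: eqv_def int_frag.span_base)

section \<open>Cosets and their chosen representatives\<close>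

lemma cls_eq_iff: "cls R u = cls R v \<longleftrightarrow> eqv R u v"
proof
  assume "cls R u = cls R v"
  moreover have "u \<in> cls R u" by (simp add: cls_def int_frag.span_zero)
  ultimately show "eqv R u v" by (simp add: cls_def eqv_def)
next
  assume "eqv R u v"
  then have "eqv R w u \<longleftrightarrow> eqv R w v" for w by (metis eqv_sym eqv_trans)
  then show "cls R u = cls R v" by (simp add: cls_def eqv_def)
qed

text \<open>Picking some member of the coset is all that is ever used about \<open>rep\<close>; its
  definition is unfolded nowhere else.\<close>

lemma rep_cls: "eqv R (rep (cls R u)) u"
proof -
  have "u \<in> cls R u" by (simp add: cls_def int_frag.span_zero)
  then have "rep (cls R u) \<in> cls R u" unfolding rep_def by (rule someI)
  then show ?thesis by (simp add: cls_def eqv_def)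
qed

lemma cls_rep_cls [simp]: "cls R (rep (cls R u)) = cls R u"
  by (simp add: cls_eq_iff rep_cls)

lemma rep_lincomb: "eqv R (rep (lincomb R I c f)) (\<Sum>i\<in>I. frag_cmul (c i) (rep (f i)))"
  by (simp add: lincomb_def rep_cls)

text \<open>\<open>frag_extend\<close> is the bind of the free abelian group monad, and this is its
  associativity law; it flattens the nested sums that Sweedler notation hides.\<close>

lemma frag_extend_bind:
  "frag_extend f (frag_extend g u) = frag_extend (\<lambda>x. frag_extend f (g x)) u"
  by (simp add: frag_extend_def [of g] frag_extend_def [of "\<lambda>x. frag_extend f (g x)"]
      frag_extend_sum comp_def frag_extend_cmul)

lemma frag_extend_sum_fun: "frag_extend (\<lambda>x. \<Sum>i\<in>I. f i x) u = (\<Sum>i\<in>I. frag_extend (f i) u)"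
  unfolding frag_extend_def by (subst sum.swap) (simp add: frag_cmul_sum)

lemma frag_extend_cmul_fun: "frag_extend (\<lambda>x. frag_cmul c (f x)) u = frag_cmul c (frag_extend f u)"
  by (simp add: frag_extend_def frag_cmul_sum mult.commute)

lemma frag_extend_add_fun: "frag_extend (\<lambda>x. f x + g x) u = frag_extend f u + frag_extend g u"
  by (simp add: frag_extend_def frag_cmul_distrib2 sum.distrib)

text \<open>Fubini for formal sums: two independent expansions may be done in either order.\<close>

lemma frag_extend_swap:
  "frag_extend (\<lambda>x. frag_extend (\<lambda>y. f x y) v) u = frag_extend (\<lambda>y. frag_extend (\<lambda>x. f x y) u) v"
  unfolding frag_extend_def [of _ v] frag_extend_sum_fun frag_extend_cmul_fun ..

lemma frag_extend_sum': "frag_extend f (\<Sum>i\<in>I. g i) = (\<Sum>i\<in>I. frag_extend f (g i))"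
  by (induction I rule: infinite_finite_induct) (auto simp: frag_extend_add)

lemma frag_extend_frag_of [simp]: "frag_extend frag_of u = u"
  by (rule frag_expansion [symmetric])

lemma frag_extend_eqv:
  assumes "\<And>x. x \<in> Poly_Mapping.keys u \<Longrightarrow> eqv R (f x) (g x)"
  shows "eqv R (frag_extend f u) (frag_extend g u)"
  unfolding frag_extend_def using assms by (intro eqv_sum eqv_cmul) auto

lemma frag_extend_span:
  assumes "\<And>r. r \<in> Q \<Longrightarrow> frag_extend f r \<in> int_frag.span R" and "u \<in> int_frag.span Q"
  shows "frag_extend f u \<in> int_frag.span R"
  using assms(2)
proof (induction rule: int_frag.span_induct_alt)
  case base
  then show ?case by (simp add: int_frag.span_zero)
next
  case (step c x y)
  then show ?case
    by (simp add: frag_extend_add frag_extend_cmul int_frag.span_add int_frag.span_scale assms(1))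
qed

text \<open>The universal property of a quotient: an additive map descends once it kills the
  generating relations. The well-definedness lemmas for \<open>slot\<close>, \<open>tperm\<close>,
  \<open>tmult\<close> and \<open>insert_at\<close> all go through this.\<close>

lemma frag_extend_respects:
  assumes "\<And>r. r \<in> Q \<Longrightarrow> frag_extend f r \<in> int_frag.span R" and "eqv Q u v"
  shows "eqv R (frag_extend f u) (frag_extend f v)"
  using frag_extend_span [OF assms(1), where u = "u - v"] assms(2)
  by (auto simp: eqv_def frag_extend_diff)

lemma keys_span:
  assumes "\<And>r. r \<in> R \<Longrightarrow> Poly_Mapping.keys r \<subseteq> K" and "u \<in> int_frag.span R"
  shows "Poly_Mapping.keys u \<subseteq> K"
  using assms(2)
proof (induction rule: int_frag.span_induct_alt)
  case base
  then show ?case by simp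
next
  case (step c x y)
  have "Poly_Mapping.keys (frag_cmul c x) \<subseteq> K" using assms(1) [OF step(1)] keys_cmul by blast
  then show ?case using step(2) Poly_Mapping.keys_add [of "frag_cmul c x" y] by blast
qed

text \<open>A representative chosen by \<open>rep\<close> is unknown, but the relations only involve
  lists of the right length, so support in such lists passes from one representative to all
  others.\<close>

lemma keys_eqv:
  assumes "\<And>r. r \<in> R \<Longrightarrow> Poly_Mapping.keys r \<subseteq> K" and "eqv R u v" and "Poly_Mapping.keys v \<subseteq> K"
  shows "Poly_Mapping.keys u \<subseteq> K"
proof -
  have "Poly_Mapping.keys (u - v) \<subseteq> K" using assms(1,2) keys_span unfolding eqv_def by blast
  then have "Poly_Mapping.keys ((u - v) + v) \<subseteq> K"
    using assms(3) Poly_Mapping.keys_add [of "u - v" v] by blast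
  then show ?thesis by simp
qed

lemma keys_frag_extend_subset:
  assumes "\<And>x. x \<in> Poly_Mapping.keys u \<Longrightarrow> Poly_Mapping.keys (f x) \<subseteq> K"
  shows "Poly_Mapping.keys (frag_extend f u) \<subseteq> K"
  using keys_frag_extend [of f u] assms by blast

lemma keys_sum_subset:
  assumes "\<And>i. i \<in> I \<Longrightarrow> Poly_Mapping.keys (f i) \<subseteq> K"
  shows "Poly_Mapping.keys (sum f I) \<subseteq> K"
  using Poly_Mapping.keys_sum [of f I] assms by blast

lemma keys_diff_subset:
  "Poly_Mapping.keys u \<subseteq> K \<Longrightarrow> Poly_Mapping.keys v \<subseteq> K \<Longrightarrow> Poly_Mapping.keys (u - v) \<subseteq> K"
  using keys_diff [of u v] by blast

section \<open>Tensor powers of an algebra\<close>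

lemma keys_frag_ofE: "x \<in> Poly_Mapping.keys (frag_of a) \<Longrightarrow> x = a"
  by (simp add: keys_frag_of)

lemma map2_update_right:
  "length hs = length gs \<Longrightarrow> i < length gs \<Longrightarrow> map2 f hs (gs[i := x]) = (map2 f hs gs)[i := f (hs ! i) x]"
  by (rule nth_equalityI) (auto simp: nth_list_update)

lemma map2_update_left:
  "length hs = length gs \<Longrightarrow> i < length gs \<Longrightarrow> map2 f (hs[i := x]) gs = (map2 f hs gs)[i := f x (gs ! i)]"
  by (rule nth_equalityI) (auto simp: nth_list_update)

text \<open>\<open>permute_list \<sigma>\<close> reads entry \<open>\<sigma> j\<close> in position
  \<open>j\<close>, so entry \<open>i\<close> reappears in position
  \<open>inv \<sigma> i\<close>.\<close>

lemma permute_list_update: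
  assumes "\<sigma> permutes {..<length hs}" "i < length hs"
  shows "permute_list \<sigma> (hs[i := x]) = (permute_list \<sigma> hs)[inv \<sigma> i := x]"
proof (rule nth_equalityI)
  fix j assume "j < length (permute_list \<sigma> (hs[i := x]))"
  then have j: "j < length hs" by simp
  have "\<sigma> j < length hs" using permutes_in_image [OF assms(1)] j by auto
  moreover have "\<sigma> j = i \<longleftrightarrow> j = inv \<sigma> i" using permutes_inverses [OF assms(1)] by metis
  ultimately show "permute_list \<sigma> (hs[i := x]) ! j = (permute_list \<sigma> hs)[inv \<sigma> i := x] ! j"
    using j by (auto simp: permute_list_def nth_list_update)
qed simp

lemma map2_permute_list:
  assumes "\<sigma> permutes {..<length hs}" "length gs = length hs"
  shows "map2 f (permute_list \<sigma> hs) (permute_list \<sigma> gs) = permute_list \<sigma> (map2 f hs gs)"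
proof (rule nth_equalityI)
  fix j assume "j < length (map2 f (permute_list \<sigma> hs) (permute_list \<sigma> gs))"
  then have j: "j < length hs" using assms by simp
  have "\<sigma> j < length hs" using permutes_in_image [OF assms(1)] j by auto
  then show "map2 f (permute_list \<sigma> hs) (permute_list \<sigma> gs) ! j = permute_list \<sigma> (map2 f hs gs) ! j"
    using j assms by (auto simp: permute_list_def)
qed (use assms in simp)

abbreviation perm_frag :: "(nat \<Rightarrow> nat) \<Rightarrow> ('b list \<Rightarrow>\<^sub>0 int) \<Rightarrow> ('b list \<Rightarrow>\<^sub>0 int)" where
  "perm_frag \<sigma> \<equiv> frag_extend (\<lambda>hs. frag_of (permute_list \<sigma> hs))"

section \<open>Expanding one tensor factor into several\<close>

lemma slot_frag_of: "slot i F (frag_of hs) =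
    frag_extend (\<lambda>gs. frag_of (take i hs @ gs @ drop (Suc i) hs)) (F (hs ! i))"
  by (simp add: slot_def)

lemma slot_extend: "slot i F u = frag_extend (\<lambda>hs. slot i F (frag_of hs)) u"
  by (simp add: slot_def)

lemma slot_add: "slot i F (u + v) = slot i F u + slot i F v"
  by (simp add: slot_def frag_extend_add)

lemma keys_slot:
  assumes "Poly_Mapping.keys u \<subseteq> {hs. length hs = Suc n}" "i \<le> n"
    and "\<And>h. Poly_Mapping.keys (F h) \<subseteq> {gs. length gs = p}"
  shows "Poly_Mapping.keys (slot i F u) \<subseteq> {hs. length hs = n + p}"
  unfolding slot_def
proof (intro keys_frag_extend_subset subsetI)
  fix hs gs ks assume "hs \<in> Poly_Mapping.keys u" "gs \<in> Poly_Mapping.keys (F (hs ! i))"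
    and ks: "ks \<in> Poly_Mapping.keys (frag_of (take i hs @ gs @ drop (Suc i) hs))"
  then have "length hs = Suc n" "length gs = p" using assms by auto
  then show "ks \<in> {hs. length hs = n + p}" using keys_frag_ofE [OF ks] \<open>i \<le> n\<close> by simp
qed

text \<open>Sequential composition as in an operad: output \<open>j\<close> of \<open>G\<close> ends
  up in position \<open>i + j\<close>.\<close>

lemma slot_slot_same:
  assumes "Poly_Mapping.keys u \<subseteq> {hs. length hs = Suc n}" "i \<le> n"
    and "\<And>h. Poly_Mapping.keys (G h) \<subseteq> {gs. length gs = p}" "j < p"
  shows "slot (i + j) F (slot i G u) = slot i (\<lambda>x. slot j F (G x)) u"
  unfolding slot_def frag_extend_bind
proof (intro frag_extend_eq)
  fix hs gs
  assume h: "hs \<in> Poly_Mapping.keys u" "gs \<in> Poly_Mapping.keys (G (hs ! i))"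
  have l: "length hs = Suc n" "length gs = p" using h assms by auto
  have "(take i hs @ gs @ drop (Suc i) hs) ! (i + j) = gs ! j"
    using l assms by (simp add: nth_append)
  moreover have "take (i + j) (take i hs @ gs @ drop (Suc i) hs) = take i hs @ take j gs"
    using l assms by simp
  moreover have "drop (Suc (i + j)) (take i hs @ gs @ drop (Suc i) hs) =
      drop (Suc j) gs @ drop (Suc i) hs"
    using l assms by (simp add: Suc_diff_le)
  ultimately show "frag_extend (\<lambda>hs. frag_extend
      (\<lambda>gs. frag_of (take (i + j) hs @ gs @ drop (Suc (i + j)) hs)) (F (hs ! (i + j))))
        (frag_of (take i hs @ gs @ drop (Suc i) hs)) =
       frag_extend (\<lambda>x. frag_extend (\<lambda>gs. frag_of (take i hs @ gs @ drop (Suc i) hs))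
           (frag_of (take j gs @ x @ drop (Suc j) gs))) (F (gs ! j))"
    by simp
qed

text \<open>Parallel composition as in an operad: expanding the earlier factor \<open>i\<close> into
  \<open>Suc p\<close> factors pushes factor \<open>j\<close> to \<open>j + p\<close>.\<close>

lemma slot_slot_swap:
  assumes "Poly_Mapping.keys u \<subseteq> {hs. length hs = Suc n}" "i < j" "j \<le> n"
    and "\<And>h. Poly_Mapping.keys (G h) \<subseteq> {gs. length gs = Suc p}"
  shows "slot (j + p) F (slot i G u) = slot i G (slot j F u)"
  unfolding slot_def frag_extend_bind
proof (intro frag_extend_eq)
  fix hs assume h: "hs \<in> Poly_Mapping.keys u"
  have l: "length hs = Suc n" using h assms by auto
  let ?f = "\<lambda>gs ks. take i hs @ gs @ drop (Suc i) (take j hs) @ ks @ drop (Suc j) hs"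
  have "frag_extend (\<lambda>gs. frag_extend (\<lambda>hs. frag_extend
      (\<lambda>gs. frag_of (take (j + p) hs @ gs @ drop (Suc (j + p)) hs)) (F (hs ! (j + p))))
           (frag_of (take i hs @ gs @ drop (Suc i) hs))) (G (hs ! i)) =
     frag_extend (\<lambda>gs. frag_extend (\<lambda>ks. frag_of (?f gs ks)) (F (hs ! j))) (G (hs ! i))"
  proof (intro frag_extend_eq)
    fix gs assume "gs \<in> Poly_Mapping.keys (G (hs ! i))"
    then have "length gs = Suc p" using assms by auto
    moreover have "j - Suc i + Suc i = j" using assms by simp
    ultimately have "(take i hs @ gs @ drop (Suc i) hs) ! (j + p) = hs ! j"
      "take (j + p) (take i hs @ gs @ drop (Suc i) hs) = take i hs @ gs @ drop (Suc i) (take j hs)"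
      "drop (Suc (j + p)) (take i hs @ gs @ drop (Suc i) hs) = drop (Suc j) hs"
      using l assms by (auto simp add: nth_append drop_take)
    then show "frag_extend (\<lambda>hs. frag_extend
        (\<lambda>gs. frag_of (take (j + p) hs @ gs @ drop (Suc (j + p)) hs)) (F (hs ! (j + p))))
           (frag_of (take i hs @ gs @ drop (Suc i) hs)) =
               frag_extend (\<lambda>ks. frag_of (?f gs ks)) (F (hs ! j))"
      by simp
  qed
  also have "\<dots> = frag_extend (\<lambda>ks. frag_extend (\<lambda>gs. frag_of (?f gs ks)) (G (hs ! i))) (F (hs ! j))"
    by (rule frag_extend_swap)
  also have "\<dots> = frag_extend (\<lambda>ks. frag_extend
      (\<lambda>hs. frag_extend (\<lambda>gs. frag_of (take i hs @ gs @ drop (Suc i) hs)) (G (hs ! i)))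
              (frag_of (take j hs @ ks @ drop (Suc j) hs))) (F (hs ! j))"
  proof (intro frag_extend_eq)
    fix ks
    have "(take j hs @ ks @ drop (Suc j) hs) ! i = hs ! i"
      "take i (take j hs @ ks @ drop (Suc j) hs) = take i hs"
      "drop (Suc i) (take j hs @ ks @ drop (Suc j) hs) = drop (Suc i) (take j hs) @ ks @ drop (Suc j) hs"
      using l assms by (auto simp add: nth_append min_def)
    then show "frag_extend (\<lambda>gs. frag_of (?f gs ks)) (G (hs ! i)) =
      frag_extend (\<lambda>hs. frag_extend (\<lambda>gs. frag_of (take i hs @ gs @ drop (Suc i) hs)) (G (hs ! i)))
              (frag_of (take j hs @ ks @ drop (Suc j) hs))" by simp
  qed
  finally show "frag_extend (\<lambda>gs. frag_extend
      (\<lambda>hs. frag_extend (\<lambda>gs. frag_of (take (j + p) hs @ gs @ drop (Suc (j + p)) hs)) (F (hs ! (j + p))))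
           (frag_of (take i hs @ gs @ drop (Suc i) hs))) (G (hs ! i)) =
     frag_extend (\<lambda>ks. frag_extend (\<lambda>hs. frag_extend (\<lambda>gs. frag_of (take i hs @ gs @ drop (Suc i) hs))
         (G (hs ! i)))
              (frag_of (take j hs @ ks @ drop (Suc j) hs))) (F (hs ! j))" .
qed

section \<open>Multilinear maps on tensor powers\<close>

context unital_algebra
begin

lemma hrel_add:
  "length hs = n \<Longrightarrow> i < n \<Longrightarrow>
    eqv (hrel n) (frag_of (hs[i := x + y])) (frag_of (hs[i := x]) + frag_of (hs[i := y]))"
  unfolding hrel_def by (rule eqv_base) (auto simp: diff_diff_eq)

lemma hrel_scale:
  "length hs = n \<Longrightarrow> i < n \<Longrightarrow> j < n \<Longrightarrow>
    eqv (hrel n) (frag_of (hs[i := c *s hs ! i])) (frag_of (hs[j := c *s hs ! j]))"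
  unfolding hrel_def by (rule eqv_base, rule UnI2) blast

lemma keys_hrel:
  assumes "r \<in> hrel n"
  shows "Poly_Mapping.keys r \<subseteq> {hs. length hs = n}"
  using assms unfolding hrel_def
  by (auto simp: keys_frag_of dest!: subsetD [OF keys_diff])

lemmas keys_eqv_hrel = keys_eqv [OF keys_hrel]

text \<open>The target is only a free abelian group, without scalars, so linearity over
  \<open>k\<close> cannot be required of \<open>f\<close> directly. As in \<open>hrel\<close>, it is
  replaced by the freedom to move a scalar from one factor to another.\<close>

definition mlin :: "nat \<Rightarrow> ('x \<Rightarrow>\<^sub>0 int) set \<Rightarrow> ('h list \<Rightarrow> ('x \<Rightarrow>\<^sub>0 int)) \<Rightarrow> bool" where
  "mlin n R f \<longleftrightarrow> (\<forall>hs i. length hs = n \<longrightarrow> i < n \<longrightarrow>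
     (\<forall>x y. eqv R (f (hs[i := x + y])) (f (hs[i := x]) + f (hs[i := y]))) \<and>
     (\<forall>j c. j < n \<longrightarrow> eqv R (f (hs[i := c *s hs ! i])) (f (hs[j := c *s hs ! j]))))"

lemma mlinI:
  assumes "\<And>hs i x y. length hs = n \<Longrightarrow> i < n \<Longrightarrow>
      eqv R (f (hs[i := x + y])) (f (hs[i := x]) + f (hs[i := y]))"
    and "\<And>hs i j c. length hs = n \<Longrightarrow> i < n \<Longrightarrow> j < n \<Longrightarrow>
        eqv R (f (hs[i := c *s hs ! i])) (f (hs[j := c *s hs ! j]))"
  shows "mlin n R f"
  using assms unfolding mlin_def by blast

lemma mlin_respects:
  assumes "mlin n R f" "eqv (hrel n) u v"
  shows "eqv R (frag_extend f u) (frag_extend f v)"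
proof (rule frag_extend_respects [OF _ assms(2)])
  fix r assume "r \<in> hrel n"
  then show "frag_extend f r \<in> int_frag.span R"
    using assms(1) unfolding hrel_def mlin_def eqv_def
    by (auto simp: frag_extend_diff frag_extend_add diff_diff_eq)
qed

lemma mlin_cong:
  assumes "mlin n R f" "\<And>hs. length hs = n \<Longrightarrow> eqv R (f hs) (g hs)"
  shows "mlin n R g"
proof (rule mlinI)
  fix hs :: "'h list" and i x y assume *: "length hs = n" "i < n"
  have "eqv R (g (hs[i := x + y])) (f (hs[i := x + y]))" using assms(2) * by (simp add: eqv_sym)
  also have "eqv R \<dots> (f (hs[i := x]) + f (hs[i := y]))" using assms(1) * by (auto simp: mlin_def)
  also have "eqv R \<dots> (g (hs[i := x]) + g (hs[i := y]))" using assms(2) * by (simp add: eqv_add)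
  finally show "eqv R (g (hs[i := x + y])) (g (hs[i := x]) + g (hs[i := y]))" .
next
  fix hs :: "'h list" and i j c assume *: "length hs = n" "i < n" "j < n"
  have "eqv R (g (hs[i := c *s hs ! i])) (f (hs[i := c *s hs ! i]))" using assms(2) *
      by (simp add: eqv_sym)
  also have "eqv R \<dots> (f (hs[j := c *s hs ! j]))" using assms(1) * by (auto simp: mlin_def)
  also have "eqv R \<dots> (g (hs[j := c *s hs ! j]))" using assms(2) * by simp
  finally show "eqv R (g (hs[i := c *s hs ! i])) (g (hs[j := c *s hs ! j]))" .
qed

lemma mlin_frag_extend:
  assumes "\<And>g. g \<in> Poly_Mapping.keys u \<Longrightarrow> mlin n R (F g)"
  shows "mlin n R (\<lambda>hs. frag_extend (\<lambda>g. F g hs) u)"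
  using assms unfolding mlin_def frag_extend_add_fun [symmetric]
  by (intro allI impI conjI frag_extend_eqv) auto

lemma mlin_comp:
  assumes "mlin n (hrel m) f" "mlin m R g"
  shows "mlin n R (\<lambda>hs. frag_extend g (f hs))"
proof (rule mlinI)
  fix hs :: "'h list" and i x y assume *: "length hs = n" "i < n"
  show "eqv R (frag_extend g (f (hs[i := x + y])))
      (frag_extend g (f (hs[i := x])) + frag_extend g (f (hs[i := y])))"
    unfolding frag_extend_add [symmetric]
    by (rule mlin_respects [OF assms(2)]) (use assms(1) * in \<open>auto simp: mlin_def\<close>)
next
  fix hs :: "'h list" and i j c assume *: "length hs = n" "i < n" "j < n"
  show "eqv R (frag_extend g (f (hs[i := c *s hs ! i]))) (frag_extend g (f (hs[j := c *s hs ! j])))"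
    by (rule mlin_respects [OF assms(2)]) (use assms(1) * in \<open>auto simp: mlin_def\<close>)
qed

lemma mlin_append:
  assumes "length as + n + length bs = m"
  shows "mlin n (hrel m) (\<lambda>hs. frag_of (as @ hs @ bs))"
proof (rule mlinI)
  fix hs :: "'h list" and i x y assume *: "length hs = n" "i < n"
  have "as @ hs[i := z] @ bs = (as @ hs @ bs)[length as + i := z]" for z
    using * by (simp add: list_update_append)
  then show "eqv (hrel m) (frag_of (as @ hs[i := x + y] @ bs))
      (frag_of (as @ hs[i := x] @ bs) + frag_of (as @ hs[i := y] @ bs))"
    using * assms by (simp add: hrel_add)
next
  fix hs :: "'h list" and i j c assume *: "length hs = n" "i < n" "j < n"
  have "as @ hs[i := c *s hs ! i] @ bs =
      (as @ hs @ bs)[length as + i := c *s (as @ hs @ bs) ! (length as + i)]" 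
    if "i < n" for i using * that by (simp add: list_update_append nth_append)
  from this [OF *(2)] this [OF *(3)]
  show "eqv (hrel m) (frag_of (as @ hs[i := c *s hs ! i] @ bs))
      (frag_of (as @ hs[j := c *s hs ! j] @ bs))"
    using * assms hrel_scale [of "as @ hs @ bs" m "length as + i" "length as + j" c] by simp
qed

lemma mlin_mult_left:
  assumes "length hs = n"
  shows "mlin n (hrel n) (\<lambda>gs. frag_of (map2 (*) hs gs))"
proof (rule mlinI)
  fix gs :: "'h list" and i x y assume *: "length gs = n" "i < n"
  then show "eqv (hrel n) (frag_of (map2 (*) hs (gs[i := x + y])))
      (frag_of (map2 (*) hs (gs[i := x])) + frag_of (map2 (*) hs (gs[i := y])))"
    using assms by (simp add: map2_update_right distrib_left hrel_add)
next
  fix gs :: "'h list" and i j c assume *: "length gs = n" "i < n" "j < n"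
  have "map2 (*) hs (gs[i := c *s gs ! i]) =
      (map2 (*) hs gs)[i := c *s (map2 (*) hs gs) ! i]" if "i < n" for i
    using assms * that by (simp add: map2_update_right scale_mult_right)
  from this [OF *(2)] this [OF *(3)]
  show "eqv (hrel n) (frag_of (map2 (*) hs (gs[i := c *s gs ! i])))
      (frag_of (map2 (*) hs (gs[j := c *s gs ! j])))"
    using assms * hrel_scale [of "map2 (*) hs gs" n i j c] by simp
qed

lemma mlin_mult_right:
  assumes "length hs = n"
  shows "mlin n (hrel n) (\<lambda>gs. frag_of (map2 (*) gs hs))"
proof (rule mlinI)
  fix gs :: "'h list" and i x y assume *: "length gs = n" "i < n"
  then show "eqv (hrel n) (frag_of (map2 (*) (gs[i := x + y]) hs))
      (frag_of (map2 (*) (gs[i := x]) hs) + frag_of (map2 (*) (gs[i := y]) hs))"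
    using assms by (simp add: map2_update_left distrib_right hrel_add)
next
  fix gs :: "'h list" and i j c assume *: "length gs = n" "i < n" "j < n"
  have "map2 (*) (gs[i := c *s gs ! i]) hs =
      (map2 (*) gs hs)[i := c *s (map2 (*) gs hs) ! i]" if "i < n" for i
    using assms * that by (simp add: map2_update_left scale_mult_left)
  from this [OF *(2)] this [OF *(3)]
  show "eqv (hrel n) (frag_of (map2 (*) (gs[i := c *s gs ! i]) hs))
      (frag_of (map2 (*) (gs[j := c *s gs ! j]) hs))"
    using assms * hrel_scale [of "map2 (*) gs hs" n i j c] by simp
qed

lemma mlin_permute:
  assumes \<sigma>: "\<sigma> permutes {..<n}"
  shows "mlin n (hrel n) (\<lambda>hs. frag_of (permute_list \<sigma> hs))"
proof (rule mlinI)
  fix hs :: "'h list" and i x y assume *: "length hs = n" "i < n"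
  have "inv \<sigma> i < n" using permutes_in_image [OF permutes_inv [OF \<sigma>]] * by auto
  then show "eqv (hrel n) (frag_of (permute_list \<sigma> (hs[i := x + y])))
      (frag_of (permute_list \<sigma> (hs[i := x])) + frag_of (permute_list \<sigma> (hs[i := y])))"
    using * \<sigma> by (simp add: permute_list_update hrel_add)
next
  fix hs :: "'h list" and i j c assume *: "length hs = n" "i < n" "j < n"
  have in_n: "inv \<sigma> i < n" if "i < n" for i using permutes_in_image [OF permutes_inv [OF \<sigma>]] that by auto
  have "permute_list \<sigma> (hs[i := c *s hs ! i]) =
      (permute_list \<sigma> hs)[inv \<sigma> i := c *s (permute_list \<sigma> hs) ! inv \<sigma> i]" if "i < n" for i
    using * that \<sigma> in_n [OF that] permutes_inverses(1) [OF \<sigma>]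
      by (simp add: permute_list_update permute_list_nth)
  from this [OF *(2)] this [OF *(3)]
  show "eqv (hrel n) (frag_of (permute_list \<sigma> (hs[i := c *s hs ! i])))
      (frag_of (permute_list \<sigma> (hs[j := c *s hs ! j])))"
    using * in_n hrel_scale [of "permute_list \<sigma> hs" n "inv \<sigma> i" "inv \<sigma> j" c] by simp
qed

section \<open>Componentwise multiplication and its interaction with expansion of a factor\<close>

definition hmul :: "('h list \<Rightarrow>\<^sub>0 int) \<Rightarrow> ('h list \<Rightarrow>\<^sub>0 int) \<Rightarrow> ('h list \<Rightarrow>\<^sub>0 int)" where
  "hmul u v = frag_extend (\<lambda>hs. frag_extend (\<lambda>gs. frag_of (map2 (*) hs gs)) v) u"

lemma keys_hmul:
  assumes "Poly_Mapping.keys u \<subseteq> {hs. length hs = n}" "Poly_Mapping.keys v \<subseteq> {hs. length hs = n}"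
  shows "Poly_Mapping.keys (hmul u v) \<subseteq> {hs. length hs = n}"
  unfolding hmul_def
proof (intro keys_frag_extend_subset)
  fix hs gs assume "hs \<in> Poly_Mapping.keys u" "gs \<in> Poly_Mapping.keys v"
  then have "length hs = n" "length gs = n" using assms by auto
  then show "Poly_Mapping.keys (frag_of (map2 (*) hs gs)) \<subseteq> {hs. length hs = n}"
      by (simp add: keys_frag_of)
qed

lemma hmul_right:
  assumes "Poly_Mapping.keys u \<subseteq> {hs. length hs = n}" "eqv (hrel n) v v'"
  shows "eqv (hrel n) (hmul u v) (hmul u v')"
  unfolding hmul_def
  by (intro frag_extend_eqv mlin_respects [OF mlin_mult_left assms(2)]) (use assms in auto)

lemma hmul_frag_of: "hmul (frag_of hs) (frag_of gs) = frag_of (map2 (*) hs gs)"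
  by (simp add: hmul_def)

lemma map2_mult_assoc:
  "map2 (*) (map2 (*) hs gs) ks = map2 (*) hs (map2 (*) gs (ks :: 'h list))"
  by (induction hs arbitrary: gs ks) (auto simp: zip_Cons1 mult.assoc split: list.splits)

lemma hmul_assoc: "hmul (hmul u v) w = hmul u (hmul v w)"
  unfolding hmul_def by (simp add: frag_extend_bind map2_mult_assoc)

lemma hmul_perm:
  assumes \<sigma>: "\<sigma> permutes {..<n}"
    and "Poly_Mapping.keys u \<subseteq> {hs. length hs = n}" "Poly_Mapping.keys v \<subseteq> {hs. length hs = n}"
  shows "hmul (perm_frag \<sigma> u) (perm_frag \<sigma> v) = perm_frag \<sigma> (hmul u v)"
  unfolding hmul_def frag_extend_bind frag_extend_of
proof (intro frag_extend_eq)
  fix hs gs assume "hs \<in> Poly_Mapping.keys u" "gs \<in> Poly_Mapping.keys v"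
  then have "length hs = n" "length gs = n" using assms by auto
  then show "frag_of (map2 (*) (permute_list \<sigma> hs) (permute_list \<sigma> gs)) =
      frag_of (permute_list \<sigma> (map2 (*) hs gs))"
    using \<sigma> by (simp add: map2_permute_list)
qed

text \<open>Linearity over \<open>k\<close> of a map into \<open>H\<^sup>\<otimes>\<^sup>p\<close>; the factor carrying the scalar is immaterial modulo
  \<open>hrel p\<close>.\<close>

definition hlin :: "nat \<Rightarrow> ('h \<Rightarrow> 'h list \<Rightarrow>\<^sub>0 int) \<Rightarrow> bool" where
  "hlin p F \<longleftrightarrow> 0 < p \<and> (\<forall>h. Poly_Mapping.keys (F h) \<subseteq> {gs. length gs = p}) \<and>
     (\<forall>x y. eqv (hrel p) (F (x + y)) (F x + F y)) \<and>
     (\<forall>c x. eqv (hrel p) (F (c *s x)) (frag_extend (\<lambda>gs. frag_of (gs[0 := c *s gs ! 0])) (F x)))"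

text \<open>A scalar attached to input factor \<open>j\<close> is compared with a normal form, the
  same scalar in output position \<open>i\<close>; two such comparisons move it between arbitrary
  factors.\<close>

lemma mlin_slot:
  assumes F: "hlin p F" and i: "i \<le> n"
  shows "mlin (Suc n) (hrel (n + p)) (\<lambda>hs. slot i F (frag_of hs))"
proof -
  let ?L = "\<lambda>hs gs. take i hs @ gs @ drop (Suc i) hs"
  let ?T = "\<lambda>hs c. frag_extend (\<lambda>gs. frag_of ((?L hs gs)[i := c *s (?L hs gs) ! i])) (F (hs ! i))"
  have p: "0 < p" and kF: "\<And>h. Poly_Mapping.keys (F h) \<subseteq> {gs. length gs = p}" using F
      by (auto simp: hlin_def)
  have ml: "mlin p (hrel (n + p)) (\<lambda>gs. frag_of (?L hs gs))" if "length hs = Suc n" for hs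
    by (rule mlin_append) (use that i in auto)
  \<comment> \<open>A factor other than \<open>i\<close> keeps its position if it comes before
    \<open>i\<close>; otherwise \<open>p\<close> factors in place of one shift it by
    \<open>p - 1\<close>.\<close>
  have upd: "?L (hs[j := x]) gs = (?L hs gs)[(if j < i then j else j - 1 + p) := x]"
    if "length hs = Suc n" "j < Suc n" "j \<noteq> i" "length gs = p" for hs j x gs
    using that i
    by (cases "j < i") (auto simp: list_update_append drop_update_swap take_update_swap
      list_update_beyond)
  have nth: "(?L hs gs) ! (if j < i then j else j - 1 + p) = hs ! j"
    if "length hs = Suc n" "j < Suc n" "j \<noteq> i" "length gs = p" for hs j gs
    using that i by (auto simp: nth_append)
  have len: "length (?L hs gs) = n + p" if "length hs = Suc n" "length gs = p" for hs gs
    using that i by simp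
  have T: "eqv (hrel (n + p)) (slot i F (frag_of (hs[j := c *s hs ! j]))) (?T hs c)"
    if *: "length hs = Suc n" "j < Suc n" for hs j c
  proof (cases "j = i")
    case True
    have "slot i F (frag_of (hs[j := c *s hs ! j])) =
        frag_extend (\<lambda>gs. frag_of (?L hs gs)) (F (c *s hs ! i))"
      using True * by (simp add: slot_frag_of)
    also have "eqv (hrel (n + p)) \<dots> (frag_extend (\<lambda>gs. frag_of (?L hs gs))
        (frag_extend (\<lambda>gs. frag_of (gs[0 := c *s gs ! 0])) (F (hs ! i))))"
      by (rule mlin_respects [OF ml [OF *(1)]]) (use F in \<open>auto simp: hlin_def\<close>)
    also have "\<dots> = ?T hs c"
      unfolding frag_extend_bind frag_extend_of
    proof (rule frag_extend_eq)
      fix gs assume "gs \<in> Poly_Mapping.keys (F (hs ! i))"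
      then have "length gs = p" using kF by auto
      then show "frag_of (?L hs (gs[0 := c *s gs ! 0])) = frag_of ((?L hs gs)[i := c *s (?L hs gs) ! i])"
        using * i p by (simp add: list_update_append nth_append)
    qed
    finally show ?thesis .
  next
    case False
    have "slot i F (frag_of (hs[j := c *s hs ! j])) =
        frag_extend (\<lambda>gs. frag_of (?L (hs[j := c *s hs ! j]) gs)) (F (hs ! i))"
      using False * by (simp add: slot_frag_of)
    also have "eqv (hrel (n + p)) \<dots> (?T hs c)"
    proof (rule frag_extend_eqv)
      fix gs assume "gs \<in> Poly_Mapping.keys (F (hs ! i))"
      then have gs: "length gs = p" using kF by auto
      let ?j = "if j < i then j else j - 1 + p"
      have "?j < n + p" using False * i by auto
      have "eqv (hrel (n + p)) (frag_of ((?L hs gs)[?j := c *s (?L hs gs) ! ?j]))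
          (frag_of ((?L hs gs)[i := c *s (?L hs gs) ! i]))"
        using len [OF *(1) gs] \<open>?j < n + p\<close> i p by (intro hrel_scale) auto
      then show "eqv (hrel (n + p)) (frag_of (?L (hs[j := c *s hs ! j]) gs))
          (frag_of ((?L hs gs)[i := c *s (?L hs gs) ! i]))"
        unfolding upd [OF * False gs] nth [OF * False gs] .
    qed
    finally show ?thesis .
  qed
  show ?thesis
  proof (rule mlinI)
    fix hs :: "'h list" and j x y assume *: "length hs = Suc n" "j < Suc n"
    show "eqv (hrel (n + p)) (slot i F (frag_of (hs[j := x + y])))
        (slot i F (frag_of (hs[j := x])) + slot i F (frag_of (hs[j := y])))"
    proof (cases "j = i")
      case True
      show ?thesis
        using * True mlin_respects [OF ml [OF *(1)], of "F (x + y)" "F x + F y"] F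
        by (simp add: slot_frag_of frag_extend_add hlin_def)
    next
      case False
      have "eqv (hrel (n + p)) (frag_extend (\<lambda>gs. frag_of (?L (hs[j := x + y]) gs)) (F (hs ! i)))
        (frag_extend (\<lambda>gs. frag_of (?L (hs[j := x]) gs) + frag_of (?L (hs[j := y]) gs)) (F (hs ! i)))"
      proof (rule frag_extend_eqv)
        fix gs assume "gs \<in> Poly_Mapping.keys (F (hs ! i))"
        then have gs: "length gs = p" using kF by auto
        let ?j = "if j < i then j else j - 1 + p"
        have "?j < n + p" using False * i by auto
        then show "eqv (hrel (n + p)) (frag_of (?L (hs[j := x + y]) gs))
            (frag_of (?L (hs[j := x]) gs) + frag_of (?L (hs[j := y]) gs))"
          unfolding upd [OF * False gs] using len [OF *(1) gs] by (intro hrel_add) auto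
      qed
      then show ?thesis using False by (simp add: slot_frag_of frag_extend_add_fun)
    qed
  next
    fix hs :: "'h list" and j k c assume *: "length hs = Suc n" "j < Suc n" "k < Suc n"
    show "eqv (hrel (n + p)) (slot i F (frag_of (hs[j := c *s hs ! j])))
        (slot i F (frag_of (hs[k := c *s hs ! k])))"
      using T [OF *(1,2)] eqv_sym [OF T [OF *(1,3)]] by (rule eqv_trans)
  qed
qed

lemma slot_respects:
  assumes "hlin p F" "i \<le> n" "eqv (hrel (Suc n)) u v"
  shows "eqv (hrel (n + p)) (slot i F u) (slot i F v)"
  unfolding slot_extend [of _ _ u] slot_extend [of _ _ v]
  by (rule mlin_respects [OF mlin_slot [OF assms(1,2)] assms(3)])

lemma slot_cong:
  assumes "Poly_Mapping.keys u \<subseteq> {hs. length hs = Suc n}" "i \<le> n"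
    and "\<And>h. eqv (hrel p) (F h) (G h)"
  shows "eqv (hrel (n + p)) (slot i F u) (slot i G u)"
  unfolding slot_def
proof (rule frag_extend_eqv, rule mlin_respects [OF mlin_append assms(3)])
  fix hs assume "hs \<in> Poly_Mapping.keys u"
  then show "length (take i hs) + p + length (drop (Suc i) hs) = n + p" using assms by auto
qed

text \<open>Three maps instead of a single multiplicative one: \<open>F\<close>, \<open>E\<close>,
  \<open>G\<close> are all the coproduct when iterated coproducts are multiplied, whereas for the
  right action \<open>ract hs (x * y)\<close> splits as \<open>ract hs x\<close> times an iterated
  coproduct of \<open>y\<close>.\<close>

lemma slot_hmul:
  assumes u: "Poly_Mapping.keys u \<subseteq> {hs. length hs = Suc n}" and v:
      "Poly_Mapping.keys v \<subseteq> {hs. length hs = Suc n}"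
    and i: "i \<le> n"
    and FEG: "\<And>x y. eqv (hrel p) (F (x * y)) (hmul (E x) (G y))"
    and E: "\<And>h. Poly_Mapping.keys (E h) \<subseteq> {gs. length gs = p}"
    and G: "\<And>h. Poly_Mapping.keys (G h) \<subseteq> {gs. length gs = p}"
  shows "eqv (hrel (n + p)) (slot i F (hmul u v)) (hmul (slot i E u) (slot i G v))"
proof -
  let ?L = "\<lambda>hs gs. take i hs @ gs @ drop (Suc i) hs"
  have "slot i F (hmul u v) = frag_extend
      (\<lambda>hs. frag_extend (\<lambda>gs. slot i F (frag_of (map2 (*) hs gs))) v) u"
    by (simp add: hmul_def slot_def frag_extend_bind)
  also have "eqv (hrel (n + p)) \<dots> (frag_extend (\<lambda>hs. frag_extend (\<lambda>gs. 
      frag_extend (\<lambda>ks. frag_of (?L (map2 (*) hs gs) ks)) (hmul (E (hs ! i)) (G (gs ! i)))) v) u)"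
  proof (intro frag_extend_eqv)
    fix hs gs assume "hs \<in> Poly_Mapping.keys u" "gs \<in> Poly_Mapping.keys v"
    then have l: "length hs = Suc n" "length gs = Suc n" using u v by auto
    have "eqv (hrel (n + p)) (frag_extend (\<lambda>ks. frag_of (?L (map2 (*) hs gs) ks)) (F (hs ! i * gs ! i)))
       (frag_extend (\<lambda>ks. frag_of (?L (map2 (*) hs gs) ks)) (hmul (E (hs ! i)) (G (gs ! i))))"
      by (rule mlin_respects [OF mlin_append FEG]) (use l i in auto)
    then show "eqv (hrel (n + p)) (slot i F (frag_of (map2 (*) hs gs)))
        (frag_extend (\<lambda>ks. frag_of (?L (map2 (*) hs gs) ks)) (hmul (E (hs ! i)) (G (gs ! i))))"
      using l i by (simp add: slot_frag_of)
  qed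
  also have "\<dots> = frag_extend (\<lambda>hs. frag_extend (\<lambda>gs. 
      frag_extend (\<lambda>es. frag_extend (\<lambda>ks. frag_of (map2 (*) (?L hs es) (?L gs ks))) (G (gs ! i)))
          (E (hs ! i))) v) u"
    unfolding hmul_def frag_extend_bind frag_extend_of
  proof (intro frag_extend_eq)
    fix hs gs es ks assume "hs \<in> Poly_Mapping.keys u" "gs \<in> Poly_Mapping.keys v"
      "es \<in> Poly_Mapping.keys (E (hs ! i))" "ks \<in> Poly_Mapping.keys (G (gs ! i))"
    then have l: "length hs = Suc n" "length gs = Suc n" "length es = p" "length ks = p"
      using u v E [of "hs ! i"] G [of "gs ! i"] by auto
    show "frag_of (?L (map2 (*) hs gs) (map2 (*) es ks)) = frag_of (map2 (*) (?L hs es) (?L gs ks))"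
      using l i by (simp add: zip_append take_map drop_map take_zip drop_zip)
  qed
  also have "\<dots> = hmul (slot i E u) (slot i G v)"
    by (simp add: hmul_def slot_def frag_extend_bind frag_extend_swap [of _ v])
  finally show ?thesis .
qed

end

section \<open>Iterated coproducts\<close>

context cocommutative_hopf_algebra
begin

abbreviation comult :: "'h \<Rightarrow> 'h list \<Rightarrow>\<^sub>0 int" where
  "comult h \<equiv> rep (\<Delta> h)"

lemma hlin_comult: "hlin 2 comult"
  unfolding hlin_def
proof (intro conjI allI)
  fix h
  obtain u where u: "\<Delta> h = cls (hrel 2) u" "Poly_Mapping.keys u \<subseteq> {hs. length hs = 2}"
    using comult_in [of h] by (auto simp: hpow_def)
  show "Poly_Mapping.keys (comult h) \<subseteq> {gs. length gs = 2}"
    unfolding u(1) by (rule keys_eqv_hrel [OF _ rep_cls u(2)])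
next
  fix x y show "eqv (hrel 2) (comult (x + y)) (comult x + comult y)"
    unfolding comult_add [of x y] by (rule rep_cls)
next
  fix c x show "eqv (hrel 2) (comult (c *s x))
      (frag_extend (\<lambda>gs. frag_of (gs[0 := c *s gs ! 0])) (comult x))"
    unfolding comult_scale [of c x] by (rule rep_cls)
qed simp

lemma keys_comult: "Poly_Mapping.keys (comult h) \<subseteq> {gs. length gs = 2}"
  using hlin_comult by (simp add: hlin_def)

lemma hmul_comult: "eqv (hrel 2) (comult (x * y)) (hmul (comult x) (comult y))"
  unfolding comult_mult [of x y] hmul_def by (rule rep_cls)

lemma coassoc_eqv: "eqv (hrel 3) (slot 0 comult (comult h)) (slot 1 comult (comult h))"
  using coassoc by (simp add: cls_eq_iff)

lemma cocommutative_eqv: "eqv (hrel 2) (frag_extend (\<lambda>hs. frag_of (rev hs)) (comult h)) (comult h)"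
  using eqv_sym [OF rep_cls [of "hrel 2"]] cocommutative [of h] by metis

lemma keys_iter_comult: "Poly_Mapping.keys (iter_comult n h) \<subseteq> {hs. length hs = Suc n}"
proof (induction n)
  case (Suc n)
  show ?case using keys_slot [OF Suc _ keys_comult, of 0] by simp
qed (simp add: keys_frag_of)

text \<open>\<open>iter_comult\<close> always expands factor 0, and \<open>comult_scale\<close>
  returns the scalar in factor 0 again, so keeping it there lets the induction close.\<close>

lemma eqv_iter_comult_scale:
  "eqv (hrel (Suc n)) (iter_comult n (c *s x))
      (frag_extend (\<lambda>gs. frag_of (gs[0 := c *s gs ! 0])) (iter_comult n x))"
proof (induction n)
  case (Suc n)
  let ?L = "\<lambda>hs gs. take 0 hs @ gs @ drop (Suc 0) hs"
  let ?s = "\<lambda>gs. gs[0 := c *s gs ! 0]"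
  have "eqv (hrel (n + 2)) (iter_comult (Suc n) (c *s x))
      (slot 0 comult (frag_extend (\<lambda>gs. frag_of (?s gs)) (iter_comult n x)))"
    unfolding iter_comult.simps using hlin_comult by (rule slot_respects) (auto intro: Suc)
  also have "\<dots> = frag_extend (\<lambda>hs. slot 0 comult (frag_of (?s hs))) (iter_comult n x)"
    by (simp add: slot_def frag_extend_bind)
  also have "eqv (hrel (n + 2)) \<dots> (frag_extend
      (\<lambda>hs. frag_extend (\<lambda>gs. frag_of (?s (?L hs gs))) (comult (hs ! 0))) (iter_comult n x))"
  proof (rule frag_extend_eqv)
    fix hs assume "hs \<in> Poly_Mapping.keys (iter_comult n x)"
    then have l: "length hs = Suc n" using keys_iter_comult by auto
    have "slot 0 comult (frag_of (?s hs)) = frag_extend (\<lambda>gs. frag_of (?L hs gs)) (comult (c *s hs ! 0))"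
      using l by (simp add: slot_frag_of)
    also have "eqv (hrel (n + 2)) \<dots> (frag_extend (\<lambda>gs. frag_of (?L hs gs))
        (frag_extend (\<lambda>gs. frag_of (?s gs)) (comult (hs ! 0))))"
      by (rule mlin_respects [OF mlin_append]) (use l hlin_comult in \<open>auto simp: hlin_def\<close>)
    also have "\<dots> = frag_extend (\<lambda>gs. frag_of (?s (?L hs gs))) (comult (hs ! 0))"
      unfolding frag_extend_bind frag_extend_of
    proof (rule frag_extend_eq)
      fix gs assume "gs \<in> Poly_Mapping.keys (comult (hs ! 0))"
      then have "length gs = 2" using keys_comult by auto
      then show "frag_of (?L hs (?s gs)) = frag_of (?s (?L hs gs))"
        by (simp add: list_update_append nth_append)
    qed
    finally show "eqv (hrel (n + 2)) (slot 0 comult (frag_of (?s hs)))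
        (frag_extend (\<lambda>gs. frag_of (?s (?L hs gs))) (comult (hs ! 0)))" .
  qed
  also have "\<dots> = frag_extend (\<lambda>gs. frag_of (?s gs)) (iter_comult (Suc n) x)"
    by (simp add: slot_def frag_extend_bind)
  finally show ?case by simp
qed simp

lemma hlin_iter_comult: "hlin (Suc n) (iter_comult n)"
  unfolding hlin_def
proof (intro conjI allI keys_iter_comult eqv_iter_comult_scale)
  fix x y
  show "eqv (hrel (Suc n)) (iter_comult n (x + y)) (iter_comult n x + iter_comult n y)"
  proof (induction n)
    case 0
    show ?case using hrel_add [of "[x]" 1 0 x y] by simp
  next
    case (Suc n)
    show ?case using slot_respects [OF hlin_comult _ Suc, of 0] by (simp add: slot_add)
  qed
qed simp

lemma hmul_iter_comult: "eqv (hrel (Suc n)) (iter_comult n (x * y))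
    (hmul (iter_comult n x) (iter_comult n y))"
proof (induction n)
  case 0
  show ?case by (simp add: hmul_frag_of)
next
  case (Suc n)
  have "eqv (hrel (n + 2)) (iter_comult (Suc n) (x * y))
      (slot 0 comult (hmul (iter_comult n x) (iter_comult n y)))"
    unfolding iter_comult.simps using hlin_comult by (rule slot_respects) (auto intro: Suc)
  also have "eqv (hrel (n + 2)) \<dots> (hmul (iter_comult (Suc n) x) (iter_comult (Suc n) y))"
    unfolding iter_comult.simps
    by (rule slot_hmul, rule keys_iter_comult, rule keys_iter_comult, simp, rule hmul_comult,
        rule keys_comult, rule keys_comult)
  finally show ?case by simp
qed

text \<open>Generalized coassociativity: it does not matter which factor is split. The last step of
  \<open>iter_comult\<close> split factor 0 into factors 0 and 1. Splitting factor 0 again is the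
  definition, splitting factor 1 is coassociativity, and a later factor was already present as
  factor \<open>i - 1\<close> before that step, where the induction hypothesis applies.\<close>

lemma slot_comult_iter: "i \<le> n \<Longrightarrow> eqv (hrel (n + 2)) (slot i comult (iter_comult n h))
    (iter_comult (Suc n) h)"
proof (induction n arbitrary: i)
  case (Suc n)
  consider "i = 0" | "i = 1" | j where "i = Suc (Suc j)" "j < n" using Suc.prems
    by (cases i; cases "i - 1") auto
  then show ?case
  proof cases
    case 1
    then show ?thesis by simp
  next
    case 2
    have "slot i comult (iter_comult (Suc n) h) =
        slot 0 (\<lambda>x. slot 1 comult (comult x)) (iter_comult n h)"
      using slot_slot_same [OF keys_iter_comult _ keys_comult, of 0 n 1] 2 by simp
    also have "eqv (hrel (n + 3)) \<dots> (slot 0 (\<lambda>x. slot 0 comult (comult x)) (iter_comult n h))"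
      by (rule slot_cong [OF keys_iter_comult]) (auto intro: eqv_sym [OF coassoc_eqv, simplified])
    also have "\<dots> = iter_comult (Suc (Suc n)) h"
      using slot_slot_same [OF keys_iter_comult _ keys_comult, of 0 n 0] by simp
    finally show ?thesis by (simp add: eval_nat_numeral)
  next
    case 3
    have "slot i comult (iter_comult (Suc n) h) = slot 0 comult (slot (Suc j) comult (iter_comult n h))"
      using slot_slot_swap [OF keys_iter_comult, of 0 "Suc j" n comult 1] keys_comult 3
      by (simp add: eval_nat_numeral)
    also have "eqv (hrel (Suc n + 2)) \<dots> (slot 0 comult (iter_comult (Suc n) h))"
      by (rule slot_respects [OF hlin_comult]) (use Suc.IH [of "Suc j"] 3 in auto)
    finally show ?thesis by simp
  qed
qed simp

text \<open>Iterates the previous lemma: \<open>iter_comult l\<close> expands its own factor 0,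
  which sits in position \<open>i\<close> of the whole tensor at every stage.\<close>

lemma slot_iter_comult:
  "i \<le> n \<Longrightarrow> eqv (hrel (n + Suc l)) (slot i (iter_comult l) (iter_comult n h)) (iter_comult (n + l) h)"
proof (induction l)
  case 0
  have "slot i (iter_comult 0) (iter_comult n h) = frag_extend frag_of (iter_comult n h)"
    unfolding slot_def
  proof (rule frag_extend_eq)
    fix hs assume "hs \<in> Poly_Mapping.keys (iter_comult n h)"
    then have "length hs = Suc n" using keys_iter_comult by auto
    then show "frag_extend (\<lambda>gs. frag_of (take i hs @ gs @ drop (Suc i) hs))
        (iter_comult 0 (hs ! i)) = frag_of hs"
      using 0 by (simp add: id_take_nth_drop [symmetric])
  qed
  then show ?case by (simp del: iter_comult.simps)
next
  case (Suc l)
  have "iter_comult (Suc l) = (\<lambda>x. slot 0 comult (iter_comult l x))" by (simp add: fun_eq_iff)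
  then have "slot i (iter_comult (Suc l)) (iter_comult n h) =
      slot (i + 0) comult (slot i (iter_comult l) (iter_comult n h))"
    using slot_slot_same [OF keys_iter_comult Suc.prems, of "iter_comult l" "Suc l" 0 comult]
      keys_iter_comult by simp
  also have "eqv (hrel (n + l + 2)) \<dots> (slot i comult (iter_comult (n + l) h))"
    using slot_respects [OF hlin_comult _ Suc.IH [OF Suc.prems, unfolded add_Suc_right], of i]
      Suc.prems by simp
  also have "eqv (hrel (n + l + 2)) \<dots> (iter_comult (Suc (n + l)) h)"
    using Suc.prems by (intro slot_comult_iter) auto
  finally show ?case by (simp del: iter_comult.simps)
qed

text \<open>By coassociativity the last splitting may be assumed to take place at factor
  \<open>i\<close>. Then factors \<open>i\<close> and \<open>Suc i\<close> are the two legs of one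
  coproduct, which cocommutativity exchanges.\<close>

lemma perm_iter_comult_adjacent:
  assumes "Suc i \<le> n"
  shows "eqv (hrel (Suc n)) (perm_frag (transpose i (Suc i)) (iter_comult n h)) (iter_comult n h)"
proof -
  obtain m where n: "n = Suc m" using assms by (cases n) auto
  have tr: "transpose i (Suc i) permutes {..<Suc n}" using assms by (intro permutes_swap_id) auto
  have "eqv (hrel (Suc n)) (perm_frag (transpose i (Suc i)) (iter_comult n h))
      (perm_frag (transpose i (Suc i)) (slot i comult (iter_comult m h)))"
    by (rule mlin_respects [OF mlin_permute [OF tr]])
      (use slot_comult_iter [of i m h] assms n in \<open>auto intro: eqv_sym\<close>)
  also have "\<dots> = slot i (\<lambda>x. frag_extend (\<lambda>hs. frag_of (rev hs)) (comult x)) (iter_comult m h)"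
    unfolding slot_def frag_extend_bind
  proof (intro frag_extend_eq)
    fix hs gs assume "hs \<in> Poly_Mapping.keys (iter_comult m h)" "gs \<in>
        Poly_Mapping.keys (comult (hs ! i))"
    then have l: "length hs = Suc m" "length gs = 2"
        using keys_comult [of "hs ! i"] keys_iter_comult [of m h] by auto
    then obtain a b where gs: "gs = [a, b]" by (auto simp: numeral_2_eq_2 length_Suc_conv)
    have "permute_list (transpose i (Suc i)) (take i hs @ gs @ drop (Suc i) hs) =
        take i hs @ rev gs @ drop (Suc i) hs"
      using l assms n gs
      by (intro nth_equalityI)
        (auto simp: permute_list_def nth_append transpose_def nth_Cons' intro!:
            arg_cong [where f = "(!) hs"])
    then show "perm_frag (transpose i (Suc i)) (frag_of (take i hs @ gs @ drop (Suc i) hs)) = 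
       frag_extend (\<lambda>gs. frag_of (take i hs @ gs @ drop (Suc i) hs)) (frag_of (rev gs))" by simp
  qed
  also have "eqv (hrel (Suc n)) \<dots> (slot i comult (iter_comult m h))"
    unfolding n add_2_eq_Suc' [symmetric] by (rule slot_cong [OF keys_iter_comult])
      (use assms n cocommutative_eqv in auto)
  also have "eqv (hrel (Suc n)) \<dots> (iter_comult n h)"
    using slot_comult_iter [of i m h] assms n by simp
  finally show ?thesis using n by simp
qed

lemma perm_frag_compose:
  assumes "\<tau> permutes {..<n}" "Poly_Mapping.keys u \<subseteq> {hs. length hs = n}"
  shows "perm_frag \<tau> (perm_frag \<sigma> u) = perm_frag (\<sigma> \<circ> \<tau>) u"
  unfolding frag_extend_bind frag_extend_of
proof (rule frag_extend_eq)
  fix hs assume "hs \<in> Poly_Mapping.keys u"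
  then have "length hs = n" using assms by auto
  then show "frag_of (permute_list \<tau> (permute_list \<sigma> hs)) = frag_of (permute_list (\<sigma> \<circ> \<tau>) hs)"
    using assms by (simp add: permute_list_compose)
qed

text \<open>Cocommutativity only gives invariance under adjacent transpositions; they generate \<open>S\<^sub>n\<close>.\<close>

lemma perm_iter_comult:
  assumes "\<sigma> permutes {..<Suc n}"
  shows "eqv (hrel (Suc n)) (perm_frag \<sigma> (iter_comult n h)) (iter_comult n h)"
proof -
  define invariant where "invariant \<sigma> \<longleftrightarrow>
      eqv (hrel (Suc n)) (perm_frag \<sigma> (iter_comult n h)) (iter_comult n h)" for \<sigma>
  have comp: "invariant (\<sigma> \<circ> \<tau>)" if "invariant \<sigma>" "invariant \<tau>" "\<tau> permutes {..<Suc n}" for \<sigma> \<tau>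
  proof -
    have "perm_frag (\<sigma> \<circ> \<tau>) (iter_comult n h) = perm_frag \<tau> (perm_frag \<sigma> (iter_comult n h))"
      by (rule perm_frag_compose [OF that(3) keys_iter_comult, symmetric])
    also have "eqv (hrel (Suc n)) \<dots> (perm_frag \<tau> (iter_comult n h))"
      using that(1) unfolding invariant_def by (rule mlin_respects [OF mlin_permute [OF that(3)]])
    also have "eqv (hrel (Suc n)) \<dots> (iter_comult n h)" using that(2) unfolding invariant_def .
    finally show ?thesis by (simp add: invariant_def)
  qed
  \<comment> \<open>Transpositions at distance \<open>Suc d\<close>, by induction on
    \<open>d\<close>: conjugating with an adjacent transposition lengthens the distance by
    one.\<close>
  have tr: "invariant (transpose a (a + Suc d))" if "a + Suc d \<le> n" for a d
    using that
  proof (induction d)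
    case 0
    then show ?case using perm_iter_comult_adjacent [of a n] by (simp add: invariant_def)
  next
    case (Suc d)
    let ?b = "a + Suc d"
    have adj: "invariant (transpose ?b (Suc ?b))" using perm_iter_comult_adjacent [of ?b n] Suc.prems
        by (simp add: invariant_def)
    have p: "transpose ?b (Suc ?b) permutes {..<Suc n}" "transpose a ?b permutes {..<Suc n}"
      using Suc.prems by (auto intro!: permutes_swap_id)
    have "transpose a (Suc ?b) = transpose ?b (Suc ?b) \<circ> (transpose a ?b \<circ> transpose ?b (Suc ?b))"
      by (auto simp: fun_eq_iff transpose_def)
    moreover have "invariant (transpose a ?b)" using Suc by simp
    ultimately show ?case using comp [OF adj comp [OF _ adj p(1)] permutes_compose [OF p(1,2)]]
      by (metis add_Suc_right)
  qed
  have tr': "invariant (transpose a b)" if "a < Suc n" "b < Suc n" for a b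
  proof -
    consider "a = b" | "a < b" | "b < a" by linarith
    then show ?thesis
    proof cases
      case 1
      then show ?thesis by (simp add: invariant_def)
    next
      case 2
      then show ?thesis using tr [of a "b - a - 1"] that by simp
    next
      case 3
      then show ?thesis using tr [of b "a - b - 1"] that by (simp add: transpose_commute)
    qed
  qed
  have "invariant \<sigma>" using assms
  proof (induction rule: permutes_rev_induct [OF finite_lessThan, consumes 1, case_names id swap])
    case id
    show ?case by (simp add: invariant_def)
  next
    case (swap a b p)
    then show ?case by (intro comp tr' permutes_swap_id) auto
  qed
  then show ?thesis by (simp add: invariant_def)
qed

section \<open>The right action of \<open>H\<close> on tensor powers\<close>

lemma ract_eq: "ract hs h = hmul (frag_of hs) (iter_comult (length hs - 1) h)"
  by (simp add: ract_def hmul_def)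

lemma keys_ract:
  assumes "hs \<noteq> []"
  shows "Poly_Mapping.keys (ract hs h) \<subseteq> {gs. length gs = length hs}"
  unfolding ract_eq
  by (rule keys_hmul) (use keys_iter_comult [of "length hs - 1" h] assms in \<open>auto simp: keys_frag_of\<close>)

lemma hlin_ract:
  assumes "hs \<noteq> []"
  shows "hlin (length hs) (ract hs)"
  unfolding hlin_def
proof (intro conjI allI keys_ract [OF assms])
  obtain l where l: "length hs = Suc l" using assms by (cases hs) auto
  have h: "hlin (length hs) (iter_comult (length hs - 1))" using l hlin_iter_comult by simp
  fix x y
  have "eqv (hrel (length hs)) (ract hs (x + y))
      (hmul (frag_of hs) (iter_comult (length hs - 1) x + iter_comult (length hs - 1) y))"
    unfolding ract_eq by (rule hmul_right) (use h in \<open>auto simp: hlin_def keys_frag_of\<close>)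
  then show "eqv (hrel (length hs)) (ract hs (x + y)) (ract hs x + ract hs y)"
    by (simp add: ract_eq hmul_def frag_extend_add)
  fix c
  have "eqv (hrel (length hs)) (ract hs (c *s x))
      (hmul (frag_of hs) (frag_extend (\<lambda>gs. frag_of (gs[0 := c *s gs ! 0]))
      (iter_comult (length hs - 1) x)))"
    unfolding ract_eq by (rule hmul_right) (use h in \<open>auto simp: hlin_def keys_frag_of\<close>)
  also have "\<dots> = frag_extend (\<lambda>gs. frag_of (gs[0 := c *s gs ! 0])) (ract hs x)"
    unfolding ract_eq hmul_def frag_extend_bind frag_extend_of
  proof (rule frag_extend_eq)
    fix gs assume "gs \<in> Poly_Mapping.keys (iter_comult (length hs - 1) x)"
    then have "length gs = length hs" using keys_iter_comult l by fastforce
    then show "frag_of (map2 (*) hs (gs[0 := c *s gs ! 0])) =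
        frag_of ((map2 (*) hs gs)[0 := c *s map2 (*) hs gs ! 0])"
      using l by (simp add: map2_update_right scale_mult_right)
  qed
  finally show "eqv (hrel (length hs)) (ract hs (c *s x))
      (frag_extend (\<lambda>gs. frag_of (gs[0 := c *s gs ! 0])) (ract hs x))" .
qed (use assms in simp)

lemma hmul_ract:
  assumes "hs \<noteq> []"
  shows "eqv (hrel (length hs)) (ract hs (x * y)) (hmul (ract hs x) (iter_comult (length hs - 1) y))"
proof -
  obtain l where l: "length hs = Suc l" using assms by (cases hs) auto
  show ?thesis unfolding ract_eq hmul_assoc
    by (rule hmul_right) (use l hmul_iter_comult [of l x y] in \<open>auto simp: keys_frag_of\<close>)
qed

text \<open>The right action is associative modulo the relations because the iterated coproduct is
  multiplicative.\<close>

lemma ract_ract: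
  assumes "hs \<noteq> []"
  shows "eqv (hrel (length hs)) (frag_extend (\<lambda>gs. ract gs y) (ract hs x)) (ract hs (x * y))"
proof -
  have "frag_extend (\<lambda>gs. ract gs y) (ract hs x) =
      frag_extend (\<lambda>gs. hmul (frag_of gs) (iter_comult (length hs - 1) y)) (ract hs x)"
    by (rule frag_extend_eq) (use keys_ract [OF assms, of x] in \<open>auto simp: ract_eq\<close>)
  also have "\<dots> = hmul (ract hs x) (iter_comult (length hs - 1) y)"
    by (simp add: hmul_def)
  finally show ?thesis using hmul_ract [OF assms] by (simp add: eqv_sym)
qed

lemma mlin_ract:
  assumes "0 < n"
  shows "mlin n (hrel n) (\<lambda>hs. ract hs h)"
proof -
  have "mlin n (hrel n) (\<lambda>hs. frag_extend (\<lambda>gs. frag_of (map2 (*) hs gs)) (iter_comult (n - 1) h))"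
    by (rule mlin_frag_extend, rule mlin_mult_right) (use keys_iter_comult [of "n - 1" h] assms in auto)
  then show ?thesis
    by (rule mlin_cong) (simp add: ract_def)
qed

text \<open>Componentwise multiplication is equivariant and the iterated coproduct is symmetric, so
  permuting factors commutes with the right action. Through this lemma cocommutativity reaches the
  relative tensor product.\<close>

lemma perm_ract:
  assumes "\<sigma> permutes {..<length hs}" "hs \<noteq> []"
  shows "eqv (hrel (length hs)) (perm_frag \<sigma> (ract hs h)) (ract (permute_list \<sigma> hs) h)"
proof -
  obtain l where l: "length hs = Suc l" using assms by (cases hs) auto
  have "perm_frag \<sigma> (ract hs h) = hmul (perm_frag \<sigma> (frag_of hs)) (perm_frag \<sigma> (iter_comult l h))"
    unfolding ract_eq using l
    by (subst hmul_perm [OF assms(1)]) (use keys_iter_comult [of l h] in \<open>auto simp: keys_frag_of\<close>)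
  also have "eqv (hrel (length hs)) \<dots> (ract (permute_list \<sigma> hs) h)"
    unfolding ract_eq using assms l perm_iter_comult [of \<sigma> l h]
    by (auto intro!: hmul_right simp: keys_frag_of)
  finally show ?thesis .
qed

text \<open>Multiplicativity pulls the coproduct of \<open>h\<close> out of the expanded factor, and
  coassociativity turns the coproduct of \<open>h\<close> with one factor split further into a
  longer iterated coproduct. This makes insertion compatible with the balancing relation of the
  outer value.\<close>

lemma slot_ract_iter:
  assumes "hs \<noteq> []" "m < length fs" "length fs = Suc n" "length hs = Suc l"
  shows "eqv (hrel (n + Suc l)) (frag_extend (\<lambda>gs. slot m (ract hs) (frag_of gs)) (ract fs h))
    (frag_extend (\<lambda>gs. ract gs h) (slot m (ract hs) (frag_of fs)))"
proof -
  have "frag_extend (\<lambda>gs. slot m (ract hs) (frag_of gs)) (ract fs h) =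
      slot m (ract hs) (hmul (frag_of fs) (iter_comult n h))"
    using assms by (simp add: slot_extend [symmetric] ract_eq)
  also have "eqv (hrel (n + Suc l)) \<dots> (hmul (slot m (ract hs) (frag_of fs))
      (slot m (iter_comult l) (iter_comult n h)))"
    by (rule slot_hmul) (use assms keys_iter_comult keys_ract [OF assms(1)] hmul_ract [OF assms(1)] in
      \<open>auto simp: keys_frag_of\<close>)
  also have "eqv (hrel (n + Suc l)) \<dots> (hmul (slot m (ract hs) (frag_of fs)) (iter_comult (n + l) h))"
    by (rule hmul_right [OF keys_slot slot_iter_comult])
      (use assms keys_ract [OF assms(1)] in \<open>auto simp: keys_frag_of\<close>)
  also have "\<dots> = frag_extend (\<lambda>gs. hmul (frag_of gs) (iter_comult (n + l) h))
      (slot m (ract hs) (frag_of fs))"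
    by (simp add: hmul_def)
  also have "\<dots> = frag_extend (\<lambda>gs. ract gs h) (slot m (ract hs) (frag_of fs))"
  proof (rule frag_extend_eq)
    fix gs assume "gs \<in> Poly_Mapping.keys (slot m (ract hs) (frag_of fs))"
    then have "length gs = n + Suc l" 
      using keys_slot [of "frag_of fs" n m "ract hs" "Suc l"] assms keys_ract [OF assms(1)]
        by (auto simp: keys_frag_of)
    then show "hmul (frag_of gs) (iter_comult (n + l) h) = ract gs h" by (simp add: ract_eq)
  qed
  finally show ?thesis .
qed

end

section \<open>Operations on the relative tensor product\<close>

text \<open>The ordering of all arguments induced by an ordering \<open>\<tau>\<close> of the arguments of an outer operation,
  whose argument 0 is an operation of arity \<open>l\<close>, and an ordering \<open>\<rho>\<close> of the arguments of the latter.\<close>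

definition block_perm :: "nat \<Rightarrow> (nat \<Rightarrow> nat) \<Rightarrow> (nat \<Rightarrow> nat) \<Rightarrow> nat \<Rightarrow> nat" where
  "block_perm l \<rho> \<tau> i = (if i < l then \<tau> 0 + \<rho> i
     else if \<tau> (i + 1 - l) < \<tau> 0 then \<tau> (i + 1 - l) else \<tau> (i + 1 - l) + l - 1)"

lemma block_perm_permutes:
  assumes \<rho>: "\<rho> permutes {..<l}" and \<tau>: "\<tau> permutes {..<Suc n}" and l: "0 < l"
  shows "block_perm l \<rho> \<tau> permutes {..<n + l}"
proof (rule inj_imp_permutes)
  have \<rho>l: "\<rho> i < l \<longleftrightarrow> i < l" for i using permutes_in_image [OF \<rho>] by auto
  have \<tau>n: "\<tau> i < Suc n \<longleftrightarrow> i < Suc n" for i using permutes_in_image [OF \<tau>] by auto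
  have \<rho>i: "\<rho> i = \<rho> j \<longleftrightarrow> i = j" for i j using permutes_inj [OF \<rho>] by (auto simp: inj_def)
  have \<tau>i: "\<tau> i = \<tau> j \<longleftrightarrow> i = j" for i j using permutes_inj [OF \<tau>] by (auto simp: inj_def)
  have "inj (block_perm l \<rho> \<tau>)"
  proof (rule injI)
    fix i j assume eq: "block_perm l \<rho> \<tau> i = block_perm l \<rho> \<tau> j"
    have [simp]: "\<tau> (i + 1 - l) \<noteq> \<tau> 0" if "\<not> i < l" for i using \<tau>i [of "i + 1 - l" 0] that by auto
    \<comment> \<open>No outer argument shares the position of the inner operation, so outer
      arguments land below \<open>\<tau> 0\<close> or at \<open>\<tau> 0 + l\<close> and beyond,
      never in the block.\<close>
    have *: "\<tau> (i + 1 - l) < \<tau> 0 \<or> \<tau> (i + 1 - l) > \<tau> 0" if "\<not> i < l" for i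
      using \<tau>i [of "i + 1 - l" 0] that by auto
    show "i = j"
    proof (cases "i < l"; cases "j < l")
      assume "i < l" "j < l"
      then show ?thesis using eq \<rho>i by (simp add: block_perm_def)
    next
      assume "i < l" "\<not> j < l"
      then show ?thesis using eq \<rho>l [of i] * [of j] l by (auto simp: block_perm_def split: if_splits)
    next
      assume "\<not> i < l" "j < l"
      then show ?thesis using eq \<rho>l [of j] * [of i] l by (auto simp: block_perm_def split: if_splits)
    next
      assume **: "\<not> i < l" "\<not> j < l"
      then have "\<tau> (i + 1 - l) = \<tau> (j + 1 - l)"
        using eq * [of i] * [of j] l by (auto simp: block_perm_def split: if_splits)
      then show ?thesis using ** \<tau>i l by auto
    qed
  qed
  then show "inj_on (block_perm l \<rho> \<tau>) {..<n + l}" by (rule inj_on_subset) simp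
  fix i
  show "block_perm l \<rho> \<tau> i \<in> {..<n + l}" if "i \<in> {..<n + l}"
    using that \<rho>l [of i] \<tau>n [of 0] \<tau>n [of "i + 1 - l"] l by (auto simp: block_perm_def)
  show "block_perm l \<rho> \<tau> i = i" if "i \<notin> {..<n + l}"
    using that \<tau>n [of 0] permutes_not_in [OF \<tau>, of "i + 1 - l"] l by (auto simp: block_perm_def)
qed simp

text \<open>The origin of the formula for \<open>block_perm\<close>: a value whose block
  \<open>gs\<close> replaces factor \<open>\<tau> 0\<close> of \<open>fs\<close> is rearranged so
  that the block comes first, with \<open>\<rho>\<close> inside it and \<open>\<tau>\<close> on the
  remaining factors.\<close>

lemma permute_list_block_perm:
  assumes \<rho>: "\<rho> permutes {..<l}" and \<tau>: "\<tau> permutes {..<Suc n}"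
    and len: "0 < l" "length gs = l" "length fs = Suc n"
  shows "permute_list (block_perm l \<rho> \<tau>) (take (\<tau> 0) fs @ gs @ drop (Suc (\<tau> 0)) fs) =
    permute_list \<rho> gs @ drop (Suc 0) (permute_list \<tau> fs)"
proof (rule nth_equalityI)
  have \<tau>n: "\<tau> i < Suc n \<longleftrightarrow> i < Suc n" for i using permutes_in_image [OF \<tau>] by auto
  have q: "\<tau> 0 < Suc n" using \<tau>n by simp
  then show "length (permute_list (block_perm l \<rho> \<tau>) (take (\<tau> 0) fs @ gs @ drop (Suc (\<tau> 0)) fs)) =
    length (permute_list \<rho> gs @ drop (Suc 0) (permute_list \<tau> fs))" using len by simp
  fix i assume "i < length (permute_list (block_perm l \<rho> \<tau>) (take (\<tau> 0) fs @ gs @ drop (Suc (\<tau> 0)) fs))"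
  then have i: "i < n + l" using q len by simp
  have len_all: "length (take (\<tau> 0) fs @ gs @ drop (Suc (\<tau> 0)) fs) = n + l" using q len by simp
  show "permute_list (block_perm l \<rho> \<tau>) (take (\<tau> 0) fs @ gs @ drop (Suc (\<tau> 0)) fs) ! i =
    (permute_list \<rho> gs @ drop (Suc 0) (permute_list \<tau> fs)) ! i"
  proof (cases "i < l")
    case True
    then have "\<rho> i < l" using permutes_in_image [OF \<rho>] by auto
    then show ?thesis using True i len q len_all
      by (simp add: permute_list_def block_perm_def nth_append)
  next
    case False
    let ?j = "\<tau> (i + 1 - l)"
    have j: "?j < Suc n" using \<tau>n [of "i + 1 - l"] False i by auto
    have "i + 1 - l \<noteq> 0" using False by simp
    then have "?j \<noteq> \<tau> 0" using permutes_inj [OF \<tau>] by (metis injD)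
    then have "(take (\<tau> 0) fs @ gs @ drop (Suc (\<tau> 0)) fs) ! block_perm l \<rho> \<tau> i = fs ! ?j"
      using False i len q j by (auto simp: block_perm_def nth_append)
    moreover have "permute_list (block_perm l \<rho> \<tau>) (take (\<tau> 0) fs @ gs @ drop (Suc (\<tau> 0)) fs) ! i =
      (take (\<tau> 0) fs @ gs @ drop (Suc (\<tau> 0)) fs) ! block_perm l \<rho> \<tau> i"
      using i len_all by (simp add: permute_list_def del: upt_Suc)
    moreover have "(permute_list \<rho> gs @ drop (Suc 0) (permute_list \<tau> fs)) ! i = fs ! ?j"
      using False i len \<tau> by (simp add: permute_list_nth nth_append Suc_diff_le)
    ultimately show ?thesis by simp
  qed
qed

section \<open>The relative tensor product: relations, permutation, multiplication,
  insertion\<close>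

context graded_hopf_module
begin

abbreviation tag :: "'a \<Rightarrow> ('h list \<Rightarrow>\<^sub>0 int) \<Rightarrow> ('h list \<times> 'a \<Rightarrow>\<^sub>0 int)" where
  "tag a \<equiv> frag_extend (\<lambda>hs. frag_of (hs, a))"

abbreviation tcarrier :: "nat \<Rightarrow> ('h list \<times> 'a) set" where
  "tcarrier n \<equiv> {hs. length hs = n} \<times> UNIV"

lemma trel_add:
  "length hs = n \<Longrightarrow> eqv (trel n) (frag_of (hs, a + b)) (frag_of (hs, a) + frag_of (hs, b))"
  unfolding trel_def diff_diff_eq
  by (rule eqv_base, rule UnI1, rule UnI2) blast

lemma trel_act:
  "length hs = n \<Longrightarrow> eqv (trel n) (tag a (ract hs h)) (frag_of (hs, h \<cdot> a))"
  unfolding trel_def by (rule eqv_base, rule UnI2) blast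

lemma mlin_tag: "mlin n (trel n) (\<lambda>hs. frag_of (hs, a))"
proof (rule mlinI)
  fix hs :: "'h list" and i x y assume "length hs = n" "i < n"
  then show "eqv (trel n) (frag_of (hs[i := x + y], a))
      (frag_of (hs[i := x], a) + frag_of (hs[i := y], a))"
    unfolding trel_def diff_diff_eq by (intro eqv_base UnI1) blast
next
  fix hs :: "'h list" and i j c assume "length hs = n" "i < n" "j < n"
  then show "eqv (trel n) (frag_of (hs[i := c *s hs ! i], a)) (frag_of (hs[j := c *s hs ! j], a))"
    unfolding trel_def diff_diff_eq by (intro eqv_base) blast
qed

lemma keys_trel:
  assumes "0 < n" "r \<in> trel n"
  shows "Poly_Mapping.keys r \<subseteq> tcarrier n"
proof -
  have "Poly_Mapping.keys (tag a (ract hs h) - frag_of (hs, h \<cdot> a)) \<subseteq> tcarrier n" if "length hs =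
      n" for hs h a
    by (intro keys_diff_subset keys_frag_extend_subset)
      (use that keys_ract [of hs h] assms(1) in \<open>auto simp: keys_frag_of\<close>)
  moreover have "Poly_Mapping.keys r \<subseteq> tcarrier n \<or>
      (\<exists>hs h a. r = tag a (ract hs h) - frag_of (hs, h \<cdot> a) \<and> length hs = n)"
    using assms(2) unfolding trel_def
    by (elim UnE CollectE exE conjE) (fastforce simp: keys_frag_of dest!: subsetD [OF keys_diff])+
  ultimately show ?thesis by auto
qed

lemmas keys_eqv_trel = keys_eqv [OF keys_trel]

text \<open>The universal property of the tensor product over \<open>H\<close>: multilinearity in
  the factors, additivity in the module element and balancing correspond to the generators in
  \<open>trel\<close>.\<close>

lemma trel_respects:
  assumes f: "\<And>a. mlin n R (\<lambda>hs. f (hs, a))"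
    and add: "\<And>hs a b. length hs = n \<Longrightarrow> eqv R (f (hs, a + b)) (f (hs, a) + f (hs, b))"
    and act: "\<And>hs h a. length hs = n \<Longrightarrow> eqv R (frag_extend (\<lambda>gs. f (gs, a)) (ract hs h)) (f (hs, h \<cdot> a))"
    and uv: "eqv (trel n) u v"
  shows "eqv R (frag_extend f u) (frag_extend f v)"
proof (rule frag_extend_respects [OF _ uv])
  fix r assume "r \<in> trel n"
  then show "frag_extend f r \<in> int_frag.span R"
    using f add act unfolding trel_def mlin_def eqv_def
    by (auto simp: frag_extend_diff frag_extend_add diff_diff_eq frag_extend_bind)
qed

definition tperm :: "(nat \<Rightarrow> nat) \<Rightarrow> ('h list \<times> 'a \<Rightarrow>\<^sub>0 int) \<Rightarrow> ('h list \<times> 'a \<Rightarrow>\<^sub>0 int)" where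
  "tperm \<sigma> = frag_extend (\<lambda>(hs, a). frag_of (permute_list \<sigma> hs, a))"

definition tmult :: "'h list \<Rightarrow> ('h list \<times> 'a \<Rightarrow>\<^sub>0 int) \<Rightarrow> ('h list \<times> 'a \<Rightarrow>\<^sub>0 int)" where
  "tmult hs = frag_extend (\<lambda>(gs, a). frag_of (map2 (*) hs gs, a))"

text \<open>Composition is split into two layers, so that independence of the outer representative
  (here) and of the inner one (\<open>compose_frag\<close>) can be proved separately.\<close>

definition insert_at :: "nat \<Rightarrow> 'h list \<Rightarrow> ('h list \<times> 'a \<Rightarrow>\<^sub>0 int) \<Rightarrow> ('h list \<times> 'a \<Rightarrow>\<^sub>0 int)" where
  "insert_at m hs = frag_extend (\<lambda>(fs, b). tag b (slot m (ract hs) (frag_of fs)))"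

text \<open>\<open>\<Phi> e\<close> stands for a representative of the outer operation with
  \<open>e\<close> in its open slot; as a parameter it can be any family congruent to the chosen
  one.\<close>

definition compose_frag :: "nat \<Rightarrow> ('a \<Rightarrow> ('h list \<times> 'a \<Rightarrow>\<^sub>0 int)) \<Rightarrow> ('h list \<times> 'a \<Rightarrow>\<^sub>0 int) \<Rightarrow>
    ('h list \<times> 'a \<Rightarrow>\<^sub>0 int)" where
  "compose_frag m \<Phi> = frag_extend (\<lambda>(hs, e). insert_at m hs (\<Phi> e))"

lemma perm_eq: "perm n \<sigma> C = cls (trel n) (tperm \<sigma> (rep C))"
  by (simp add: perm_def tperm_def)

lemma lmult_eq: "lmult hs C = cls (trel (length hs)) (tmult hs (rep C))"
  by (simp add: lmult_def tmult_def)

lemma compose_eq: "compose l m \<phi> \<psi> xs = cls (trel (length xs))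
   (compose_frag m (\<lambda>e. rep (\<phi> (take m xs @ e # drop (m + l) xs))) (rep (\<psi> (take l (drop m xs)))))"
  unfolding compose_def compose_frag_def insert_at_def slot_frag_of frag_extend_bind frag_extend_of ..

lemma keys_tperm: "Poly_Mapping.keys u \<subseteq> {hs. length hs = n} \<times> B \<Longrightarrow>
    Poly_Mapping.keys (tperm \<sigma> u) \<subseteq> {hs. length hs = n} \<times> B"
  unfolding tperm_def by (intro keys_frag_extend_subset) (auto simp: keys_frag_of)

lemma keys_slot_ract:
  assumes "length fs = Suc n" "m \<le> n" "hs \<noteq> []"
  shows "Poly_Mapping.keys (slot m (ract hs) (frag_of fs)) \<subseteq> {gs. length gs = n + length hs}"
  using assms by (intro keys_slot keys_ract) (auto simp: keys_frag_of)

lemma keys_insert_at: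
  assumes "Poly_Mapping.keys u \<subseteq> tcarrier (Suc n)" "m \<le> n" "hs \<noteq> []"
  shows "Poly_Mapping.keys (insert_at m hs u) \<subseteq> tcarrier (n + length hs)"
  unfolding insert_at_def
proof (intro keys_frag_extend_subset, clarify)
  fix fs b gs c
  assume "(fs, b) \<in> Poly_Mapping.keys u" and k: "(gs, c) \<in>
      Poly_Mapping.keys (tag b (slot m (ract hs) (frag_of fs)))"
  then have "length fs = Suc n" using assms by auto
  then have "Poly_Mapping.keys (slot m (ract hs) (frag_of fs)) \<subseteq> {gs. length gs = n + length hs}"
    using assms by (intro keys_slot_ract)
  then show "gs \<in> {gs. length gs = n + length hs} \<and> c \<in> UNIV"
    using k keys_frag_extend [of "\<lambda>hs. frag_of (hs, b)"] by (fastforce simp: keys_frag_of)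
qed

lemma tperm_respects:
  assumes \<sigma>: "\<sigma> permutes {..<n}" and n: "0 < n" and uv: "eqv (trel n) u v"
  shows "eqv (trel n) (tperm \<sigma> u) (tperm \<sigma> v)"
  unfolding tperm_def
proof (rule trel_respects [OF _ _ _ uv]; simp)
  fix a
  show "mlin n (trel n) (\<lambda>hs. frag_of (permute_list \<sigma> hs, a))"
    using mlin_comp [OF mlin_permute [OF \<sigma>] mlin_tag] by simp
next
  fix hs :: "'h list" and a b assume "length hs = n"
  then show "eqv (trel n) (frag_of (permute_list \<sigma> hs, a + b))
      (frag_of (permute_list \<sigma> hs, a) + frag_of (permute_list \<sigma> hs, b))"
    by (simp add: trel_add)
next
  fix hs :: "'h list" and h a assume hs: "length hs = n"
  have "frag_extend (\<lambda>gs. frag_of (permute_list \<sigma> gs, a)) (ract hs h) = tag a (perm_frag \<sigma> (ract hs h))"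
    by (simp add: frag_extend_bind)
  also have "eqv (trel n) \<dots> (tag a (ract (permute_list \<sigma> hs) h))"
    by (rule mlin_respects [OF mlin_tag]) (use perm_ract [of \<sigma> hs h] \<sigma> hs n in auto)
  also have "eqv (trel n) \<dots> (frag_of (permute_list \<sigma> hs, h \<cdot> a))"
    by (rule trel_act) (use hs in simp)
  finally show "eqv (trel n) (frag_extend (\<lambda>gs. frag_of (permute_list \<sigma> gs, a)) (ract hs h))
      (frag_of (permute_list \<sigma> hs, h \<cdot> a))" .
qed

lemma tmult_respects:
  assumes ks: "length ks = n" and n: "0 < n" and uv: "eqv (trel n) u v"
  shows "eqv (trel n) (tmult ks u) (tmult ks v)"
  unfolding tmult_def
proof (rule trel_respects [OF _ _ _ uv]; simp)
  fix a
  show "mlin n (trel n) (\<lambda>hs. frag_of (map2 (*) ks hs, a))"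
    using mlin_comp [OF mlin_mult_left [OF ks] mlin_tag] by simp
next
  fix hs :: "'h list" and a b assume "length hs = n"
  then show "eqv (trel n) (frag_of (map2 (*) ks hs, a + b))
      (frag_of (map2 (*) ks hs, a) + frag_of (map2 (*) ks hs, b))"
    using ks by (simp add: trel_add)
next
  fix hs :: "'h list" and h a assume hs: "length hs = n"
  have "frag_extend (\<lambda>gs. frag_of (map2 (*) ks gs, a)) (ract hs h) = tag a (ract (map2 (*) ks hs) h)"
    using hs ks by (simp add: ract_def frag_extend_bind map2_mult_assoc)
  also have "eqv (trel n) \<dots> (frag_of (map2 (*) ks hs, h \<cdot> a))"
    by (rule trel_act) (use hs ks in simp)
  finally show "eqv (trel n) (frag_extend (\<lambda>gs. frag_of (map2 (*) ks gs, a)) (ract hs h))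
      (frag_of (map2 (*) ks hs, h \<cdot> a))" .
qed

text \<open>Change of the outer representative. The relation with content is balancing over
  \<open>H\<close>, and it follows from \<open>slot_ract_iter\<close> and
  \<open>trel_act\<close>.\<close>

lemma insert_at_respects:
  assumes m: "m \<le> n" and hs: "length hs = Suc l" and uv: "eqv (trel (Suc n)) u v"
  shows "eqv (trel (n + Suc l)) (insert_at m hs u) (insert_at m hs v)"
  unfolding insert_at_def
proof (rule trel_respects [OF _ _ _ uv]; simp del: add_Suc_right)
  have hs': "hs \<noteq> []" using hs by auto
  have hl: "hlin (Suc l) (ract hs)" using hlin_ract [OF hs'] hs by simp
  fix a
  show "mlin (Suc n) (trel (n + Suc l)) (\<lambda>fs. tag a (slot m (ract hs) (frag_of fs)))"
    by (rule mlin_comp [OF mlin_slot [OF hl m] mlin_tag])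
next
  fix fs :: "'h list" and a b assume "length fs = Suc n"
  then have "Poly_Mapping.keys (slot m (ract hs) (frag_of fs)) \<subseteq> {gs. length gs = n + Suc l}"
    using keys_slot_ract [of fs n m hs] m hs by (cases hs) auto
  then show "eqv (trel (n + Suc l)) (tag (a + b) (slot m (ract hs) (frag_of fs)))
      (tag a (slot m (ract hs) (frag_of fs)) + tag b (slot m (ract hs) (frag_of fs)))"
    unfolding frag_extend_add_fun [symmetric]
    by (intro frag_extend_eqv trel_add) auto
next
  fix fs :: "'h list" and h a assume fs: "length fs = Suc n"
  have hs': "hs \<noteq> []" using hs by auto
  have k: "Poly_Mapping.keys (slot m (ract hs) (frag_of fs)) \<subseteq> {gs. length gs = n + Suc l}"
    using keys_slot_ract [OF fs m hs'] hs by simp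
  have "frag_extend (\<lambda>gs. tag a (slot m (ract hs) (frag_of gs))) (ract fs h) =
      tag a (frag_extend (\<lambda>gs. slot m (ract hs) (frag_of gs)) (ract fs h))"
    by (simp add: frag_extend_bind)
  also have "eqv (trel (n + Suc l)) \<dots> (tag a
      (frag_extend (\<lambda>gs. ract gs h) (slot m (ract hs) (frag_of fs))))"
    by (rule mlin_respects [OF mlin_tag slot_ract_iter [OF hs' _ fs hs]]) (use m fs in simp)
  also have "\<dots> = frag_extend (\<lambda>gs. tag a (ract gs h)) (slot m (ract hs) (frag_of fs))"
    by (simp add: frag_extend_bind)
  also have "eqv (trel (n + Suc l)) \<dots> (tag (h \<cdot> a) (slot m (ract hs) (frag_of fs)))"
    by (rule frag_extend_eqv, rule trel_act) (use k in auto)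
  finally show "eqv (trel (n + Suc l))
      (frag_extend (\<lambda>gs. tag a (slot m (ract hs) (frag_of gs))) (ract fs h))
      (tag (h \<cdot> a) (slot m (ract hs) (frag_of fs)))"
    by simp
qed

lemma mlin_insert_at:
  assumes u: "Poly_Mapping.keys u \<subseteq> tcarrier (Suc n)" and m: "m \<le> n"
  shows "mlin (Suc l) (trel (n + Suc l)) (\<lambda>hs. insert_at m hs u)"
  unfolding insert_at_def slot_frag_of
proof (rule mlin_frag_extend, clarify)
  fix fs b assume "(fs, b) \<in> Poly_Mapping.keys u"
  then have fs: "length fs = Suc n" using u by auto
  show "mlin (Suc l) (trel (n + Suc l))
      (\<lambda>hs. tag b (frag_extend (\<lambda>gs. frag_of (take m fs @ gs @ drop (Suc m) fs)) (ract hs (fs ! m))))"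
    by (rule mlin_comp [OF mlin_comp [OF mlin_ract mlin_append] mlin_tag]) (use fs m in auto)
qed

lemma insert_at_add: "insert_at m hs (u + v) = insert_at m hs u + insert_at m hs v"
  by (simp add: insert_at_def frag_extend_add)

text \<open>An element \<open>h\<close> acting on the inner tensor meets the coproduct of the outer
  factor \<open>m\<close>, and the product of the two coproducts is that of
  \<open>h * fs ! m\<close>. This is left multiplication of the outer value in factor
  \<open>m\<close> alone, the form in which linearity of the outer operation delivers
  \<open>h \<cdot> e\<close>.\<close>

lemma insert_at_balanced:
  assumes u: "Poly_Mapping.keys u \<subseteq> tcarrier (Suc n)" and m: "m \<le> n" and hs: "length hs = Suc l"
  shows "eqv (trel (n + Suc l)) (frag_extend (\<lambda>gs. insert_at m gs u) (ract hs h)) 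
    (insert_at m hs (tmult ((replicate (Suc n) 1)[m := h]) u))"
proof -
  let ?L = "\<lambda>fs. frag_extend (\<lambda>gs. frag_of (take m fs @ gs @ drop (Suc m) fs))"
  have hs': "hs \<noteq> []" using hs by auto
  have "frag_extend (\<lambda>gs. insert_at m gs u) (ract hs h) =
    frag_extend (\<lambda>(fs, b). tag b (?L fs (frag_extend (\<lambda>gs. ract gs (fs ! m)) (ract hs h)))) u"
    unfolding insert_at_def slot_frag_of
    by (subst frag_extend_swap) (simp add: frag_extend_bind case_prod_unfold)
  also have "eqv (trel (n + Suc l)) \<dots> (frag_extend (\<lambda>(fs, b). tag b (?L fs (ract hs (h * fs ! m)))) u)"
  proof (rule frag_extend_eqv, clarify)
    fix fs b assume "(fs, b) \<in> Poly_Mapping.keys u"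
    then have fs: "length fs = Suc n" using u by auto
    show "eqv (trel (n + Suc l)) (tag b (?L fs (frag_extend (\<lambda>gs. ract gs (fs ! m)) (ract hs h))))
        (tag b (?L fs (ract hs (h * fs ! m))))"
      by (rule mlin_respects [OF mlin_tag], rule mlin_respects
        [OF mlin_append ract_ract [OF hs', unfolded hs]])
        (use fs m in auto)
  qed
  also have "\<dots> = insert_at m hs (tmult ((replicate (Suc n) 1)[m := h]) u)"
    unfolding insert_at_def tmult_def frag_extend_bind
  proof (rule frag_extend_eq, clarify, unfold frag_extend_bind frag_extend_of split slot_frag_of)
    fix fs b assume "(fs, b) \<in> Poly_Mapping.keys u"
    then have fs: "length fs = Suc n" using u by auto
    have "map2 (*) ((replicate (Suc n) 1)[m := h]) fs = fs[m := h * fs ! m]"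
      using fs m by (intro nth_equalityI) (auto simp: nth_list_update nth_Cons' simp del: replicate_Suc)
    then show "frag_extend (\<lambda>gs. frag_of (take m fs @ gs @ drop (Suc m) fs, b)) (ract hs (h * fs ! m)) =
      frag_extend (\<lambda>gs. frag_of (take m (map2 (*) ((replicate (Suc n) 1)[m := h]) fs) @ gs @
        drop (Suc m) (map2 (*) ((replicate (Suc n) 1)[m := h]) fs), b))
            (ract hs (map2 (*) ((replicate (Suc n) 1)[m := h]) fs ! m))"
      using fs m by (simp del: replicate_Suc)
  qed
  finally show ?thesis .
qed

text \<open>Change of the inner representative: \<open>add\<close> and \<open>act\<close> express
  additivity and linearity of the outer operation in its open slot, and
  \<open>insert_at_balanced\<close> matches the latter with the balancing relation.\<close>

lemma compose_frag_respects:
  assumes m: "m \<le> n"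
    and keys: "\<And>e. Poly_Mapping.keys (\<Phi> e) \<subseteq> tcarrier (Suc n)"
    and add: "\<And>e e'. eqv (trel (Suc n)) (\<Phi> (e + e')) (\<Phi> e + \<Phi> e')"
    and act: "\<And>h e. eqv (trel (Suc n)) (\<Phi> (h \<cdot> e)) (tmult ((replicate (Suc n) 1)[m := h]) (\<Phi> e))"
    and uv: "eqv (trel (Suc l)) u v"
  shows "eqv (trel (n + Suc l)) (compose_frag m \<Phi> u) (compose_frag m \<Phi> v)"
  unfolding compose_frag_def
proof (rule trel_respects [OF _ _ _ uv]; unfold split)
  show "mlin (Suc l) (trel (n + Suc l)) (\<lambda>hs. insert_at m hs (\<Phi> a))" for a
    by (rule mlin_insert_at [OF keys m])
next
  fix hs :: "'h list" and a b assume "length hs = Suc l"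
  then show "eqv (trel (n + Suc l)) (insert_at m hs (\<Phi> (a + b)))
      (insert_at m hs (\<Phi> a) + insert_at m hs (\<Phi> b))"
    unfolding insert_at_add [symmetric] by (rule insert_at_respects [OF m _ add])
next
  fix hs :: "'h list" and h a assume hs: "length hs = Suc l"
  show "eqv (trel (n + Suc l)) (frag_extend (\<lambda>gs. insert_at m gs (\<Phi> a)) (ract hs h))
      (insert_at m hs (\<Phi> (h \<cdot> a)))"
    using insert_at_balanced [OF keys m hs] insert_at_respects [OF m hs eqv_sym [OF act]]
      by (rule eqv_trans)
qed

text \<open>Equivariance of composition. \<open>\<rho>\<close> passes through the right action by
  \<open>perm_ract\<close>; the rest is the bookkeeping of positions in
  \<open>permute_list_block_perm\<close>.\<close>

lemma insert_at_perm:
  assumes \<rho>: "\<rho> permutes {..<Suc l}" and \<tau>: "\<tau> permutes {..<Suc n}"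
    and u: "Poly_Mapping.keys u \<subseteq> tcarrier (Suc n)" and hs: "length hs = Suc l"
  shows "eqv (trel (n + Suc l)) (insert_at 0 (permute_list \<rho> hs) (tperm \<tau> u))
    (tperm (block_perm (Suc l) \<rho> \<tau>) (insert_at (\<tau> 0) hs u))"
proof -
  let ?L = "\<lambda>fs. frag_extend (\<lambda>gs. frag_of (gs @ drop (Suc 0) (permute_list \<tau> fs)))"
  have hs': "hs \<noteq> []" using hs by auto
  have q: "\<tau> 0 < Suc n" using permutes_in_image [OF \<tau>, of 0] by auto
  have "insert_at 0 (permute_list \<rho> hs) (tperm \<tau> u) =
      frag_extend (\<lambda>(fs, b). tag b (?L fs (ract (permute_list \<rho> hs) (fs ! \<tau> 0)))) u"
    unfolding insert_at_def tperm_def frag_extend_bind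
  proof (rule frag_extend_eq, clarify, unfold frag_extend_bind frag_extend_of split slot_frag_of)
    fix fs b assume "(fs, b) \<in> Poly_Mapping.keys u"
    then have fs: "length fs = Suc n" using u by auto
    \<comment> \<open>The factor to be expanded is factor 0 after permuting, hence factor
      \<open>\<tau> 0\<close> of the original value.\<close>
    then have "permute_list \<tau> fs ! 0 = fs ! \<tau> 0" by (simp add: permute_list_def nth_Cons' del: upt_Suc)
    then show "frag_extend (\<lambda>gs. frag_of
        (take 0 (permute_list \<tau> fs) @ gs @ drop (Suc 0) (permute_list \<tau> fs), b))
        (ract (permute_list \<rho> hs) (permute_list \<tau> fs ! 0)) =
            frag_extend (\<lambda>gs. frag_of (gs @ drop (Suc 0) (permute_list \<tau> fs), b))
            (ract (permute_list \<rho> hs) (fs ! \<tau> 0))" by simp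
  qed
  also have "eqv (trel (n + Suc l)) \<dots> (frag_extend
      (\<lambda>(fs, b). tag b (?L fs (perm_frag \<rho> (ract hs (fs ! \<tau> 0))))) u)"
  proof (rule frag_extend_eqv, clarify)
    fix fs b assume "(fs, b) \<in> Poly_Mapping.keys u"
    then have fs: "length fs = Suc n" using u by auto
    have "mlin (Suc l) (hrel (n + Suc l)) (\<lambda>gs. frag_of ([] @ gs @ drop (Suc 0) (permute_list \<tau> fs)))"
      by (rule mlin_append) (use fs in simp)
    then have ml: "mlin (Suc l) (hrel (n + Suc l))
        (\<lambda>gs. frag_of (gs @ drop (Suc 0) (permute_list \<tau> fs)))"
      by simp
    show "eqv (trel (n + Suc l)) (tag b (?L fs (ract (permute_list \<rho> hs) (fs ! \<tau> 0))))
        (tag b (?L fs (perm_frag \<rho> (ract hs (fs ! \<tau> 0)))))"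
      by (rule mlin_respects [OF mlin_tag], rule mlin_respects [OF ml])
        (use perm_ract [of \<rho> hs] \<rho> hs hs' in \<open>auto intro: eqv_sym\<close>)
  qed
  also have "\<dots> = tperm (block_perm (Suc l) \<rho> \<tau>) (insert_at (\<tau> 0) hs u)"
    unfolding insert_at_def tperm_def frag_extend_bind slot_frag_of
  proof (rule frag_extend_eq, clarify, unfold frag_extend_of frag_extend_bind split, rule frag_extend_eq)
    fix fs b gs assume "(fs, b) \<in> Poly_Mapping.keys u" "gs \<in> Poly_Mapping.keys (ract hs (fs ! \<tau> 0))"
    then have "length fs = Suc n" "length gs = Suc l" using u keys_ract [OF hs'] hs by auto
    then show "frag_of (permute_list \<rho> gs @ drop (Suc 0) (permute_list \<tau> fs), b) =
      frag_of (permute_list (block_perm (Suc l) \<rho> \<tau>) (take (\<tau> 0) fs @ gs @ drop (Suc (\<tau> 0)) fs), b)"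
      by (simp add: permute_list_block_perm [OF \<rho> \<tau>])
  qed
  finally show ?thesis .
qed

text \<open>Permuting positions is contravariant: the permutation applied last is composed on the
  right.\<close>

lemma tperm_compose:
  assumes "\<tau> permutes {..<n}" "Poly_Mapping.keys u \<subseteq> tcarrier n"
  shows "tperm \<tau> (tperm \<sigma> u) = tperm (\<sigma> \<circ> \<tau>) u"
  unfolding tperm_def frag_extend_bind
proof (rule frag_extend_eq, clarify, unfold frag_extend_of split)
  fix hs a assume "(hs, a) \<in> Poly_Mapping.keys u"
  then have "length hs = n" using assms by auto
  then show "frag_of (permute_list \<tau> (permute_list \<sigma> hs), a) = frag_of (permute_list (\<sigma> \<circ> \<tau>) hs, a)"
    using assms by (simp add: permute_list_compose)
qed

text \<open>For skew-symmetrization the multipliers are permuted along with the arguments of the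
  operation; permuting the value back restores their order.\<close>

lemma tperm_tmult:
  assumes \<sigma>: "\<sigma> permutes {..<n}" and hs: "length hs = n" and u: "Poly_Mapping.keys u \<subseteq> tcarrier n"
  shows "tperm \<sigma> (tmult (permute_list (inv \<sigma>) hs) u) = tmult hs (tperm \<sigma> u)"
  unfolding tperm_def tmult_def frag_extend_bind
proof (rule frag_extend_eq, clarify, unfold frag_extend_of split)
  fix gs a assume "(gs, a) \<in> Poly_Mapping.keys u"
  then have gs: "length gs = n" using u by auto
  have "permute_list \<sigma> (permute_list (inv \<sigma>) hs) = hs"
    using permute_list_compose [of \<sigma> hs "inv \<sigma>"] \<sigma> hs by (simp add: permutes_inv_o)
  then show "frag_of (permute_list \<sigma> (map2 (*) (permute_list (inv \<sigma>) hs) gs), a) =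
      frag_of (map2 (*) hs (permute_list \<sigma> gs), a)"
    using map2_permute_list [of \<sigma> "permute_list (inv \<sigma>) hs" gs "(*)"] \<sigma> hs gs by simp
qed

end

section \<open>Signs and shuffles\<close>

lemma msign_add: "msign (a + b) = msign a * msign b"
  by (simp add: msign_def)

lemma msign_square [simp]: "msign a * msign a = 1"
  by (simp add: msign_def)

lemma msign_zero [simp]: "msign 0 = 1"
  by (simp add: msign_def)

lemma msign_sum: "msign (\<Sum>i\<in>I. f i) = (\<Prod>i\<in>I. msign (f i))"
  by (induction I rule: infinite_finite_induct) (auto simp: msign_add)

section \<open>Products over inverted pairs, signature and Koszul sign\<close>

abbreviation ltpairs :: "nat \<Rightarrow> (nat \<times> nat) set" where
  "ltpairs n \<equiv> {(a, b). a < b \<and> b < n}"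

lemma finite_ltpairs: "finite (ltpairs n)"
  by (rule finite_subset [of _ "{..<n} \<times> {..<n}"]) auto

text \<open>Ordered pairs \<open>a < b\<close> stand for two-element subsets, which a permutation
  permutes; \<open>min\<close> and \<open>max\<close> restore the order, and \<open>g\<close> is
  symmetric.\<close>

lemma prod_ltpairs_permute:
  fixes g :: "nat \<Rightarrow> nat \<Rightarrow> int"
  assumes \<beta>: "\<beta> permutes {..<n}" and g: "\<And>a b. g a b = g b a"
  shows "(\<Prod>(a, b)\<in>ltpairs n. g (\<beta> a) (\<beta> b)) = (\<Prod>(a, b)\<in>ltpairs n. g a b)"
proof -
  let ?h = "\<lambda>(a, b). (min (\<beta> a) (\<beta> b), max (\<beta> a) (\<beta> b))"
  have \<beta>n: "\<beta> i < n \<longleftrightarrow> i < n" for i using permutes_in_image [OF \<beta>] by auto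
  have \<beta>i: "\<beta> i = \<beta> j \<longleftrightarrow> i = j" for i j using permutes_inj [OF \<beta>] by (auto simp: inj_def)
  have "?h ` ltpairs n \<subseteq> ltpairs n"
  proof clarify
    fix a b assume "a < b" "b < n"
    then have "\<beta> a \<noteq> \<beta> b" "\<beta> a < n" "\<beta> b < n" using \<beta>i [of a b] \<beta>n [of a] \<beta>n [of b] by auto
    then show "min (\<beta> a) (\<beta> b) < max (\<beta> a) (\<beta> b) \<and> max (\<beta> a) (\<beta> b) < n"
      by linarith
  qed
  moreover have inj: "inj_on ?h (ltpairs n)"
  proof (rule inj_onI, clarify)
    fix a b c d :: nat
    assume lt: "a < b" "c < d" and eq: "min (\<beta> a) (\<beta> b) = min (\<beta> c) (\<beta> d)" "max (\<beta> a) (\<beta> b) =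
        max (\<beta> c) (\<beta> d)"
    have "\<beta> a = \<beta> c \<and> \<beta> b = \<beta> d \<or> \<beta> a = \<beta> d \<and> \<beta> b = \<beta> c"
      using eq by linarith
    then show "a = c \<and> b = d" using lt unfolding \<beta>i by linarith
  qed
  ultimately have "?h ` ltpairs n = ltpairs n"
    by (intro endo_inj_surj finite_ltpairs)
  then have "(\<Prod>(a, b)\<in>ltpairs n. g a b) = (\<Prod>p\<in>ltpairs n. case ?h p of (a, b) \<Rightarrow> g a b)"
    using prod.reindex [OF inj, of "\<lambda>(a, b). g a b"] by (simp add: comp_def)
  also have "\<dots> = (\<Prod>(a, b)\<in>ltpairs n. g (\<beta> a) (\<beta> b))"
  proof (rule prod.cong [OF refl])
    fix p :: "nat \<times> nat"
    obtain a b where p: "p = (a, b)" by (cases p)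
    show "(case ?h p of (a, b) \<Rightarrow> g a b) = (case p of (a, b) \<Rightarrow> g (\<beta> a) (\<beta> b))"
      unfolding p using g [of "\<beta> a" "\<beta> b"] by (simp add: min_def max_def)
  qed
  finally show ?thesis ..
qed

text \<open>Constant weight -1 gives the signature, and the weights in \<open>chi\<close> add the
  Koszul sign; one composition law serves both.\<close>

definition inv_weight :: "(nat \<Rightarrow> nat \<Rightarrow> int) \<Rightarrow> nat \<Rightarrow> (nat \<Rightarrow> nat) \<Rightarrow> int" where
  "inv_weight w n \<theta> = (\<Prod>(a, b)\<in>ltpairs n. if \<theta> b < \<theta> a then w a b else 1)"

lemma inv_weight_symm:
  assumes "\<theta> permutes {..<n}"
  shows "inv_weight w n \<theta> = (\<Prod>(a, b)\<in>ltpairs n. if (a < b) \<noteq> (\<theta> a < \<theta> b) then w a b else 1)"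
proof -
  have "\<theta> i = \<theta> j \<longleftrightarrow> i = j" for i j using permutes_inj [OF assms] by (auto simp: inj_def)
  then show ?thesis unfolding inv_weight_def by (intro prod.cong) (auto simp: not_less le_less)
qed

text \<open>A pair is inverted by \<open>\<alpha> \<circ> \<beta>\<close> iff it is inverted by
  exactly one of \<open>\<beta>\<close> and the subsequent \<open>\<alpha>\<close>. Pairs inverted
  by both contribute a square, which is 1.\<close>

lemma inv_weight_compose:
  assumes \<alpha>: "\<alpha> permutes {..<n}" and \<beta>: "\<beta> permutes {..<n}"
    and w: "\<And>a b. w a b = w b a" "\<And>a b. w a b * w a b = 1"
  shows "inv_weight w n (\<alpha> \<circ> \<beta>) = inv_weight w n \<beta> * inv_weight (\<lambda>i j. w (inv \<beta> i) (inv \<beta> j)) n \<alpha>"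
proof -
  let ?d = "\<lambda>\<theta> a b. (a < b) \<noteq> (\<theta> a < (\<theta> b :: nat))"
  let ?g = "\<lambda>i j. if i \<noteq> j \<and> ?d \<alpha> i j then w (inv \<beta> i) (inv \<beta> j) else 1"
  have \<alpha>i: "\<alpha> i = \<alpha> j \<longleftrightarrow> i = j" for i j using permutes_inj [OF \<alpha>] by (auto simp: inj_def)
  have \<beta>i: "\<beta> i = \<beta> j \<longleftrightarrow> i = j" for i j using permutes_inj [OF \<beta>] by (auto simp: inj_def)
  have "?g i j = ?g j i" for i j
  proof (cases "i = j")
    case False
    then have "?d \<alpha> i j \<longleftrightarrow> ?d \<alpha> j i" using \<alpha>i [of i j] by linarith
    then show ?thesis using w(1) [of "inv \<beta> i" "inv \<beta> j"] by presburger
  qed simp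
  then have "(\<Prod>(a, b)\<in>ltpairs n. ?g a b) = (\<Prod>(a, b)\<in>ltpairs n. ?g (\<beta> a) (\<beta> b))"
    by (intro prod_ltpairs_permute [OF \<beta>, symmetric])
  also have "\<dots> = (\<Prod>(a, b)\<in>ltpairs n. if ?d \<alpha> (\<beta> a) (\<beta> b) then w a b else 1)"
    using \<beta>i by (intro prod.cong) (auto simp: permutes_inverses [OF \<beta>])
  finally have "inv_weight (\<lambda>i j. w (inv \<beta> i) (inv \<beta> j)) n \<alpha> =
      (\<Prod>(a, b)\<in>ltpairs n. if ?d \<alpha> (\<beta> a) (\<beta> b) then w a b else 1)"
    unfolding inv_weight_symm [OF \<alpha>] by (rule trans [rotated]) (rule prod.cong, auto)
  then show ?thesis
    unfolding inv_weight_symm [OF permutes_compose [OF \<beta> \<alpha>]] inv_weight_symm [OF \<beta>]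
    by (simp add: prod.distrib [symmetric] case_prod_unfold, intro prod.cong) (auto simp: w(2))
qed

lemma inv_weight_id: "inv_weight w n id = 1"
  unfolding inv_weight_def by (rule prod.neutral) auto

text \<open>Both sides are multiplicative, which reduces the claim to transpositions; conjugation
  reduces these to adjacent ones, whose only inverted pair is \<open>(a, Suc a)\<close>.\<close>

lemma sign_eq_inv_weight:
  assumes "\<theta> permutes {..<n}"
  shows "sign \<theta> = inv_weight (\<lambda>_ _. - 1) n \<theta>"
proof -
  let ?K = "inv_weight (\<lambda>_ _. - 1) n"
  have K: "?K (\<alpha> \<circ> \<beta>) = ?K \<beta> * ?K \<alpha>" if "\<alpha> permutes {..<n}" "\<beta> permutes {..<n}" for \<alpha> \<beta>
    by (rule inv_weight_compose [OF that]) auto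
  have tr: "?K (transpose a (a + Suc d)) = - 1" if "a + Suc d < n" for a d
    using that
  proof (induction d)
    case 0
    have "?K (transpose a (Suc a)) = (\<Prod>p\<in>ltpairs n. if p = (a, Suc a) then - 1 else 1)"
      unfolding inv_weight_def by (rule prod.cong) (auto simp: transpose_def split: if_splits)
    also have "\<dots> = - 1" using 0 finite_ltpairs by (simp add: prod.delta)
    finally show ?case by simp
  next
    case (Suc d)
    let ?b = "a + Suc d"
    let ?s = "transpose ?b (Suc ?b)"
    have p: "?s permutes {..<n}" "transpose a ?b permutes {..<n}"
      using Suc.prems by (auto intro!: permutes_swap_id)
    have "?K ?s * ?K ?s = 1" using K [OF p(1) p(1)] inv_weight_id by (metis transpose_comp_involutory)
    moreover have "transpose a (Suc ?b) = ?s \<circ> (transpose a ?b \<circ> ?s)"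
      by (auto simp: fun_eq_iff transpose_def)
    ultimately have "?K (transpose a (Suc ?b)) = ?K (transpose a ?b)"
      using K [OF p(1) permutes_compose [OF p(1) p(2)]] K [OF p(2) p(1)] by simp
    then show ?case using Suc by simp
  qed
  show ?thesis using assms
  proof (induction rule: permutes_rev_induct [OF finite_lessThan, consumes 1, case_names id swap])
    case id
    show ?case by (simp only: inv_weight_id sign_id)
  next
    case (swap a b p)
    have "?K (transpose a b) = - 1"
    proof (cases "a < b")
      case True
      then show ?thesis using tr [of a "b - a - 1"] swap by simp
    next
      case False
      then show ?thesis using tr [of b "a - b - 1"] swap by (simp add: transpose_commute)
    qed
    moreover have "sign (p \<circ> transpose a b) = - sign p"
      using swap by (subst sign_compose) (auto intro:
        permutation_swap_id permutation_permutes [THEN iffD2] simp: sign_swap_id)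
    ultimately show ?case using swap by (subst K) (auto intro: permutes_swap_id)
  qed
qed

text \<open>Signature and Koszul sign in one product: an inverted pair contributes -1 and the sign
  of its degrees. Argument \<open>a\<close> is sent to position \<open>\<theta> a\<close>, whereas
  \<open>koszul\<close> expects the inverse of this map.\<close>

definition chi :: "(nat \<Rightarrow> nat) \<Rightarrow> int list \<Rightarrow> int" where
  "chi \<theta> es = inv_weight (\<lambda>a b. msign (es ! a * es ! b + 1)) (length es) \<theta>"

text \<open>A cocycle rather than a homomorphism: after \<open>\<beta>\<close> the arguments stand
  in a new order, so \<open>\<alpha>\<close> sees the permuted degrees.\<close>

lemma chi_compose:
  assumes "\<alpha> permutes {..<length es}" "\<beta> permutes {..<length es}"
  shows "chi (\<alpha> \<circ> \<beta>) es = chi \<beta> es * chi \<alpha> (permute_list (inv \<beta>) es)"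
proof -
  have "chi (\<alpha> \<circ> \<beta>) es = chi \<beta> es * inv_weight (\<lambda>i j. msign (es ! inv \<beta> i * es ! inv \<beta> j + 1))
      (length es) \<alpha>"
    unfolding chi_def by (rule inv_weight_compose [OF assms]) (auto simp: mult.commute)
  also have "inv_weight (\<lambda>i j. msign (es ! inv \<beta> i * es ! inv \<beta> j + 1)) (length es) \<alpha> =
      chi \<alpha> (permute_list (inv \<beta>) es)"
    unfolding chi_def inv_weight_def
    by (rule prod.cong) (use permutes_inv [OF assms(2)] in \<open>auto simp: permute_list_nth\<close>)
  finally show ?thesis .
qed

text \<open>\<open>koszul\<close> multiplies over pairs of target positions, \<open>chi\<close> over
  pairs of arguments; \<open>inv \<theta>\<close> translates one into the other.\<close>

lemma sign_koszul:
  assumes \<theta>: "\<theta> permutes {..<length es}"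
  shows "sign \<theta> * koszul (inv \<theta>) es = chi \<theta> es"
proof -
  let ?n = "length es"
  let ?g = "\<lambda>a b. if a \<noteq> b \<and> (a < b) \<noteq> (\<theta> a < \<theta> b) then msign (es ! a * es ! b) else 1"
  have \<theta>i: "\<theta> i = \<theta> j \<longleftrightarrow> i = j" for i j using permutes_inj [OF \<theta>] by (auto simp: inj_def)
  have "koszul (inv \<theta>) es = (\<Prod>(i, j)\<in>ltpairs ?n. if inv \<theta> j < inv \<theta> i then msign
      (es ! inv \<theta> i * es ! inv \<theta> j) else 1)"
    unfolding koszul_def
    by (rule prod.mono_neutral_cong_left) (auto simp: finite_ltpairs split: if_splits)
  also have "\<dots> = (\<Prod>(i, j)\<in>ltpairs ?n. ?g (inv \<theta> i) (inv \<theta> j))"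
    by (intro prod.cong) (auto simp: permutes_inverses [OF \<theta>] split: if_splits)
  also have "\<dots> = (\<Prod>(a, b)\<in>ltpairs ?n. ?g a b)"
    using \<theta>i by (intro prod_ltpairs_permute permutes_inv \<theta>) (auto simp: mult.commute not_less le_less)
  also have "\<dots> = (\<Prod>(a, b)\<in>ltpairs ?n. if \<theta> b < \<theta> a then msign (es ! a * es ! b) else 1)"
    using \<theta>i by (intro prod.cong) (auto simp: not_less le_less)
  finally show ?thesis
    unfolding sign_eq_inv_weight [OF \<theta>] chi_def inv_weight_def
    by (simp add: prod.distrib [symmetric] case_prod_unfold, intro prod.cong) (auto simp: msign_def)
qed

text \<open>Pairs of arguments are split into inner, outer and mixed ones. The first two kinds
  contribute equally to both sides. A mixed pair is inverted exactly when the outer argument comes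
  before the block, whichever inner argument is taken, so a discrepancy arises only from outer
  arguments before the block.\<close>

lemma chi_block_perm:
  assumes \<rho>: "\<rho> permutes {..<l}" and \<tau>: "\<tau> permutes {..<Suc n}"
    and l: "0 < l" and es: "length es = n + l"
  shows "chi \<rho> (take l es) * chi \<tau> ((sum_list (take l es) + int l - 2) # drop l es) =
    chi (block_perm l \<rho> \<tau>) es * msign ((int l + 1) * int (\<tau> 0) +
      int l * sum_list (take (\<tau> 0) (permute_list (inv (block_perm l \<rho> \<tau>)) es)))"
proof -
  define \<theta> where "\<theta> = block_perm l \<rho> \<tau>"
  define q where "q = \<tau> 0"
  define S where "S = sum_list (take l es)"
  define w where "w a b = msign (es ! a * es ! b + 1)" for a b
  have \<theta>: "\<theta> permutes {..<n + l}" unfolding \<theta>_def by (rule block_perm_permutes [OF \<rho> \<tau> l])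
  have \<rho>l: "\<rho> i < l \<longleftrightarrow> i < l" for i using permutes_in_image [OF \<rho>] by auto
  have \<tau>n: "\<tau> i < Suc n \<longleftrightarrow> i < Suc n" for i using permutes_in_image [OF \<tau>] by auto
  have \<tau>i: "\<tau> i = \<tau> j \<longleftrightarrow> i = j" for i j using permutes_inj [OF \<tau>] by (auto simp: inj_def)
  have qn: "q < Suc n" using \<tau>n q_def by simp
  have th1: "\<theta> i = q + \<rho> i" if "i < l" for i using that by (simp add: \<theta>_def block_perm_def q_def)
  have th2: "\<theta> (i + l) = (if \<tau> (Suc i) < q then \<tau> (Suc i) else \<tau> (Suc i) + l - 1)" for i
    using l by (simp add: \<theta>_def block_perm_def q_def)
  have ne: "\<tau> (Suc i) \<noteq> q" for i using \<tau>i [of "Suc i" 0] q_def by simp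
  have th3: "\<theta> (j + l) < \<theta> (i + l) \<longleftrightarrow> \<tau> (Suc j) < \<tau> (Suc i)" for i j
    using ne [of i] ne [of j] l by (auto simp: th2)
  have th4: "\<theta> (i + l) < q \<longleftrightarrow> \<tau> (Suc i) < q" for i
    using ne [of i] l by (auto simp: th2)
  have th5: "\<theta> (b + l) < \<theta> a \<longleftrightarrow> \<tau> (Suc b) < q" if "a < l" for a b
    using ne [of b] l that \<rho>l [of a] by (auto simp: th2 th1)
  let ?f = "\<lambda>(a, b). if \<theta> b < \<theta> a then w a b else 1"
  let ?P2 = "(\<lambda>(a, b). (a + l, b + l)) ` ltpairs n"
  let ?P3 = "(\<lambda>(a, b). (a, b + l)) ` ({..<l} \<times> {..<n})"
  have split: "ltpairs (n + l) = ltpairs l \<union> ?P2 \<union> ?P3"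
  proof (intro equalityI subsetI)
    fix p assume "p \<in> ltpairs (n + l)"
    then obtain a b where p: "p = (a, b)" "a < b" "b < n + l" by auto
    consider "b < l" | "a < l" "l \<le> b" | "l \<le> a" by linarith
    then show "p \<in> ltpairs l \<union> ?P2 \<union> ?P3"
    proof cases
      case 2
      then have "p = (\<lambda>(a, b). (a, b + l)) (a, b - l)" "(a, b - l) \<in> {..<l} \<times> {..<n}" using p by auto
      then show ?thesis by blast
    next
      case 3
      then have "p = (\<lambda>(a, b). (a + l, b + l)) (a - l, b - l)" "(a - l, b - l) \<in> ltpairs n" using p
          by auto
      then show ?thesis by blast
    qed (use p in auto)
  qed auto
  have "chi \<theta> es = prod ?f (ltpairs (n + l))"
    unfolding chi_def inv_weight_def es w_def ..
  also have "\<dots> = prod ?f (ltpairs l \<union> ?P2) * prod ?f ?P3"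
    unfolding split by (rule prod.union_disjoint) (auto simp: finite_ltpairs)
  also have "prod ?f (ltpairs l \<union> ?P2) = prod ?f (ltpairs l) * prod ?f ?P2"
    by (rule prod.union_disjoint) (auto simp: finite_ltpairs)
  also have "prod ?f (ltpairs l) = chi \<rho> (take l es)"
    unfolding chi_def inv_weight_def using es by (intro prod.cong) (auto simp: th1 w_def)
  also have "prod ?f ?P2 = (\<Prod>(a, b)\<in>ltpairs n. if \<tau> (Suc b) < \<tau> (Suc a) then w (a + l) (b + l) else 1)"
    by (subst prod.reindex) (auto simp: inj_on_def th3 intro!: prod.cong)
  also have "prod ?f ?P3 = (\<Prod>(a, b)\<in>{..<l} \<times> {..<n}. if \<tau> (Suc b) < q then w a (b + l) else 1)"
    by (subst prod.reindex) (auto simp: inj_on_def th5 intro!: prod.cong)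
  also have "\<dots> = (\<Prod>b<n. \<Prod>a<l. if \<tau> (Suc b) < q then w a (b + l) else 1)"
    by (subst prod.swap) (simp add: prod.cartesian_product)
  also have "\<dots> = (\<Prod>b<n. if \<tau> (Suc b) < q then msign (S * es ! (b + l) + int l) else 1)"
  proof (rule prod.cong)
    fix b
    have "(\<Prod>a<l. w a (b + l)) = msign (\<Sum>a<l. es ! a * es ! (b + l) + 1)"
      by (simp add: w_def msign_sum)
    also have "(\<Sum>a<l. es ! a * es ! (b + l) + 1) = S * es ! (b + l) + int l"
      using es by (simp add: S_def sum.distrib sum_distrib_right sum_list_sum_nth atLeast0LessThan)
    finally show "(\<Prod>a<l. if \<tau> (Suc b) < q then w a (b + l) else 1) =
        (if \<tau> (Suc b) < q then msign (S * es ! (b + l) + int l) else 1)"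
      by simp
  qed simp
  finally have chi_\<theta>: "chi \<theta> es = chi \<rho> (take l es) *
     (\<Prod>(a, b)\<in>ltpairs n. if \<tau> (Suc b) < \<tau> (Suc a) then w (a + l) (b + l) else 1) *
     (\<Prod>b<n. if \<tau> (Suc b) < q then msign (S * es ! (b + l) + int l) else 1)" .
  \<comment> \<open>On the outer level the block is a single argument; \<open>S + l - 2\<close> is
    the degree of a value of an operation of degree \<open>l - 2\<close>.\<close>
  let ?e = "(S + int l - 2) # drop l es"
  let ?g = "\<lambda>(a, b). if \<tau> b < \<tau> a then msign (?e ! a * ?e ! b + 1) else 1"
  let ?Q1 = "(\<lambda>b. (0, Suc b)) ` {..<n}"
  let ?Q2 = "(\<lambda>(a, b). (Suc a, Suc b)) ` ltpairs n"
  have split': "ltpairs (Suc n) = ?Q1 \<union> ?Q2"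
  proof (intro equalityI subsetI)
    fix p assume "p \<in> ltpairs (Suc n)"
    then obtain a b where p: "p = (a, Suc b)" "a < Suc b" "b < n" by (auto elim: less_natE)
    then show "p \<in> ?Q1 \<union> ?Q2" by (cases a) auto
  qed auto
  have "chi \<tau> ?e = prod ?g (ltpairs (Suc n))"
    using es by (simp add: chi_def inv_weight_def)
  also have "\<dots> = prod ?g ?Q1 * prod ?g ?Q2"
    unfolding split' by (rule prod.union_disjoint) (auto simp: finite_ltpairs)
  also have "prod ?g ?Q1 = (\<Prod>b<n. if \<tau> (Suc b) < q then msign ((S + int l - 2) * es ! (b + l) + 1)
      else 1)"
    using es by (subst prod.reindex) (auto simp: inj_on_def q_def add.commute intro!: prod.cong)
  also have "prod ?g ?Q2 = (\<Prod>(a, b)\<in>ltpairs n. if \<tau> (Suc b) < \<tau> (Suc a) then w (a + l) (b + l) else 1)"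
    using es by (subst prod.reindex) (auto simp: inj_on_def w_def add.commute intro!: prod.cong)
  finally have chi_\<tau>: "chi \<tau> ?e = (\<Prod>b<n. if \<tau> (Suc b) < q then msign
      ((S + int l - 2) * es ! (b + l) + 1) else 1) *
    (\<Prod>(a, b)\<in>ltpairs n. if \<tau> (Suc b) < \<tau> (Suc a) then w (a + l) (b + l) else 1)" .
  \<comment> \<open>Modulo 2 this is \<open>(S + l - 2) e + 1\<close> minus \<open>S e + l\<close>
    for an outer argument of degree \<open>e\<close>: passing the inner operation once, compared
    with passing its \<open>l\<close> arguments one by one.\<close>
  let ?F = "\<lambda>b. int l + 1 + int l * es ! b"
  have "(\<Prod>b<n. if \<tau> (Suc b) < q then msign ((S + int l - 2) * es ! (b + l) + 1) else 1) =
    (\<Prod>b<n. (if \<tau> (Suc b) < q then msign (S * es ! (b + l) + int l) else 1) *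
        (if \<tau> (Suc b) < q then msign (?F (b + l)) else 1))"
    by (rule prod.cong) (auto simp: msign_def)
  also have "\<dots> = (\<Prod>b<n. if \<tau> (Suc b) < q then msign (S * es ! (b + l) + int l) else 1) *
     (\<Prod>b<n. if \<tau> (Suc b) < q then msign (?F (b + l)) else 1)"
    by (rule prod.distrib)
  also have "(\<Prod>b<n. if \<tau> (Suc b) < q then msign (?F (b + l)) else 1) =
      (\<Prod>b\<in>{b. b < n \<and> \<tau> (Suc b) < q}. msign (?F (b + l)))"
    by (rule prod.mono_neutral_cong_right) auto
  \<comment> \<open>The outer arguments before the block are those that \<open>\<theta>\<close>
    sends to the first \<open>q\<close> positions; indexed by position, their degrees are the first
    \<open>q\<close> entries of the permuted list.\<close>
  also have "\<dots> = (\<Prod>i<q. msign (?F (inv \<theta> i)))"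
  proof (rule prod.reindex_bij_witness [of _ "\<lambda>i. inv \<theta> i - l" "\<lambda>b. \<theta> (b + l)"])
    fix i assume i: "i \<in> {..<q}"
    have "inv \<theta> i < n + l" using i qn l permutes_in_image [OF permutes_inv [OF \<theta>], of i] by auto
    moreover have "\<not> inv \<theta> i < l"
    proof
      assume "inv \<theta> i < l"
      then have "\<theta> (inv \<theta> i) \<ge> q" using th1 by simp
      then show False using i permutes_inverses [OF \<theta>] by simp
    qed
    ultimately have *: "inv \<theta> i - l + l = inv \<theta> i" "inv \<theta> i - l < n" by auto
    then show "\<theta> (inv \<theta> i - l + l) = i" using permutes_inverses [OF \<theta>] by simp
    then show "inv \<theta> i - l \<in> {b. b < n \<and> \<tau> (Suc b) < q}" using * i th4 [of "inv \<theta> i - l"] by auto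
  next
    fix b assume "b \<in> {b. b < n \<and> \<tau> (Suc b) < q}"
    then show "\<theta> (b + l) \<in> {..<q}" "inv \<theta> (\<theta> (b + l)) - l = b" "msign (?F (inv \<theta> (\<theta> (b + l)))) =
        msign (?F (b + l))"
      using th4 permutes_inverses [OF \<theta>] by auto
  qed
  also have "\<dots> = msign (\<Sum>i<q. ?F (inv \<theta> i))" by (simp add: msign_sum)
  also have "(\<Sum>i<q. ?F (inv \<theta> i)) = (int l + 1) * int q + int l * (\<Sum>i<q. es ! inv \<theta> i)"
    by (simp add: sum.distrib sum_distrib_left algebra_simps)
  also have "(\<Sum>i<q. es ! inv \<theta> i) = sum_list (take q (permute_list (inv \<theta>) es))"
    using es qn l permutes_inv [OF \<theta>] by
      (simp add: sum_list_sum_nth permute_list_nth atLeast0LessThan min_def)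
  finally show ?thesis
    using chi_\<theta> chi_\<tau> unfolding \<theta>_def [symmetric] q_def [symmetric] S_def [symmetric]
      by (simp add: mult_ac)
qed


section \<open>Shuffles and block permutations\<close>

lemma ex_shuffle:
  assumes B: "B \<subseteq> {..<N}" and card: "card B = l"
  shows "\<exists>\<sigma>\<in>shuffles_of l N. \<sigma> ` {..<l} = B"
proof -
  \<comment> \<open>The required shuffle enumerates \<open>B\<close> increasingly and then its
    complement.\<close>
  let ?C = "{..<N} - B"
  let ?xs = "sorted_list_of_set B @ sorted_list_of_set ?C"
  have fin: "finite B" using B finite_subset by blast
  have len: "length (sorted_list_of_set B) = l" using card fin by simp
  have lN: "l \<le> N" using card_mono [OF _ B] card by simp
  have lenC: "length (sorted_list_of_set ?C) = N - l" using card card_Diff_subset [OF fin B] fin by simp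
  have lenxs: "length ?xs = N" using len lenC lN by simp
  have dist: "distinct ?xs" using fin by auto
  have set: "set ?xs = {..<N}" using B fin by auto
  define \<sigma> where "\<sigma> i = (if i < N then ?xs ! i else i)" for i
  have "\<sigma> permutes {..<N}"
  proof (rule inj_imp_permutes)
    have "?xs ! i = ?xs ! j \<longleftrightarrow> i = j" if "i < N" "j < N" for i j
      by (rule nth_eq_iff_index_eq [OF dist]) (use that lenxs in simp_all)
    then show "inj_on \<sigma> {..<N}" by (intro inj_onI) (simp add: \<sigma>_def)
    fix i show "\<sigma> i \<in> {..<N}" if "i \<in> {..<N}"
      using that set nth_mem [of i ?xs] lenxs by (simp add: \<sigma>_def)
  qed (simp_all add: \<sigma>_def)
  moreover have "strict_mono_on {..<l} \<sigma>"
  proof (rule strict_mono_onI)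
    fix i j assume "i \<in> {..<l}" "j \<in> {..<l}" "i < j"
    then show "\<sigma> i < \<sigma> j"
      using sorted_wrt_nth_less [OF strict_sorted_list_of_set [of B], of i j] len lN
        by (simp add: \<sigma>_def nth_append)
  qed
  moreover have "strict_mono_on {l..<N} \<sigma>"
  proof (rule strict_mono_onI)
    fix i j assume "i \<in> {l..<N}" "j \<in> {l..<N}" "i < j"
    then show "\<sigma> i < \<sigma> j"
      using sorted_wrt_nth_less [OF strict_sorted_list_of_set [of ?C], of "i - l" "j - l"] len lenC
        by (simp add: \<sigma>_def nth_append)
  qed
  moreover have "\<sigma> ` {..<l} = B"
  proof -
    have "\<sigma> ` {..<l} = (!) (sorted_list_of_set B) ` {..<length (sorted_list_of_set B)}"
      unfolding len by (rule image_cong) (use len lN in \<open>auto simp: \<sigma>_def nth_append\<close>)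
    also have "\<dots> = B" using fin by (simp add:
        nth_image [of _ "sorted_list_of_set B", unfolded take_all_iff] lessThan_atLeast0)
    finally show ?thesis .
  qed
  ultimately show ?thesis unfolding shuffles_of_def by blast
qed

text \<open>Both maps enumerate the same finite set in increasing order, and a sorted list without
  repetitions is determined by its set.\<close>

lemma strict_mono_on_image_unique:
  fixes f g :: "nat \<Rightarrow> nat"
  assumes "strict_mono_on {a..<b} f" "strict_mono_on {a..<b} g" "f ` {a..<b} = g ` {a..<b}" "i \<in> {a..<b}"
  shows "f i = g i"
proof -
  have s: "sorted (map h [a..<b]) \<and> distinct (map h [a..<b])" if "strict_mono_on {a..<b} h" for h ::
      "nat \<Rightarrow> nat"
  proof -
    have "sorted_wrt (<) (map h [a..<b])"
      unfolding sorted_wrt_map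
      by (rule sorted_wrt_mono_rel [of _ "(<)"]) (use that in \<open>auto intro: strict_mono_onD\<close>)
    then show ?thesis by (simp add: strict_sorted_iff)
  qed
  have "map f [a..<b] = map g [a..<b]"
    using s [OF assms(1)] s [OF assms(2)] assms(3)
    by (intro sorted_distinct_set_unique) auto
  then show ?thesis using assms(4) by simp
qed

text \<open>The two blocks are increasing enumerations of the image of the first \<open>l\<close>
  positions and of its complement. Together with \<open>ex_shuffle\<close>, shuffles thus correspond
  to subsets of size \<open>l\<close>.\<close>

lemma shuffle_unique:
  assumes "\<sigma> \<in> shuffles_of l N" "\<sigma>' \<in> shuffles_of l N" "\<sigma> ` {..<l} = \<sigma>' ` {..<l}" "l \<le> N"
  shows "\<sigma> = \<sigma>'"
proof
  have p: "\<sigma> permutes {..<N}" "\<sigma>' permutes {..<N}" using assms by (auto simp: shuffles_of_def)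
  have im: "\<tau> ` {l..<N} = {..<N} - \<tau> ` {..<l}" if "\<tau> permutes {..<N}" for \<tau>
  proof -
    have "{l..<N} = {..<N} - {..<l}" using assms(4) by auto
    then show ?thesis using permutes_image [OF that] image_set_diff [OF permutes_inj [OF that]] by metis
  qed
  fix i
  consider "i \<in> {0..<l}" | "i \<in> {l..<N}" | "i \<notin> {..<N}" using assms(4) by fastforce
  then show "\<sigma> i = \<sigma>' i"
  proof cases
    case 1
    then show ?thesis using assms
      by (intro strict_mono_on_image_unique [of 0 l \<sigma> \<sigma>']) (auto simp: shuffles_of_def lessThan_atLeast0)
  next
    case 2
    then show ?thesis using assms im [OF p(1)] im [OF p(2)]
      by (intro strict_mono_on_image_unique [of l N \<sigma> \<sigma>']) (auto simp: shuffles_of_def)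
  next
    case 3
    then show ?thesis using permutes_not_in [OF p(1) 3] permutes_not_in [OF p(2) 3] by simp
  qed
qed

lemma block_perm_image:
  assumes "\<rho> permutes {..<l}"
  shows "block_perm l \<rho> \<tau> ` {..<l} = {\<tau> 0..<\<tau> 0 + l}"
proof -
  have "block_perm l \<rho> \<tau> ` {..<l} = (+) (\<tau> 0) ` (\<rho> ` {..<l})"
    unfolding image_image by (rule image_cong) (auto simp: block_perm_def)
  then show ?thesis using permutes_image [OF assms]
      by (simp add: lessThan_atLeast0 image_add_atLeastLessThan add.commute)
qed

lemma block_perm_inject:
  assumes \<rho>: "\<rho> permutes {..<l}" "\<rho>' permutes {..<l}"
    and \<tau>: "\<tau> permutes {..<Suc n}" "\<tau>' permutes {..<Suc n}"
    and l: "0 < l" and eq: "block_perm l \<rho> \<tau> = block_perm l \<rho>' \<tau>'" and q: "\<tau> 0 = \<tau>' 0"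
  shows "\<rho> = \<rho>'" "\<tau> = \<tau>'"
proof -
  have eq': "block_perm l \<rho> \<tau> i = block_perm l \<rho>' \<tau>' i" for i using eq by simp
  show "\<rho> = \<rho>'"
  proof
    fix i show "\<rho> i = \<rho>' i"
      using eq' [of i] q permutes_not_in [OF \<rho>(1), of i] permutes_not_in [OF \<rho>(2), of i]
      by (cases "i < l") (auto simp: block_perm_def)
  qed
  show "\<tau> = \<tau>'"
  proof
    fix j show "\<tau> j = \<tau>' j"
    proof (cases j)
      case (Suc i)
      have "\<tau> j \<noteq> \<tau> 0" "\<tau>' j \<noteq> \<tau>' 0"
        using Suc permutes_inj [OF \<tau>(1)] permutes_inj [OF \<tau>(2)] by (metis injD nat.distinct(1))+
      then show ?thesis using eq' [of "i + l"] q l Suc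
        by (auto simp: block_perm_def split: if_splits)
    qed (use q in simp)
  qed
qed

text \<open>The order inside the block gives \<open>\<rho>\<close>, and collapsing the block to a
  single position gives \<open>\<tau>\<close>.\<close>

lemma block_perm_surj:
  assumes \<theta>: "\<theta> permutes {..<n + l}" and l: "0 < l" and q: "q < Suc n"
    and im: "\<theta> ` {..<l} = {q..<q + l}"
  shows "\<exists>\<rho> \<tau>. \<rho> permutes {..<l} \<and> \<tau> permutes {..<Suc n} \<and> \<tau> 0 = q \<and> block_perm l \<rho> \<tau> = \<theta>"
proof -
  define \<rho> where "\<rho> i = (if i < l then \<theta> i - q else i)" for i
  \<comment> \<open>Outer argument \<open>j > 0\<close> is argument \<open>j + l - 1\<close> of the
    whole list. Positions behind the block drop by \<open>l - 1\<close> when the block becomes the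
    single position \<open>q\<close>.\<close>
  define \<tau> where "\<tau> j = (if j = 0 then q else if j < Suc n then
      (if \<theta> (j + l - 1) < q then \<theta> (j + l - 1) else \<theta> (j + l - 1) + 1 - l) else j)" for j
  have \<theta>i: "\<theta> i = \<theta> j \<longleftrightarrow> i = j" for i j using permutes_inj [OF \<theta>] by (auto simp: inj_def)
  have \<theta>n: "\<theta> i < n + l \<longleftrightarrow> i < n + l" for i using permutes_in_image [OF \<theta>] by auto
  have blk: "i < l \<longleftrightarrow> q \<le> \<theta> i \<and> \<theta> i < q + l" for i
  proof -
    have "i < l \<longleftrightarrow> \<theta> i \<in> \<theta> ` {..<l}" using \<theta>i by auto
    then show ?thesis unfolding im by simp
  qed
  have nblk: "\<theta> i < q \<or> q + l \<le> \<theta> i" if "l \<le> i" for i using blk [of i] that by auto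
  have \<tau>_cases: "\<tau> j < q \<and> \<tau> j = \<theta> (j + l - 1) \<or> q < \<tau> j \<and> \<tau> j + l = \<theta> (j + l - 1) + 1"
    if "0 < j" "j < Suc n" for j
  proof -
    have "l \<le> j + l - 1" using that by simp
    from nblk [OF this] show ?thesis using that l by (auto simp: \<tau>_def)
  qed
  have "\<rho> permutes {..<l}"
  proof (rule inj_imp_permutes)
    show "inj_on \<rho> {..<l}"
    proof (rule inj_onI)
      fix i j assume "i \<in> {..<l}" "j \<in> {..<l}" "\<rho> i = \<rho> j"
      then have "\<theta> i - q = \<theta> j - q" "q \<le> \<theta> i" "q \<le> \<theta> j" using blk [of i] blk [of j]
          by (simp_all add: \<rho>_def)
      then have "\<theta> i = \<theta> j" by linarith
      then show "i = j" using \<theta>i by simp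
    qed
    fix i show "\<rho> i \<in> {..<l}" if "i \<in> {..<l}" using that blk [of i] by (auto simp: \<rho>_def)
  qed (simp_all add: \<rho>_def)
  moreover have "\<tau> permutes {..<Suc n}"
  proof (rule inj_imp_permutes)
    show "inj_on \<tau> {..<Suc n}"
    proof (rule inj_onI)
      fix i j assume *: "i \<in> {..<Suc n}" "j \<in> {..<Suc n}" "\<tau> i = \<tau> j"
      show "i = j"
      proof (cases "i = 0 \<or> j = 0")
        case True
        then show ?thesis using *(1,2) *(3) \<tau>_cases [of i] \<tau>_cases [of j]
            by (cases "i = 0"; cases "j = 0") (auto simp: \<tau>_def [of 0])
      next
        case False
        then have "\<theta> (i + l - 1) = \<theta> (j + l - 1)"
          using \<tau>_cases [of i] \<tau>_cases [of j] * by auto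
        then have "i + l - 1 = j + l - 1" unfolding \<theta>i .
        then show ?thesis using False l by linarith
      qed
    qed
    fix j show "\<tau> j \<in> {..<Suc n}" if "j \<in> {..<Suc n}"
      using that q l \<theta>n [of "j + l - 1"] by (auto simp: \<tau>_def)
  qed (simp_all add: \<tau>_def)
  moreover have "block_perm l \<rho> \<tau> = \<theta>"
  proof
    fix i
    show "block_perm l \<rho> \<tau> i = \<theta> i"
    proof (cases "i < l")
      case True
      then show ?thesis using blk [of i] by (simp add: block_perm_def \<rho>_def \<tau>_def)
    next
      case False
      then have i: "i + 1 - l \<noteq> 0" "i + 1 - l + l - 1 = i" using l by auto
      show ?thesis
      proof (cases "i < n + l")
        case True
        then have "i + 1 - l < Suc n" using False l by auto
        then show ?thesis using False i nblk [of i] l by (auto simp: block_perm_def \<tau>_def)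
      next
        case ge: False
        then have "\<not> i + 1 - l < Suc n" using l by auto
        then show ?thesis using ge False i q permutes_not_in [OF \<theta>, of i] l
            by (auto simp: block_perm_def \<tau>_def)
      qed
    qed
  qed
  ultimately show ?thesis by (intro exI [of _ \<rho>] exI [of _ \<tau>]) (simp add: \<tau>_def)
qed

text \<open>A shuffle followed by permutations inside the inner and the outer operation amounts to an
  arbitrary ordering of the arguments together with the position of the inner operation.\<close>

lemma bij_betw_shuffle_block:
  assumes l: "0 < l"
  shows "bij_betw (\<lambda>(\<sigma>, \<rho>, \<tau>). (\<sigma> \<circ> inv (block_perm l \<rho> \<tau>), \<tau> 0))
    (shuffles_of l (n + l) \<times> {\<rho>. \<rho> permutes {..<l}} \<times> {\<tau>. \<tau> permutes {..<Suc n}})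
    ({\<pi>. \<pi> permutes {..<n + l}} \<times> {..<Suc n})"
proof (rule bij_betwI')
  fix x y
  assume x: "x \<in> shuffles_of l (n + l) \<times> {\<rho>. \<rho> permutes {..<l}} \<times> {\<tau>. \<tau> permutes {..<Suc n}}"
    and y: "y \<in> shuffles_of l (n + l) \<times> {\<rho>. \<rho> permutes {..<l}} \<times> {\<tau>. \<tau> permutes {..<Suc n}}"
  obtain \<sigma> \<rho> \<tau> where x': "x = (\<sigma>, \<rho>, \<tau>)" by (cases x)
  obtain \<sigma>' \<rho>' \<tau>' where y': "y = (\<sigma>', \<rho>', \<tau>')" by (cases y)
  let ?\<theta> = "block_perm l \<rho> \<tau>" let ?\<theta>' = "block_perm l \<rho>' \<tau>'"
  have p: "\<rho> permutes {..<l}" "\<tau> permutes {..<Suc n}" "\<rho>' permutes {..<l}" "\<tau>' permutes {..<Suc n}"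
    "\<sigma> \<in> shuffles_of l (n + l)" "\<sigma>' \<in> shuffles_of l (n + l)"
    using x y x' y' by auto
  have \<theta>: "?\<theta> permutes {..<n + l}" "?\<theta>' permutes {..<n + l}" using p l
      by (auto intro: block_perm_permutes)
  have "\<sigma> = \<sigma>' \<and> \<rho> = \<rho>' \<and> \<tau> = \<tau>'" if eq: "\<sigma> \<circ> inv ?\<theta> = \<sigma>' \<circ> inv ?\<theta>'" and q: "\<tau> 0 = \<tau>' 0"
  proof -
    \<comment> \<open>The block positions are filled by the first \<open>l\<close> arguments, so the
      common ordering determines the image of these under \<open>\<sigma>\<close>, and a shuffle is
      determined by that set.\<close>
    have inv_im: "inv ?\<theta> ` {\<tau> 0..<\<tau> 0 + l} = {..<l}" "inv ?\<theta>' ` {\<tau>' 0..<\<tau>' 0 + l} = {..<l}"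
      using image_inv_f_f [OF permutes_inj [OF \<theta>(1)], of "{..<l}"] image_inv_f_f
        [OF permutes_inj [OF \<theta>(2)], of "{..<l}"]
      unfolding block_perm_image [OF p(1)] block_perm_image [OF p(3)] by auto
    then have "\<sigma> ` {..<l} = (\<sigma> \<circ> inv ?\<theta>) ` {\<tau> 0..<\<tau> 0 + l}" "\<sigma>' ` {..<l} =
        (\<sigma>' \<circ> inv ?\<theta>') ` {\<tau>' 0..<\<tau>' 0 + l}"
      by (simp_all only: image_comp [symmetric])
    then have "\<sigma> ` {..<l} = \<sigma>' ` {..<l}" unfolding eq q by (rule trans [OF _ sym])
    then have \<sigma>: "\<sigma> = \<sigma>'" using p by (intro shuffle_unique) auto
    have "inj \<sigma>" using p(5) permutes_inj by (auto simp: shuffles_of_def)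
    have "inv ?\<theta> i = inv ?\<theta>' i" for i
      using fun_cong [OF eq, of i] unfolding \<sigma> [symmetric] comp_apply by (rule injD [OF \<open>inj \<sigma>\<close>])
    then have "inv ?\<theta> = inv ?\<theta>'" ..
    then have "inv (inv ?\<theta>) = inv (inv ?\<theta>')" by simp
    then have "?\<theta> = ?\<theta>'" unfolding permutes_inv_inv [OF \<theta>(1)] permutes_inv_inv [OF \<theta>(2)] .
    then show ?thesis using block_perm_inject [OF p(1,3,2,4) l _ q] \<sigma> by simp
  qed
  then show "((case x of (\<sigma>, \<rho>, \<tau>) \<Rightarrow> (\<sigma> \<circ> inv (block_perm l \<rho> \<tau>), \<tau> 0)) =
        (case y of (\<sigma>, \<rho>, \<tau>) \<Rightarrow> (\<sigma> \<circ> inv (block_perm l \<rho> \<tau>), \<tau> 0))) = (x = y)"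
    unfolding x' y' split prod.inject by blast
  have "\<sigma> \<circ> inv ?\<theta> permutes {..<n + l}"
    by (rule permutes_compose [OF permutes_inv [OF \<theta>(1)]]) (use p(5) in \<open>simp add: shuffles_of_def\<close>)
  moreover have "\<tau> 0 < Suc n" using permutes_in_image [OF p(2), of 0] by simp
  ultimately show "(case x of (\<sigma>, \<rho>, \<tau>) \<Rightarrow> (\<sigma> \<circ> inv (block_perm l \<rho> \<tau>), \<tau> 0)) \<in>
      {\<pi>. \<pi> permutes {..<n + l}} \<times> {..<Suc n}"
    unfolding x' by simp
next
  fix z assume "z \<in> {\<pi>. \<pi> permutes {..<n + l}} \<times> {..<Suc n}"
  then obtain \<pi> q where z: "z = (\<pi>, q)" and \<pi>: "\<pi> permutes {..<n + l}" and q: "q < Suc n" by auto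
  have "\<pi> ` {q..<q + l} \<subseteq> \<pi> ` {..<n + l}" using q by (intro image_mono) auto
  then have "\<pi> ` {q..<q + l} \<subseteq> {..<n + l}" using permutes_image [OF \<pi>] by simp
  moreover have "card (\<pi> ` {q..<q + l}) = l" using permutes_inj_on [OF \<pi>] by (simp add: card_image)
  \<comment> \<open>The shuffle is forced: its first block lists the arguments that
    \<open>\<pi>\<close> puts into positions \<open>q\<close> to \<open>q + l - 1\<close>.\<close>
  ultimately obtain \<sigma> where \<sigma>: "\<sigma> \<in> shuffles_of l (n + l)" "\<sigma> ` {..<l} = \<pi> ` {q..<q + l}"
    using bexE [OF ex_shuffle] by metis
  have \<sigma>p: "\<sigma> permutes {..<n + l}" using \<sigma> by (simp add: shuffles_of_def)
  have "(inv \<pi> \<circ> \<sigma>) ` {..<l} = {q..<q + l}"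
    unfolding image_comp [symmetric] \<sigma>(2) using permutes_inj [OF \<pi>] by (rule image_inv_f_f)
  from block_perm_surj [OF permutes_compose [OF \<sigma>p permutes_inv [OF \<pi>]] l q this]
  obtain \<rho> \<tau> where \<rho>\<tau>: "\<rho> permutes {..<l}" "\<tau> permutes {..<Suc n}" "\<tau> 0 = q" "block_perm l \<rho> \<tau> =
      inv \<pi> \<circ> \<sigma>"
    by (elim exE conjE)
  have "\<sigma> \<circ> inv (block_perm l \<rho> \<tau>) = \<pi>"
  proof -
    have "inv (inv \<pi> \<circ> \<sigma>) = inv \<sigma> \<circ> \<pi>"
      using o_inv_distrib [OF permutes_bij [OF permutes_inv [OF \<pi>]] permutes_bij [OF \<sigma>p]]
        permutes_inv_inv [OF \<pi>] by simp
    then show ?thesis unfolding \<rho>\<tau>(4) by (simp add: o_assoc permutes_inv_o [OF \<sigma>p])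
  qed
  then have "z = (\<lambda>(\<sigma>, \<rho>, \<tau>). (\<sigma> \<circ> inv (block_perm l \<rho> \<tau>), \<tau> 0)) (\<sigma>, \<rho>, \<tau>)"
    unfolding z split using \<rho>\<tau>(3) by blast
  moreover have "(\<sigma>, \<rho>, \<tau>) \<in> shuffles_of l (n + l) \<times> {\<rho>. \<rho> permutes {..<l}} \<times> {\<tau>. \<tau> permutes {..<Suc n}}"
    using \<sigma>(1) \<rho>\<tau>(1,2) by blast
  ultimately show "\<exists>x\<in>shuffles_of l (n + l) \<times> {\<rho>. \<rho> permutes {..<l}} \<times> {\<tau>. \<tau> permutes {..<Suc n}}.
      z = (case x of (\<sigma>, \<rho>, \<tau>) \<Rightarrow> (\<sigma> \<circ> inv (block_perm l \<rho> \<tau>), \<tau> 0))"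
    by (rule bexI)
qed

section \<open>Skew-symmetrization\<close>

lemma permute_list_inv_cancel:
  assumes "\<sigma> permutes {..<length xs}"
  shows "permute_list \<sigma> (permute_list (inv \<sigma>) xs) = xs" "permute_list (inv \<sigma>) (permute_list \<sigma> xs) = xs"
  using permute_list_compose [OF assms, of "inv \<sigma>"] permute_list_compose
    [OF permutes_inv [OF assms], of \<sigma>]
  by (simp_all add: permutes_inv_o [OF assms])

context graded_hopf_module
begin

section \<open>Homogeneous components\<close>

lemma act_zero [simp]: "h \<cdot> 0 = 0"
  using act_add_right [of h 0 0] by simp

lemma hcomp_props: "hcomp a d \<in> A d" "finite {d. hcomp a d \<noteq> 0}" "a = (\<Sum>d | hcomp a d \<noteq> 0. hcomp a d)"
  using theI' [OF direct_sum [of a]] unfolding hcomp_def by blast+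

lemma hcomp_unique:
  assumes "\<And>d. c d \<in> A d" "finite {d. c d \<noteq> 0}" "a = (\<Sum>d | c d \<noteq> 0. c d)"
  shows "hcomp a = c"
  unfolding hcomp_def by (rule the1_equality [OF direct_sum]) (use assms in auto)

text \<open>Decompositions of different elements can be combined over a common finite index set,
  without determining the exact support of the result.\<close>

lemma hcomp_unique_superset:
  assumes c: "\<And>d. c d \<in> A d" and F: "finite F" "\<And>d. d \<notin> F \<Longrightarrow> c d = 0" and a: "a = sum c F"
  shows "hcomp a = c"
proof (rule hcomp_unique [OF c])
  have sub: "{d. c d \<noteq> 0} \<subseteq> F" using F(2) by blast
  then show "finite {d. c d \<noteq> 0}" using F(1) by (rule finite_subset)
  show "a = (\<Sum>d | c d \<noteq> 0. c d)" unfolding a by (rule sum.mono_neutral_right) (use F sub in auto)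
qed

lemma hcomp_sum_superset:
  assumes "finite F" "{d. hcomp a d \<noteq> 0} \<subseteq> F"
  shows "a = sum (hcomp a) F"
  by (subst hcomp_props(3), rule sum.mono_neutral_left) (use assms in auto)

lemma hcomp_add: "hcomp (a + b) d = hcomp a d + hcomp b d"
proof -
  let ?F = "{d. hcomp a d \<noteq> 0} \<union> {d. hcomp b d \<noteq> 0}"
  have F: "finite ?F" using hcomp_props(2) by simp
  have "a + b = (\<Sum>d\<in>?F. hcomp a d + hcomp b d)"
    unfolding sum.distrib using hcomp_sum_superset [OF F, of a] hcomp_sum_superset [OF F, of b] by auto
  then have "hcomp (a + b) = (\<lambda>d. hcomp a d + hcomp b d)"
    by (intro hcomp_unique_superset [OF _ F]) (auto intro: grade_add hcomp_props)
  then show ?thesis by simp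
qed

lemma hcomp_act: "hcomp (h \<cdot> a) d = h \<cdot> hcomp a d"
proof -
  let ?F = "{d. hcomp a d \<noteq> 0}"
  have F: "finite ?F" using hcomp_props(2) by simp
  have act_sum: "h \<cdot> sum f I = (\<Sum>i\<in>I. h \<cdot> f i)" for f :: "int \<Rightarrow> 'a" and I
    by (induction I rule: infinite_finite_induct) (auto simp: act_add_right)
  have "h \<cdot> a = (\<Sum>d\<in>?F. h \<cdot> hcomp a d)"
    unfolding act_sum [symmetric] using hcomp_props(3) by simp
  then have "hcomp (h \<cdot> a) = (\<lambda>d. h \<cdot> hcomp a d)"
    by (intro hcomp_unique_superset [OF _ F]) (auto intro: grade_act hcomp_props)
  then show ?thesis by simp
qed

lemma hcomp_homogeneous:
  assumes "a \<in> A d"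
  shows "hcomp a = (\<lambda>d'. if d' = d then a else 0)"
  by (rule hcomp_unique_superset [of _ "{d}"]) (use assms grade_zero in auto)

lemma homogeneous_nth:
  "homogeneous ds xs \<longleftrightarrow> length ds = length xs \<and> (\<forall>i<length xs. xs ! i \<in> A (ds ! i))"
  by (auto simp: homogeneous_def list_all2_conv_all_nth)

lemma homogeneous_permute:
  "\<sigma> permutes {..<length xs} \<Longrightarrow> homogeneous ds xs \<Longrightarrow> homogeneous (permute_list \<sigma> ds) (permute_list \<sigma> xs)"
  unfolding homogeneous_def by (subst list_all2_permute_list_iff) (auto dest: list_all2_lengthD)

section \<open>Polylinear maps in terms of representatives\<close>

lemma tens_rep:
  assumes "0 < n" "C \<in> tens n"
  shows "Poly_Mapping.keys (rep C) \<subseteq> tcarrier n" "cls (trel n) (rep C) = C"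
proof -
  obtain u where u: "C = cls (trel n) u" "Poly_Mapping.keys u \<subseteq> tcarrier n" using assms(2)
      by (auto simp: tens_def)
  show "Poly_Mapping.keys (rep C) \<subseteq> tcarrier n" unfolding u(1)
      by (rule keys_eqv_trel [OF assms(1) _ rep_cls u(2)])
  show "cls (trel n) (rep C) = C" unfolding u(1) by simp
qed

text \<open>The degree clause only yields a congruent \<open>u\<close>: the relation in
  \<open>trel\<close> for sums \<open>a + b\<close> ignores degrees, so the terms of the chosen
  representative need not be homogeneous.\<close>

lemma polylinear_rep:
  assumes f: "polylinear n p f" and n: "0 < n"
  shows "length xs = n \<Longrightarrow> Poly_Mapping.keys (rep (f xs)) \<subseteq> tcarrier n"
    and "length xs = n \<Longrightarrow> cls (trel n) (rep (f xs)) = f xs"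
    and "length xs = n \<Longrightarrow> i < n \<Longrightarrow>
      eqv (trel n) (rep (f (xs[i := x + y]))) (rep (f (xs[i := x])) + rep (f (xs[i := y])))"
    and "length xs = n \<Longrightarrow> length hs = n \<Longrightarrow> eqv (trel n) (rep (f (map2 (\<cdot>) hs xs))) (tmult hs (rep (f xs)))"
    and "length xs = n \<Longrightarrow> homogeneous ds xs \<Longrightarrow> \<exists>u. eqv (trel n) (rep (f xs)) u \<and>
      Poly_Mapping.keys u \<subseteq> {hs. length hs = n} \<times> A (sum_list ds + p)"
proof -
  assume xs: "length xs = n"
  then have "f xs \<in> tens n" using f by (simp add: polylinear_def)
  from tens_rep [OF n this]
  show "Poly_Mapping.keys (rep (f xs)) \<subseteq> tcarrier n" "cls (trel n) (rep (f xs)) = f xs" .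
  show "eqv (trel n) (rep (f (xs[i := x + y]))) (rep (f (xs[i := x])) + rep (f (xs[i := y])))" if "i < n"
  proof -
    have "f (xs[i := x + y]) = cls (trel n) (rep (f (xs[i := x])) + rep (f (xs[i := y])))"
      using f xs that unfolding polylinear_def by blast
    then show ?thesis by (simp add: rep_cls)
  qed
  show "eqv (trel n) (rep (f (map2 (\<cdot>) hs xs))) (tmult hs (rep (f xs)))" if "length hs = n"
  proof -
    have "f (map2 (\<cdot>) hs xs) = cls (trel n) (tmult hs (rep (f xs)))"
      using f xs that by (simp add: polylinear_def lmult_eq)
    then show ?thesis by (simp add: rep_cls)
  qed
  show "\<exists>u. eqv (trel n) (rep (f xs)) u \<and>
      Poly_Mapping.keys u \<subseteq> {hs. length hs = n} \<times> A (sum_list ds + p)"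
    if "homogeneous ds xs"
  proof -
    have "f xs \<in> tens_deg n (sum_list ds + p)"
      using f xs that unfolding polylinear_def by blast
    then obtain u where "f xs = cls (trel n) u" "Poly_Mapping.keys u \<subseteq> {hs. length hs = n} \<times> A
        (sum_list ds + p)"
      by (auto simp: tens_deg_def)
    then show ?thesis using rep_cls by metis
  qed
qed

text \<open>Any choice \<open>g\<close> of representatives suffices, since passing from
  \<open>g xs\<close> to \<open>rep (f xs)\<close> changes sums and left multiples only within their
  cosets.\<close>

lemma polylinearI:
  assumes "\<And>xs. length xs = n \<Longrightarrow> f xs = cls (trel n) (g xs)"
    and "\<And>xs. length xs = n \<Longrightarrow> Poly_Mapping.keys (g xs) \<subseteq> tcarrier n"
    and "\<And>xs i x y. length xs = n \<Longrightarrow> i < n \<Longrightarrow>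
        eqv (trel n) (g (xs[i := x + y])) (g (xs[i := x]) + g (xs[i := y]))"
    and "\<And>xs hs. length xs = n \<Longrightarrow> length hs = n \<Longrightarrow> eqv (trel n) (g (map2 (\<cdot>) hs xs)) (tmult hs (g xs))"
    and "\<And>xs ds. length xs = n \<Longrightarrow> homogeneous ds xs \<Longrightarrow> \<exists>u. eqv (trel n) (g xs) u \<and>
      Poly_Mapping.keys u \<subseteq> {hs. length hs = n} \<times> A (sum_list ds + p)"
    and n: "0 < n"
  shows "polylinear n p f"
  unfolding polylinear_def
proof (intro conjI allI impI)
  fix xs :: "'a list" assume xs: "length xs = n"
  show "f xs \<in> tens n" unfolding tens_def assms(1) [OF xs] using assms(2) [OF xs] by blast
  fix i x y assume i: "i < n"
  have "eqv (trel n) (g (xs[i := x + y])) (g (xs[i := x]) + g (xs[i := y]))" by (rule assms(3) [OF xs i])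
  also have "eqv (trel n) \<dots> (rep (f (xs[i := x])) + rep (f (xs[i := y])))"
    using xs by (intro eqv_add) (simp_all add: assms(1) eqv_sym rep_cls)
  finally show "f (xs[i := x + y]) = cls (trel n) (rep (f (xs[i := x])) + rep (f (xs[i := y])))"
    using assms(1) xs by (simp add: cls_eq_iff)
next
  fix hs :: "'h list" and xs :: "'a list" assume *: "length hs = n" "length xs = n"
  have "eqv (trel n) (g (map2 (\<cdot>) hs xs)) (tmult hs (g xs))" using assms(4) * by simp
  also have "eqv (trel n) \<dots> (tmult hs (rep (f xs)))"
    using * n by (intro tmult_respects) (simp_all add: assms(1) eqv_sym rep_cls)
  finally show "f (map2 (\<cdot>) hs xs) = lmult hs (f xs)"
    using * assms(1) by (simp add: lmult_eq cls_eq_iff)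
next
  fix ds and xs :: "'a list" assume *: "length xs = n" "homogeneous ds xs"
  then obtain u where "eqv (trel n) (g xs) u" "Poly_Mapping.keys u \<subseteq> {hs. length hs = n} \<times> A
      (sum_list ds + p)"
    using assms(5) by blast
  then show "f xs \<in> tens_deg n (sum_list ds + p)"
    unfolding tens_deg_def assms(1) [OF *(1)] cls_eq_iff [symmetric] by blast
qed

text \<open>Writing the argument as \<open>0 + 0\<close> makes the value congruent to twice
  itself.\<close>

lemma polylinear_zero:
  assumes f: "polylinear n p f" and n: "0 < n" and xs: "length xs = n" "i < n" "xs ! i = 0"
  shows "eqv (trel n) (rep (f xs)) 0"
proof -
  have "xs[i := 0] = xs" using xs by (metis list_update_id)
  then have "eqv (trel n) (rep (f xs)) (rep (f xs) + rep (f xs))"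
    using polylinear_rep(3) [OF f n xs(1,2), of 0 0] by simp
  from eqv_diff [OF this eqv_refl [of _ "rep (f xs)"]]
  show ?thesis by (simp add: eqv_sym)
qed

section \<open>Skew-symmetrized operations for a fixed list of degrees\<close>

text \<open>The degrees are a parameter and not read off from \<open>xs\<close>, because 0 lies in
  every degree. With \<open>ds\<close> fixed the signs are constants, and the sum inherits
  additivity and linearity term by term.\<close>

definition skew_frag :: "nat \<Rightarrow> ('a list \<Rightarrow> ('h list \<times> 'a \<Rightarrow>\<^sub>0 int) set) \<Rightarrow> int list \<Rightarrow> 'a list \<Rightarrow>
    ('h list \<times> 'a \<Rightarrow>\<^sub>0 int)" where
  "skew_frag k f ds xs = (\<Sum>\<sigma> | \<sigma> permutes {..<k}.
     frag_cmul (chi \<sigma> ds) (tperm \<sigma> (rep (f (permute_list (inv \<sigma>) xs)))))"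

lemma tperm_add: "tperm \<sigma> (u + v) = tperm \<sigma> u + tperm \<sigma> v"
  by (simp add: tperm_def frag_extend_add)

lemma tperm_cmul: "tperm \<sigma> (frag_cmul c u) = frag_cmul c (tperm \<sigma> u)"
  by (simp add: tperm_def frag_extend_cmul)

lemma tperm_sum: "tperm \<sigma> (\<Sum>i\<in>I. f i) = (\<Sum>i\<in>I. tperm \<sigma> (f i))"
  by (simp add: tperm_def frag_extend_sum')

lemma tperm_zero [simp]: "tperm \<sigma> 0 = 0"
  by (simp add: tperm_def)

lemma keys_sum_cmul:
  assumes "\<And>i. i \<in> I \<Longrightarrow> Poly_Mapping.keys (f i) \<subseteq> K"
  shows "Poly_Mapping.keys (\<Sum>i\<in>I. frag_cmul (c i) (f i)) \<subseteq> K"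
  by (rule keys_sum_subset) (use assms keys_cmul in blast)

context
  fixes k p f
  assumes f: "polylinear k p f" and k: "0 < k"
begin

lemma keys_skew_frag: "length xs = k \<Longrightarrow> Poly_Mapping.keys (skew_frag k f ds xs) \<subseteq> tcarrier k"
  unfolding skew_frag_def
  by (intro keys_sum_cmul keys_tperm polylinear_rep(1) [OF f k]) simp

lemma skew_frag_add:
  assumes xs: "length xs = k" and i: "i < k"
  shows "eqv (trel k) (skew_frag k f ds (xs[i := x + y]))
      (skew_frag k f ds (xs[i := x]) + skew_frag k f ds (xs[i := y]))"
  unfolding skew_frag_def sum.distrib [symmetric] frag_cmul_distrib2 [symmetric] tperm_add [symmetric]
proof (intro eqv_sum eqv_cmul, unfold mem_Collect_eq)
  fix \<sigma> assume \<sigma>: "\<sigma> permutes {..<k}"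
  have "inv (inv \<sigma>) i < k" using permutes_in_image [OF \<sigma>] i by (simp add: permutes_inv_inv [OF \<sigma>])
  moreover have "permute_list (inv \<sigma>) (xs[i := z]) = (permute_list (inv \<sigma>) xs)[inv (inv \<sigma>) i := z]" for z
    by (rule permute_list_update) (use permutes_inv [OF \<sigma>] xs i in simp_all)
  ultimately show "eqv (trel k) (tperm \<sigma> (rep (f (permute_list (inv \<sigma>) (xs[i := x + y])))))
     (tperm \<sigma> (rep (f (permute_list (inv \<sigma>) (xs[i := x]))) +
         rep (f (permute_list (inv \<sigma>) (xs[i := y])))))"
    using xs by (intro tperm_respects [OF \<sigma> k]) (simp add: polylinear_rep(3) [OF f k])
qed

lemma skew_frag_act:
  assumes xs: "length xs = k" and hs: "length hs = k"
  shows "eqv (trel k) (skew_frag k f ds (map2 (\<cdot>) hs xs)) (tmult hs (skew_frag k f ds xs))"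
proof -
  have "eqv (trel k) (skew_frag k f ds (map2 (\<cdot>) hs xs))
    (\<Sum>\<sigma> | \<sigma> permutes {..<k}. frag_cmul (chi \<sigma> ds)
        (tmult hs (tperm \<sigma> (rep (f (permute_list (inv \<sigma>) xs))))))"
    unfolding skew_frag_def
  proof (intro eqv_sum eqv_cmul, unfold mem_Collect_eq)
    fix \<sigma> assume \<sigma>: "\<sigma> permutes {..<k}"
    have "permute_list (inv \<sigma>) (map2 (\<cdot>) hs xs) =
        map2 (\<cdot>) (permute_list (inv \<sigma>) hs) (permute_list (inv \<sigma>) xs)"
      by (rule map2_permute_list [symmetric]) (use permutes_inv [OF \<sigma>] xs hs in auto)
    then have "eqv (trel k) (tperm \<sigma> (rep (f (permute_list (inv \<sigma>) (map2 (\<cdot>) hs xs)))))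
       (tperm \<sigma> (tmult (permute_list (inv \<sigma>) hs) (rep (f (permute_list (inv \<sigma>) xs)))))"
      using xs hs by (intro tperm_respects [OF \<sigma> k]) (simp add: polylinear_rep(4) [OF f k])
    also have "\<dots> = tmult hs (tperm \<sigma> (rep (f (permute_list (inv \<sigma>) xs))))"
      by (rule tperm_tmult [OF \<sigma> hs polylinear_rep(1) [OF f k]]) (use xs in simp)
    finally show "eqv (trel k) (tperm \<sigma> (rep (f (permute_list (inv \<sigma>) (map2 (\<cdot>) hs xs))))) \<dots>" .
  qed
  also have "\<dots> = tmult hs (skew_frag k f ds xs)"
    by (simp add: skew_frag_def tmult_def frag_extend_sum' frag_extend_cmul)
  finally show ?thesis .
qed

lemma skew_frag_zero:
  assumes xs: "length xs = k" "i < k" "xs ! i = 0"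
  shows "eqv (trel k) (skew_frag k f ds xs) 0"
proof -
  have "eqv (trel k) (skew_frag k f ds xs) (\<Sum>\<sigma> | \<sigma> permutes {..<k}. frag_cmul (chi \<sigma> ds) (tperm \<sigma> 0))"
    unfolding skew_frag_def
  proof (intro eqv_sum eqv_cmul, unfold mem_Collect_eq)
    fix \<sigma> assume \<sigma>: "\<sigma> permutes {..<k}"
    have "\<sigma> i < k" using permutes_in_image [OF \<sigma>, of i] xs by simp
    then have "permute_list (inv \<sigma>) xs ! \<sigma> i = 0"
      using xs permutes_inv [OF \<sigma>] by (simp add: permute_list_nth permutes_inverses [OF \<sigma>])
    then show "eqv (trel k) (tperm \<sigma> (rep (f (permute_list (inv \<sigma>) xs)))) (tperm \<sigma> 0)"
      using xs \<open>\<sigma> i < k\<close> by (intro tperm_respects [OF \<sigma> k] polylinear_zero [OF f k, where i = "\<sigma> i"])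
        auto
  qed
  then show ?thesis by simp
qed

lemma skew_frag_degree:
  assumes xs: "length xs = k" and hom: "homogeneous ds' xs"
  shows "\<exists>u. eqv (trel k) (skew_frag k f ds xs) u \<and>
      Poly_Mapping.keys u \<subseteq> {hs. length hs = k} \<times> A (sum_list ds' + p)"
proof -
  have "\<exists>u. eqv (trel k) (rep (f (permute_list (inv \<sigma>) xs))) u \<and>
      Poly_Mapping.keys u \<subseteq> {hs. length hs = k} \<times> A (sum_list ds' + p)"
    if \<sigma>: "\<sigma> permutes {..<k}" for \<sigma>
  proof -
    have ds': "length ds' = k" using hom xs by (simp add: homogeneous_nth)
    have "sum_list (permute_list (inv \<sigma>) ds') = sum_list ds'"
      by (metis ds' mset_permute_list permutes_inv \<sigma> sum_mset_sum_list)
    then show ?thesis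
      using polylinear_rep(5) [OF f k _ homogeneous_permute [OF _ hom], of "inv \<sigma>"] permutes_inv
        [OF \<sigma>] xs by simp
  qed
  then obtain u where u: "\<And>\<sigma>. \<sigma> permutes {..<k} \<Longrightarrow>
      eqv (trel k) (rep (f (permute_list (inv \<sigma>) xs))) (u \<sigma>) \<and>
      Poly_Mapping.keys (u \<sigma>) \<subseteq> {hs. length hs = k} \<times> A (sum_list ds' + p)"
    by metis
  let ?u = "\<Sum>\<sigma> | \<sigma> permutes {..<k}. frag_cmul (chi \<sigma> ds) (tperm \<sigma> (u \<sigma>))"
  have "eqv (trel k) (skew_frag k f ds xs) ?u"
    unfolding skew_frag_def by (intro eqv_sum eqv_cmul tperm_respects k) (use u in auto)
  moreover have "Poly_Mapping.keys ?u \<subseteq> {hs. length hs = k} \<times> A (sum_list ds' + p)"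
    by (intro keys_sum_cmul keys_tperm) (use u in auto)
  ultimately show ?thesis by blast
qed

text \<open>Substituting \<open>\<tau> \<circ> \<sigma>\<close> for the summation variable,
  \<open>chi_compose\<close> splits off the sign of \<open>\<sigma>\<close>. The operation is
  applied to literally the same lists on both sides, so the formal sums agree and not only their
  cosets.\<close>

lemma skew_frag_skew:
  assumes xs: "length xs = k" and ds: "length ds = k" and \<sigma>: "\<sigma> permutes {..<k}"
  shows "skew_frag k f ds xs =
    frag_cmul (chi \<sigma> ds) (tperm \<sigma> (skew_frag k f (permute_list (inv \<sigma>) ds) (permute_list (inv \<sigma>) xs)))"
proof -
  have "skew_frag k f ds xs = (\<Sum>\<tau> | \<tau> permutes {..<k}.
      frag_cmul (chi (\<tau> \<circ> \<sigma>) ds) (tperm (\<tau> \<circ> \<sigma>) (rep (f (permute_list (inv (\<tau> \<circ> \<sigma>)) xs)))))"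
    unfolding skew_frag_def by (rule sum_permutations_compose_right [OF \<sigma>])
  also have "\<dots> = (\<Sum>\<tau> | \<tau> permutes {..<k}. frag_cmul (chi \<sigma> ds)
      (tperm \<sigma> (frag_cmul (chi \<tau> (permute_list (inv \<sigma>) ds))
      (tperm \<tau> (rep (f (permute_list (inv \<tau>) (permute_list (inv \<sigma>) xs))))))))"
  proof (rule sum.cong, rule refl, unfold mem_Collect_eq)
    fix \<tau> assume \<tau>: "\<tau> permutes {..<k}"
    have "inv (\<tau> \<circ> \<sigma>) = inv \<sigma> \<circ> inv \<tau>" using permutes_bij [OF \<tau>] permutes_bij [OF \<sigma>]
        by (rule o_inv_distrib)
    then have pl: "permute_list (inv (\<tau> \<circ> \<sigma>)) xs = permute_list (inv \<tau>) (permute_list (inv \<sigma>) xs)"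
      using permutes_inv [OF \<tau>] xs by (simp add: permute_list_compose)
    have "chi (\<tau> \<circ> \<sigma>) ds = chi \<sigma> ds * chi \<tau> (permute_list (inv \<sigma>) ds)"
      by (rule chi_compose) (use \<sigma> \<tau> ds in auto)
    moreover have "tperm (\<tau> \<circ> \<sigma>) (rep (f (permute_list (inv (\<tau> \<circ> \<sigma>)) xs))) =
       tperm \<sigma> (tperm \<tau> (rep (f (permute_list (inv \<tau>) (permute_list (inv \<sigma>) xs)))))"
      unfolding pl by (rule tperm_compose [OF \<sigma> polylinear_rep(1) [OF f k], symmetric]) (use xs in simp)
    ultimately show "frag_cmul (chi (\<tau> \<circ> \<sigma>) ds)
        (tperm (\<tau> \<circ> \<sigma>) (rep (f (permute_list (inv (\<tau> \<circ> \<sigma>)) xs)))) =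
      frag_cmul (chi \<sigma> ds) (tperm \<sigma> (frag_cmul (chi \<tau> (permute_list (inv \<sigma>) ds))
      (tperm \<tau> (rep (f (permute_list (inv \<tau>) (permute_list (inv \<sigma>) xs)))))))"
      by (simp add: tperm_cmul)
  qed
  also have "\<dots> = frag_cmul (chi \<sigma> ds) (tperm \<sigma>
      (skew_frag k f (permute_list (inv \<sigma>) ds) (permute_list (inv \<sigma>) xs)))"
    by (simp add: skew_frag_def tperm_sum frag_cmul_sum)
  finally show ?thesis .
qed

end

lemma skew_sum_eq:
  assumes f: "polylinear k p (\<mu> k)" and k: "0 < k" and ds: "length ds = k"
  shows "skew_sum \<mu> k ds xs = cls (trel k) (skew_frag k (\<mu> k) ds xs)"
  unfolding skew_sum_def lincomb_def cls_eq_iff skew_frag_def perm_eq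
  by (intro eqv_sum) (use ds in \<open>auto simp: sign_koszul intro!: eqv_cmul rep_cls\<close>)

section \<open>Extension to inhomogeneous arguments\<close>

definition degree_lists :: "'a list \<Rightarrow> int list set" where
  "degree_lists xs = {ds. length ds = length xs \<and> (\<forall>i<length xs. hcomp (xs ! i) (ds ! i) \<noteq> 0)}"

definition skewsym_frag :: "nat \<Rightarrow> ('a list \<Rightarrow> ('h list \<times> 'a \<Rightarrow>\<^sub>0 int) set) \<Rightarrow> 'a list \<Rightarrow>
    ('h list \<times> 'a \<Rightarrow>\<^sub>0 int)" where
  "skewsym_frag k f xs = (\<Sum>ds\<in>degree_lists xs. skew_frag k f ds (map2 hcomp xs ds))"

lemma skew_symmetrization_eq:
  assumes f: "polylinear k p (\<mu> k)" and k: "0 < k" and xs: "length xs = k"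
  shows "skew_symmetrization \<mu> k xs = cls (trel k) (skewsym_frag k (\<mu> k) xs)"
  unfolding skew_symmetrization_def lincomb_def cls_eq_iff skewsym_frag_def degree_lists_def xs
  by (intro eqv_sum) (auto simp: skew_sum_eq [where \<mu> = \<mu>, OF f k] intro: rep_cls)

definition degree_support :: "'a list \<Rightarrow> int set" where
  "degree_support xs = (\<Union>x\<in>set xs. {d. hcomp x d \<noteq> 0})"

text \<open>The additional degree lists have a zero component among the arguments, so their terms
  vanish modulo the relations. This gives an index set that can be shared by different argument
  lists.\<close>

lemma skewsym_frag_superset:
  assumes f: "polylinear k p f" and k: "0 < k" and xs: "length xs = k"
    and F: "finite F" "degree_support xs \<subseteq> F"
  shows "eqv (trel k) (skewsym_frag k f xs)
      (\<Sum>ds | set ds \<subseteq> F \<and> length ds = k. skew_frag k f ds (map2 hcomp xs ds))"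
proof -
  let ?E = "{ds. set ds \<subseteq> F \<and> length ds = k}"
  have E: "finite ?E" using finite_lists_length_eq [OF F(1)] .
  have sub: "degree_lists xs \<subseteq> ?E"
  proof (intro subsetI CollectI conjI)
    fix ds d assume ds: "ds \<in> degree_lists xs" and "d \<in> set ds"
    then obtain i where i: "i < length ds" "d = ds ! i" by (auto simp: in_set_conv_nth)
    then have "hcomp (xs ! i) d \<noteq> 0" "xs ! i \<in> set xs" using ds by (auto simp: degree_lists_def)
    then show "d \<in> F" using F(2) by (auto simp: degree_support_def)
  qed (use xs in \<open>simp add: degree_lists_def\<close>)
  have "(\<Sum>ds\<in>?E. skew_frag k f ds (map2 hcomp xs ds)) =
     skewsym_frag k f xs + (\<Sum>ds\<in>?E - degree_lists xs. skew_frag k f ds (map2 hcomp xs ds))"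
    unfolding skewsym_frag_def using sum.subset_diff [OF sub E] by (simp add: add.commute)
  moreover have "eqv (trel k) (\<Sum>ds\<in>?E - degree_lists xs. skew_frag k f ds (map2 hcomp xs ds))
      (\<Sum>ds\<in>?E - degree_lists xs. 0)"
  proof (rule eqv_sum)
    fix ds assume "ds \<in> ?E - degree_lists xs"
    then obtain i where "length ds = k" "i < k" "hcomp (xs ! i) (ds ! i) = 0"
      using xs by (auto simp: degree_lists_def)
    then show "eqv (trel k) (skew_frag k f ds (map2 hcomp xs ds)) 0"
      using xs by (intro skew_frag_zero [OF f k, where i = i]) auto
  qed
  note eqv_sym [OF eqv_add [OF eqv_refl [of "trel k" "skewsym_frag k f xs"] this]]
  ultimately show ?thesis by simp
qed

text \<open>For nonzero homogeneous arguments \<open>ds\<close> is the only list of degrees with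
  nonzero components, so the sum has a single term.\<close>

lemma skewsym_frag_homogeneous:
  assumes f: "polylinear k p f" and k: "0 < k" and xs: "length xs = k" and hom: "homogeneous ds xs"
  shows "eqv (trel k) (skewsym_frag k f xs) (skew_frag k f ds xs)"
proof (cases "\<exists>i<k. xs ! i = 0")
  \<comment> \<open>A zero argument has no nonzero component, so the sum over degree lists is empty;
    the other side vanishes by additivity.\<close>
  case True
  then obtain i where i: "i < k" "xs ! i = 0" by blast
  have "hcomp 0 = (\<lambda>d. 0)" using hcomp_homogeneous [OF grade_zero, of 0] by auto
  then have "degree_lists xs = {}" using i xs by (auto simp: degree_lists_def)
  then have "skewsym_frag k f xs = 0" by (simp add: skewsym_frag_def)
  then show ?thesis using skew_frag_zero [OF f k xs i] by (simp add: eqv_sym)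
next
  case False
  have ds: "length ds = k" using hom xs by (simp add: homogeneous_nth)
  have hc: "hcomp (xs ! i) = (\<lambda>d. if d = ds ! i then xs ! i else 0)" if "i < k" for i
    using hom that xs by (intro hcomp_homogeneous) (simp add: homogeneous_nth)
  have "ds' \<in> degree_lists xs \<longleftrightarrow> ds' = ds" for ds'
    using ds xs False by (auto simp: degree_lists_def hc list_eq_iff_nth_eq split: if_splits)
  then have "degree_lists xs = {ds}" by blast
  moreover have "map2 hcomp xs ds = xs" using ds xs by (intro nth_equalityI) (auto simp: hc)
  ultimately show ?thesis by (simp add: skewsym_frag_def)
qed

lemma skewsym_frag_add:
  assumes f: "polylinear k p f" and k: "0 < k" and xs: "length xs = k" and i: "i < k"
  shows "eqv (trel k) (skewsym_frag k f (xs[i := x + y]))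
      (skewsym_frag k f (xs[i := x]) + skewsym_frag k f (xs[i := y]))"
proof -
  \<comment> \<open>One finite set of degrees for all three argument lists, so that the three sums
    have the same index set.\<close>
  let ?F = "degree_support (xs[i := x + y]) \<union> degree_support (xs[i := x]) \<union> degree_support (xs[i := y])"
  let ?E = "{ds. set ds \<subseteq> ?F \<and> length ds = k}"
  have F: "finite ?F" unfolding degree_support_def using hcomp_props(2) by auto
  have upd: "map2 hcomp (xs[i := z]) ds = (map2 hcomp xs ds)[i := hcomp z (ds ! i)]" if "length ds =
      k" for z ds
    by (rule map2_update_left) (use that xs i in auto)
  have "eqv (trel k) (skewsym_frag k f (xs[i := x + y]))
      (\<Sum>ds\<in>?E. skew_frag k f ds (map2 hcomp (xs[i := x + y]) ds))"
    by (rule skewsym_frag_superset [OF f k _ F]) (use xs in auto)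
  also have "eqv (trel k) \<dots> (\<Sum>ds\<in>?E. skew_frag k f ds (map2 hcomp (xs[i := x]) ds) +
      skew_frag k f ds (map2 hcomp (xs[i := y]) ds))"
  proof (rule eqv_sum)
    fix ds assume "ds \<in> ?E"
    then have "length ds = k" by simp
    then show "eqv (trel k) (skew_frag k f ds (map2 hcomp (xs[i := x + y]) ds))
      (skew_frag k f ds (map2 hcomp (xs[i := x]) ds) + skew_frag k f ds (map2 hcomp (xs[i := y]) ds))"
      unfolding upd [OF \<open>length ds = k\<close>] hcomp_add using xs i by (intro skew_frag_add [OF f k]) auto
  qed
  also have "\<dots> = (\<Sum>ds\<in>?E. skew_frag k f ds (map2 hcomp (xs[i := x]) ds)) +
      (\<Sum>ds\<in>?E. skew_frag k f ds (map2 hcomp (xs[i := y]) ds))"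
    by (rule sum.distrib)
  also have "eqv (trel k) \<dots> (skewsym_frag k f (xs[i := x]) + skewsym_frag k f (xs[i := y]))"
    by (intro eqv_add eqv_sym [OF skewsym_frag_superset [OF f k _ F]]) (use xs in auto)
  finally show ?thesis .
qed

lemma skewsym_frag_act:
  assumes f: "polylinear k p f" and k: "0 < k" and xs: "length xs = k" and hs: "length hs = k"
  shows "eqv (trel k) (skewsym_frag k f (map2 (\<cdot>) hs xs)) (tmult hs (skewsym_frag k f xs))"
proof -
  let ?F = "degree_support (map2 (\<cdot>) hs xs) \<union> degree_support xs"
  let ?E = "{ds. set ds \<subseteq> ?F \<and> length ds = k}"
  have F: "finite ?F" unfolding degree_support_def using hcomp_props(2) by auto
  have "eqv (trel k) (skewsym_frag k f (map2 (\<cdot>) hs xs))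
      (\<Sum>ds\<in>?E. skew_frag k f ds (map2 hcomp (map2 (\<cdot>) hs xs) ds))"
    by (rule skewsym_frag_superset [OF f k _ F]) (use xs hs in auto)
  also have "eqv (trel k) \<dots> (\<Sum>ds\<in>?E. tmult hs (skew_frag k f ds (map2 hcomp xs ds)))"
  proof (rule eqv_sum)
    fix ds assume "ds \<in> ?E"
    then have ds: "length ds = k" by simp
    have "map2 hcomp (map2 (\<cdot>) hs xs) ds = map2 (\<cdot>) hs (map2 hcomp xs ds)"
      using xs hs ds by (intro nth_equalityI) (auto simp: hcomp_act)
    then show "eqv (trel k) (skew_frag k f ds (map2 hcomp (map2 (\<cdot>) hs xs) ds))
        (tmult hs (skew_frag k f ds (map2 hcomp xs ds)))"
      using skew_frag_act [OF f k, of "map2 hcomp xs ds" hs ds] xs hs ds by simp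
  qed
  also have "\<dots> = tmult hs (\<Sum>ds\<in>?E. skew_frag k f ds (map2 hcomp xs ds))"
    by (simp add: tmult_def frag_extend_sum')
  also have "eqv (trel k) \<dots> (tmult hs (skewsym_frag k f xs))"
    by (intro tmult_respects hs k eqv_sym [OF skewsym_frag_superset [OF f k _ F]]) (use xs in auto)
  finally show ?thesis .
qed

lemma polylinear_skew_symmetrization:
  assumes f: "polylinear k p (\<mu> k)" and k: "0 < k"
  shows "polylinear k p (skew_symmetrization \<mu> k)"
proof (rule polylinearI [where g = "skewsym_frag k (\<mu> k)"])
  fix xs :: "'a list" assume xs: "length xs = k"
  show "skew_symmetrization \<mu> k xs = cls (trel k) (skewsym_frag k (\<mu> k) xs)"
    by (rule skew_symmetrization_eq [where \<mu> = \<mu>, OF f k xs])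
  show "Poly_Mapping.keys (skewsym_frag k (\<mu> k) xs) \<subseteq> tcarrier k"
    unfolding skewsym_frag_def
    by (intro keys_sum_subset keys_skew_frag [OF f k]) (use xs in \<open>simp add: degree_lists_def\<close>)
  fix ds assume hom: "homogeneous ds xs"
  obtain u where "eqv (trel k) (skew_frag k (\<mu> k) ds xs) u" "Poly_Mapping.keys u \<subseteq> {hs. length hs = k}
      \<times> A (sum_list ds + p)"
    using skew_frag_degree [OF f k xs hom] by blast
  then show "\<exists>u. eqv (trel k) (skewsym_frag k (\<mu> k) xs) u \<and>
      Poly_Mapping.keys u \<subseteq> {hs. length hs = k} \<times> A (sum_list ds + p)"
    using skewsym_frag_homogeneous [OF f k xs hom] eqv_trans by blast
qed (use skewsym_frag_add [OF f k] skewsym_frag_act [OF f k] k in auto)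

lemma rep_skew_symmetrization:
  assumes f: "polylinear k p (\<mu> k)" and k: "0 < k" and xs: "length xs = k" and hom: "homogeneous ds xs"
  shows "eqv (trel k) (rep (skew_symmetrization \<mu> k xs)) (skew_frag k (\<mu> k) ds xs)"
  unfolding skew_symmetrization_eq [where \<mu> = \<mu>, OF f k xs]
  using rep_cls skewsym_frag_homogeneous [OF f k xs hom] by (rule eqv_trans)

lemma skew_symmetrization_homogeneous:
  assumes f: "polylinear k p (\<mu> k)" and k: "0 < k" and xs: "length xs = k" and hom: "homogeneous ds xs"
  shows "skew_symmetrization \<mu> k xs = skew_sum \<mu> k ds xs"
proof -
  have "length ds = k" using hom xs by (simp add: homogeneous_nth)
  then show ?thesis
    unfolding skew_symmetrization_eq [where \<mu> = \<mu>, OF f k xs] skew_sum_eq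
      [where \<mu> = \<mu>, OF f k \<open>length ds = k\<close>] cls_eq_iff
    by (intro skewsym_frag_homogeneous [OF f k xs hom])
qed

lemma skew_symmetrization_skew_symmetric:
  assumes f: "polylinear k p (\<mu> k)" and k: "0 < k" and xs: "length xs = k" and hom: "homogeneous ds xs"
    and \<sigma>: "\<sigma> permutes {..<k}"
  shows "skew_symmetrization \<mu> k xs = cls (trel k) (frag_cmul (sign \<sigma> * koszul (inv \<sigma>) ds)
    (rep (perm k \<sigma> (skew_symmetrization \<mu> k (permute_list (inv \<sigma>) xs)))))"
proof -
  have ds: "length ds = k" using hom xs by (simp add: homogeneous_nth)
  have inv\<sigma>: "inv \<sigma> permutes {..<length xs}" using permutes_inv [OF \<sigma>] xs by simp
  let ?xs = "permute_list (inv \<sigma>) xs" and ?ds = "permute_list (inv \<sigma>) ds"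
  have "eqv (trel k) (skewsym_frag k (\<mu> k) xs)
      (frag_cmul (chi \<sigma> ds) (tperm \<sigma> (skew_frag k (\<mu> k) ?ds ?xs)))"
    using skewsym_frag_homogeneous [OF f k xs hom] skew_frag_skew [OF f k xs ds \<sigma>] by simp
  also have "eqv (trel k) \<dots> (frag_cmul (chi \<sigma> ds) (tperm \<sigma> (rep (skew_symmetrization \<mu> k ?xs))))"
    by (intro eqv_cmul tperm_respects \<sigma> k eqv_sym [OF rep_skew_symmetrization [where \<mu> = \<mu>, OF f k]]
      homogeneous_permute [OF inv\<sigma> hom])
      (use xs in simp)
  also have "eqv (trel k) \<dots> (frag_cmul (chi \<sigma> ds) (rep (perm k \<sigma> (skew_symmetrization \<mu> k ?xs))))"
    unfolding perm_eq by (intro eqv_cmul eqv_sym [OF rep_cls])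
  finally show ?thesis
    using ds \<sigma> unfolding skew_symmetrization_eq [where \<mu> = \<mu>, OF f k xs] cls_eq_iff
      by (simp add: sign_koszul)
qed

end

section \<open>The \<open>L\<^sub>\<infinity>\<close> identities\<close>

text \<open>Counterpart of \<open>permute_list_block_perm\<close> for arguments instead of tensor
  factors: reordering the outer and the inner arguments separately amounts to reading both from the
  single list \<open>zs\<close>, with \<open>e\<close> standing in for the block at position
  \<open>\<tau> 0\<close>. Cancelling the inverses reduces it to that lemma.\<close>

lemma block_perm_arguments:
  fixes ys :: "'b list" and e :: 'b
  assumes \<rho>: "\<rho> permutes {..<l}" and \<tau>: "\<tau> permutes {..<Suc n}" and l: "0 < l"
    and ys: "length ys = n + l"
  defines "zs \<equiv> permute_list (inv (block_perm l \<rho> \<tau>)) ys"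
  shows "permute_list (inv \<tau>) (e # drop l ys) = take (\<tau> 0) zs @ e # drop (\<tau> 0 + l) zs"
    and "permute_list (inv \<rho>) (take l ys) = take l (drop (\<tau> 0) zs)"
proof -
  let ?\<theta> = "block_perm l \<rho> \<tau>" and ?q = "\<tau> 0"
  let ?gs = "permute_list (inv \<rho>) (take l ys)" and ?fs = "permute_list (inv \<tau>) (e # drop l ys)"
  have q: "?q < Suc n" using permutes_in_image [OF \<tau>, of 0] by simp
  have gs: "length ?gs = l" and fs: "length ?fs = Suc n" using ys by simp_all
  have \<theta>: "?\<theta> permutes {..<n + l}" by (rule block_perm_permutes [OF \<rho> \<tau> l])
  have "permute_list \<rho> ?gs = take l ys" "permute_list \<tau> ?fs = e # drop l ys"
    using \<rho> \<tau> ys by (simp_all add: permute_list_inv_cancel)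
  then have "permute_list ?\<theta> (take ?q ?fs @ ?gs @ drop (Suc ?q) ?fs) = ys"
    using permute_list_block_perm [OF \<rho> \<tau> l gs fs] by simp
  moreover have "length (take ?q ?fs @ ?gs @ drop (Suc ?q) ?fs) = n + l" using q gs fs by simp
  ultimately have zs: "take ?q ?fs @ ?gs @ drop (Suc ?q) ?fs = zs"
    unfolding zs_def using \<theta> permute_list_inv_cancel(2) by metis
  have "?fs ! ?q = e"
    using q ys permutes_inv [OF \<tau>] by (simp add: permute_list_nth permutes_inverses [OF \<tau>])
  then have "?fs = take ?q ?fs @ e # drop (Suc ?q) ?fs" using id_take_nth_drop [of ?q ?fs] q fs by simp
  moreover have "take ?q zs = take ?q ?fs" "drop (?q + l) zs = drop (Suc ?q) ?fs"
    unfolding zs [symmetric] using q gs fs by simp_all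
  ultimately show "?fs = take ?q zs @ e # drop (?q + l) zs" by simp
  show "?gs = take l (drop ?q zs)" unfolding zs [symmetric] using q gs fs by simp
qed

section \<open>Composition of skew-symmetrized operations\<close>

context graded_hopf_module
begin

text \<open>Provides the hypotheses of \<open>compose_frag_respects\<close> for an operation with
  one open slot.\<close>

lemma polylinear_insert:
  assumes f: "polylinear (Suc n) p f" and m: "length as = m" and n: "m + length bs = n"
  shows "Poly_Mapping.keys (rep (f (as @ e # bs))) \<subseteq> tcarrier (Suc n)"
    and "eqv (trel (Suc n)) (rep (f (as @ (e + e') # bs)))
        (rep (f (as @ e # bs)) + rep (f (as @ e' # bs)))"
    and "eqv (trel (Suc n)) (rep (f (as @ h \<cdot> e # bs)))
        (tmult ((replicate (Suc n) 1)[m := h]) (rep (f (as @ e # bs))))"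
proof -
  have len: "length (as @ x # bs) = Suc n" for x using m n by simp
  have upd: "(as @ e # bs)[m := x] = as @ x # bs" for x using m by (simp add: list_update_append)
  show "Poly_Mapping.keys (rep (f (as @ e # bs))) \<subseteq> tcarrier (Suc n)"
    by (rule polylinear_rep(1) [OF f _ len]) simp
  show "eqv (trel (Suc n)) (rep (f (as @ (e + e') # bs)))
      (rep (f (as @ e # bs)) + rep (f (as @ e' # bs)))"
    using polylinear_rep(3) [OF f _ len, of m e e e'] m n unfolding upd by simp
  \<comment> \<open>\<open>h\<close> acts on the open slot alone through the pure tensor with
    \<open>h\<close> in factor \<open>m\<close> and 1 elsewhere.\<close>
  have "map2 (\<cdot>) ((replicate (Suc n) 1)[m := h]) (as @ e # bs) = as @ h \<cdot> e # bs"
  proof (rule nth_equalityI)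
    fix i assume "i < length (map2 (\<cdot>) ((replicate (Suc n) 1)[m := h]) (as @ e # bs))"
    then have "i < Suc n" using len by simp
    then show "map2 (\<cdot>) ((replicate (Suc n) 1)[m := h]) (as @ e # bs) ! i = (as @ h \<cdot> e # bs) ! i"
      using m n by (auto simp: nth_append nth_list_update act_one simp del: replicate_Suc)
  qed (use m n in \<open>simp del: replicate_Suc\<close>)
  then show "eqv (trel (Suc n)) (rep (f (as @ h \<cdot> e # bs)))
      (tmult ((replicate (Suc n) 1)[m := h]) (rep (f (as @ e # bs))))"
    using polylinear_rep(4) [OF f _ len [of e], of "(replicate (Suc n) 1)[m := h]"]
    by (simp del: replicate_Suc)
qed

lemma compose_frag_polylinear_respects:
  assumes f: "polylinear (Suc n) p f" and as: "length as = m" and n: "m + length bs = n" and l: "0 < l" 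
    and uv: "eqv (trel l) u v"
  shows "eqv (trel (n + l)) (compose_frag m (\<lambda>e. rep (f (as @ e # bs))) u)
      (compose_frag m (\<lambda>e. rep (f (as @ e # bs))) v)"
proof -
  obtain l' where l': "l = Suc l'" using l by (cases l) auto
  show ?thesis using uv unfolding l'
    by (intro compose_frag_respects polylinear_insert [OF f as n]) (use n in auto)
qed

lemma keys_rep_compose:
  assumes \<phi>: "polylinear (Suc n) p \<phi>" and \<psi>: "polylinear l p' \<psi>" and l: "0 < l" and m: "m \<le> n" and xs:
      "length xs = n + l"
  shows "Poly_Mapping.keys (rep (compose l m \<phi> \<psi> xs)) \<subseteq> tcarrier (n + l)"
  unfolding compose_eq xs
proof (rule keys_eqv_trel [OF _ _ rep_cls])
  show "Poly_Mapping.keys (compose_frag m (\<lambda>e. rep (\<phi> (take m xs @ e # drop (m + l) xs)))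
      (rep (\<psi> (take l (drop m xs))))) \<subseteq> tcarrier (n + l)"
    unfolding compose_frag_def
  proof (rule keys_frag_extend_subset, clarify)
    fix hs e gs b assume *: "(hs, e) \<in> Poly_Mapping.keys (rep (\<psi> (take l (drop m xs))))"
      and g: "(gs, b) \<in> Poly_Mapping.keys (insert_at m hs (rep (\<phi> (take m xs @ e # drop (m + l) xs))))"
    have "length hs = l" using * polylinear_rep(1) [OF \<psi> l, of "take l (drop m xs)"] xs m by auto
    moreover have "Poly_Mapping.keys (rep (\<phi> (take m xs @ e # drop (m + l) xs))) \<subseteq> tcarrier (Suc n)"
      by (rule polylinear_insert(1) [OF \<phi>]) (use xs m in auto)
    ultimately show "gs \<in> {hs. length hs = n + l} \<and> b \<in> UNIV"
      using keys_insert_at [of _ n m hs] m l g by (cases hs) auto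
  qed
qed (use l in simp)

lemma compose_frag_cmul_sum: "compose_frag m \<Phi> (\<Sum>i\<in>I. frag_cmul (c i) (u i)) =
    (\<Sum>i\<in>I. frag_cmul (c i) (compose_frag m \<Phi> (u i)))"
  by (simp add: compose_frag_def frag_extend_sum' frag_extend_cmul)

lemma insert_at_cmul_sum: "insert_at m hs (\<Sum>i\<in>I. frag_cmul (c i) (u i)) =
    (\<Sum>i\<in>I. frag_cmul (c i) (insert_at m hs (u i)))"
  by (simp add: insert_at_def frag_extend_sum' frag_extend_cmul)

text \<open>Treats one ordering \<open>\<rho>\<close> of the inner arguments. The representative
  \<open>u\<close> with terms in \<open>A d\<close> replaces the chosen one, because the skew
  formula for \<open>\<Phi> e\<close> is available only for \<open>e\<close> of degree
  \<open>d\<close>. Each ordering \<open>\<tau>\<close> of the outer arguments then moves the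
  insertion to position \<open>\<tau> 0\<close> by \<open>insert_at_perm\<close>.\<close>

lemma compose_frag_skew_inner:
  assumes f: "polylinear (Suc n) p f" and g: "polylinear l p' g" and l: "0 < l"
    and ys: "length ys = n + l" and hom: "homogeneous es ys"
    and \<Phi>: "\<And>e. e \<in> A d \<Longrightarrow> eqv (trel (Suc n)) (\<Phi> e) (skew_frag (Suc n) f (d # drop l es) (e # drop l ys))"
    and \<rho>: "\<rho> permutes {..<l}"
    and u: "eqv (trel l) (rep (g (permute_list (inv \<rho>) (take l ys)))) u" "Poly_Mapping.keys
        u \<subseteq> {hs. length hs = l} \<times> A d"
  shows "eqv (trel (n + l)) (compose_frag 0 \<Phi> (tperm \<rho> u))
     (\<Sum>\<tau> | \<tau> permutes {..<Suc n}. frag_cmul (chi \<tau> (d # drop l es))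
        (tperm (block_perm l \<rho> \<tau>) (rep (compose l (\<tau> 0) f g
            (permute_list (inv (block_perm l \<rho> \<tau>)) ys)))))"
proof -
  obtain l' where l': "l = Suc l'" using l by (cases l) auto
  let ?z = "\<lambda>\<tau>. permute_list (inv (block_perm l \<rho> \<tau>)) ys"
  let ?f = "\<lambda>\<tau> e. rep (f (take (\<tau> 0) (?z \<tau>) @ e # drop (\<tau> 0 + l) (?z \<tau>)))"
  have q: "\<tau> 0 < Suc n" if "\<tau> permutes {..<Suc n}" for \<tau> using permutes_in_image [OF that, of 0] by simp
  have "compose_frag 0 \<Phi> (tperm \<rho> u) = frag_extend (\<lambda>(hs, e). insert_at 0 (permute_list \<rho> hs) (\<Phi> e)) u"
    unfolding compose_frag_def tperm_def frag_extend_bind by (rule frag_extend_eq) auto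
  also have "eqv (trel (n + l)) \<dots> (frag_extend
      (\<lambda>(hs, e). \<Sum>\<tau> | \<tau> permutes {..<Suc n}. frag_cmul (chi \<tau> (d # drop l es))
     (tperm (block_perm l \<rho> \<tau>) (insert_at (\<tau> 0) hs (?f \<tau> e)))) u)"
  proof (rule frag_extend_eqv, clarify)
    fix hs e assume "(hs, e) \<in> Poly_Mapping.keys u"
    then have hs: "length hs = l" and e: "e \<in> A d" using u by auto
    have "eqv (trel (n + l)) (insert_at 0 (permute_list \<rho> hs) (\<Phi> e))
        (insert_at 0 (permute_list \<rho> hs) (skew_frag (Suc n) f (d # drop l es) (e # drop l ys)))"
      unfolding l' using insert_at_respects [OF _ _ \<Phi> [OF e], of 0 "permute_list \<rho> hs" l'] hs l' by simp
    also have "\<dots> = (\<Sum>\<tau> | \<tau> permutes {..<Suc n}. frag_cmul (chi \<tau> (d # drop l es)) 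
       (insert_at 0 (permute_list \<rho> hs) (tperm \<tau> (rep (f (permute_list (inv \<tau>) (e # drop l ys)))))))"
      unfolding skew_frag_def by (rule insert_at_cmul_sum)
    also have "eqv (trel (n + l)) \<dots> (\<Sum>\<tau> | \<tau> permutes {..<Suc n}. frag_cmul (chi \<tau> (d # drop l es)) 
       (tperm (block_perm l \<rho> \<tau>) (insert_at (\<tau> 0) hs (?f \<tau> e))))"
    proof (intro eqv_sum eqv_cmul, unfold mem_Collect_eq)
      fix \<tau> assume \<tau>: "\<tau> permutes {..<Suc n}"
      have eq: "permute_list (inv \<tau>) (e # drop l ys) = take (\<tau> 0) (?z \<tau>) @ e # drop (\<tau> 0 + l) (?z \<tau>)"
        by (rule block_perm_arguments(1) [OF \<rho> \<tau> l ys])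
      show "eqv (trel (n + l)) (insert_at 0 (permute_list \<rho> hs)
          (tperm \<tau> (rep (f (permute_list (inv \<tau>) (e # drop l ys))))))
         (tperm (block_perm l \<rho> \<tau>) (insert_at (\<tau> 0) hs (?f \<tau> e)))"
        unfolding eq unfolding l'
        by (rule insert_at_perm [OF _ \<tau> polylinear_insert(1) [OF f]]) (use \<rho> l' hs ys q [OF \<tau>] in auto)
    qed
    finally show "eqv (trel (n + l)) (insert_at 0 (permute_list \<rho> hs) (\<Phi> e))
        (\<Sum>\<tau> | \<tau> permutes {..<Suc n}. frag_cmul (chi \<tau> (d # drop l es))
            (tperm (block_perm l \<rho> \<tau>) (insert_at (\<tau> 0) hs (?f \<tau> e))))" .
  qed
  also have "\<dots> = (\<Sum>\<tau> | \<tau> permutes {..<Suc n}. frag_cmul (chi \<tau> (d # drop l es))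
      (tperm (block_perm l \<rho> \<tau>) (compose_frag (\<tau> 0) (?f \<tau>) u)))"
    by (simp add: compose_frag_def tperm_def case_prod_unfold frag_extend_sum_fun frag_extend_cmul_fun
      frag_extend_bind)
  also have "eqv (trel (n + l)) \<dots> (\<Sum>\<tau> | \<tau> permutes {..<Suc n}. frag_cmul (chi \<tau> (d # drop l es))
        (tperm (block_perm l \<rho> \<tau>) (rep (compose l (\<tau> 0) f g (?z \<tau>)))))"
  proof (intro eqv_sum eqv_cmul, unfold mem_Collect_eq)
    fix \<tau> assume \<tau>: "\<tau> permutes {..<Suc n}"
    \<comment> \<open>The homogeneous representative has served its purpose and is exchanged back,
      so that a genuine \<open>compose\<close> of the original operations appears.\<close>
    have u': "eqv (trel l) u (rep (g (take l (drop (\<tau> 0) (?z \<tau>)))))"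
      unfolding block_perm_arguments(2) [OF \<rho> \<tau> l ys, symmetric] by (rule eqv_sym [OF u(1)])
    have "eqv (trel (n + l)) (compose_frag (\<tau> 0) (?f \<tau>) u)
        (compose_frag (\<tau> 0) (?f \<tau>) (rep (g (take l (drop (\<tau> 0) (?z \<tau>))))))"
      by (rule compose_frag_polylinear_respects [OF f _ _ l u']) (use ys q [OF \<tau>] in auto)
    also have "eqv (trel (n + l)) \<dots> (rep (compose l (\<tau> 0) f g (?z \<tau>)))"
      unfolding compose_eq using ys eqv_sym [OF rep_cls] by simp
    finally show "eqv (trel (n + l)) (tperm (block_perm l \<rho> \<tau>) (compose_frag (\<tau> 0) (?f \<tau>) u))
       (tperm (block_perm l \<rho> \<tau>) (rep (compose l (\<tau> 0) f g (?z \<tau>))))"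
      using l by (intro tperm_respects block_perm_permutes [OF \<rho> \<tau> l]) auto
  qed
  finally show ?thesis .
qed

text \<open>Polylinearity of \<open>F\<close> makes the composition independent of the inner
  representative. The inner value can therefore be expanded into its orderings
  \<open>\<rho>\<close>, each with a representative of the right degree, before the formula for
  \<open>F\<close> is applied to single terms.\<close>

lemma compose_frag_skew:
  assumes f: "polylinear (Suc n) p f" and g: "polylinear l (int l - 2) g" and l: "0 < l"
    and F: "polylinear (Suc n) p' F"
    and F_skew: "\<And>xs ds. length xs = Suc n \<Longrightarrow> homogeneous ds xs \<Longrightarrow>
        eqv (trel (Suc n)) (rep (F xs)) (skew_frag (Suc n) f ds xs)"
    and G_skew: "\<And>xs ds. length xs = l \<Longrightarrow> homogeneous ds xs \<Longrightarrow>
        eqv (trel l) (rep (G xs)) (skew_frag l g ds xs)"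
    and ys: "length ys = n + l" and hom: "homogeneous es ys"
  shows "eqv (trel (n + l)) (rep (compose l 0 F G ys))
     (\<Sum>\<rho> | \<rho> permutes {..<l}. \<Sum>\<tau> | \<tau> permutes {..<Suc n}.
        frag_cmul (chi \<rho> (take l es) * chi \<tau> ((sum_list (take l es) + int l - 2) # drop l es))
        (tperm (block_perm l \<rho> \<tau>) (rep (compose l (\<tau> 0) f g
            (permute_list (inv (block_perm l \<rho> \<tau>)) ys)))))"
proof -
  \<comment> \<open>The degree of the inner value, as \<open>g\<close> has degree
    \<open>l - 2\<close>.\<close>
  define d where "d = sum_list (take l es) + int l - 2"
  let ?\<Phi> = "\<lambda>e. rep (F ([] @ e # drop l ys))"
  have es: "length es = n + l" using hom ys by (simp add: homogeneous_nth)
  have hom1: "homogeneous (take l es) (take l ys)" and hom2: "homogeneous (drop l es) (drop l ys)"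
    using hom unfolding homogeneous_def by (auto intro: list_all2_takeI list_all2_dropI)
  have "\<exists>u. eqv (trel l) (rep (g (permute_list (inv \<rho>) (take l ys)))) u \<and>
      Poly_Mapping.keys u \<subseteq> {hs. length hs = l} \<times> A d"
    if \<rho>: "\<rho> permutes {..<l}" for \<rho>
  proof -
    have "sum_list (permute_list (inv \<rho>) (take l es)) = sum_list (take l es)"
      using mset_permute_list [of "inv \<rho>" "take l es"] permutes_inv [OF \<rho>] es
        by (simp flip: sum_mset_sum_list)
    then show ?thesis
      using polylinear_rep(5) [OF g l _ homogeneous_permute [OF _ hom1], of "inv \<rho>"] permutes_inv
        [OF \<rho>] ys
      by (simp add: d_def add_diff_eq)
  qed
  then obtain u where u: "\<And>\<rho>. \<rho> permutes {..<l} \<Longrightarrow>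
      eqv (trel l) (rep (g (permute_list (inv \<rho>) (take l ys)))) (u \<rho>)"
    "\<And>\<rho>. \<rho> permutes {..<l} \<Longrightarrow> Poly_Mapping.keys (u \<rho>) \<subseteq> {hs. length hs = l} \<times> A d"
    by metis
  have "eqv (trel l) (rep (G (take l ys))) (skew_frag l g (take l es) (take l ys))"
    by (rule G_skew [OF _ hom1]) (use ys in simp)
  also have "eqv (trel l) \<dots> (\<Sum>\<rho> | \<rho> permutes {..<l}. frag_cmul (chi \<rho> (take l es)) (tperm \<rho> (u \<rho>)))"
    unfolding skew_frag_def by (intro eqv_sum eqv_cmul tperm_respects l) (use u in auto)
  finally have G: "eqv (trel l) (rep (G (take l ys))) \<dots>" .
  have "eqv (trel (n + l)) (rep (compose l 0 F G ys)) (compose_frag 0 ?\<Phi> (rep (G (take l ys))))"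
    unfolding compose_eq ys using rep_cls by simp
  also have "eqv (trel (n + l)) \<dots> (compose_frag 0 ?\<Phi>
      (\<Sum>\<rho> | \<rho> permutes {..<l}. frag_cmul (chi \<rho> (take l es)) (tperm \<rho> (u \<rho>))))"
    by (rule compose_frag_polylinear_respects [OF F _ _ l G]) (use ys in auto)
  also have "\<dots> = (\<Sum>\<rho> | \<rho> permutes {..<l}. frag_cmul (chi \<rho> (take l es))
      (compose_frag 0 ?\<Phi> (tperm \<rho> (u \<rho>))))"
    by (rule compose_frag_cmul_sum)
  also have "eqv (trel (n + l)) \<dots> (\<Sum>\<rho> | \<rho> permutes {..<l}. frag_cmul (chi \<rho> (take l es)) 
     (\<Sum>\<tau> | \<tau> permutes {..<Suc n}. frag_cmul (chi \<tau> (d # drop l es))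
        (tperm (block_perm l \<rho> \<tau>) (rep (compose l (\<tau> 0) f g
            (permute_list (inv (block_perm l \<rho> \<tau>)) ys))))))"
  proof (intro eqv_sum eqv_cmul compose_frag_skew_inner [OF f g l ys hom])
    fix e assume "e \<in> A d"
    then have "homogeneous (d # drop l es) (e # drop l ys)" using hom2 by (simp add: homogeneous_def)
    then show "eqv (trel (Suc n)) (?\<Phi> e) (skew_frag (Suc n) f (d # drop l es) (e # drop l ys))"
      using F_skew [of "e # drop l ys"] ys by simp
  qed (use u in auto)
  finally show ?thesis by (simp add: frag_cmul_sum d_def)
qed

text \<open>Moving the inner operation to position \<open>q\<close> turns the \<open>L\<^sub>\<infinity>\<close> sign into the \<open>A\<^sub>\<infinity>\<close> sign.\<close>

lemma L_sign_eq_A_sign: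
  assumes \<sigma>: "\<sigma> permutes {..<n + l}" and \<rho>: "\<rho> permutes {..<l}" and \<tau>: "\<tau> permutes {..<Suc n}"
    and l: "0 < l" and ds: "length ds = n + l"
  defines "es \<equiv> permute_list \<sigma> ds" and "\<pi> \<equiv> \<sigma> \<circ> inv (block_perm l \<rho> \<tau>)"
  shows "sign \<sigma> * koszul \<sigma> ds * msign (int l * (int (Suc n) - 1)) *
      (chi \<rho> (take l es) * chi \<tau> ((sum_list (take l es) + int l - 2) # drop l es)) =
    - chi (inv \<pi>) ds * msign (int (Suc (\<tau> 0)) * (int l + 1) + int l * int (n + l) + int l *
        sum_list (take (\<tau> 0) (permute_list \<pi> ds)))"
proof -
  let ?\<theta> = "block_perm l \<rho> \<tau>"
  have \<theta>: "?\<theta> permutes {..<n + l}" by (rule block_perm_permutes [OF \<rho> \<tau> l])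
  \<comment> \<open>The shuffle assigns arguments to positions, while \<open>chi\<close> takes the
    map from arguments to positions; hence the inverse.\<close>
  have s: "sign \<sigma> * koszul \<sigma> ds = chi (inv \<sigma>) ds"
    using sign_koszul [of "inv \<sigma>" ds] permutes_inv [OF \<sigma>] ds \<sigma>
    by (simp add: permutes_inv_inv [OF \<sigma>] sign_inverse permutes_imp_permutation [OF finite_lessThan])
  have inv\<pi>: "inv \<pi> = ?\<theta> \<circ> inv \<sigma>"
    unfolding \<pi>_def using o_inv_distrib [OF permutes_bij [OF \<sigma>] permutes_bij [OF permutes_inv [OF \<theta>]]]
    by (simp add: permutes_inv_inv [OF \<theta>])
  have chi\<pi>: "chi (inv \<pi>) ds = chi (inv \<sigma>) ds * chi ?\<theta> es"
    unfolding inv\<pi> es_def using chi_compose [of ?\<theta> ds "inv \<sigma>"] \<theta> permutes_inv [OF \<sigma>] ds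
    by (simp add: permutes_inv_inv [OF \<sigma>])
  have pl: "permute_list (inv ?\<theta>) es = permute_list \<pi> ds"
    unfolding es_def \<pi>_def by (rule permute_list_compose [symmetric])
      (use permutes_inv [OF \<theta>] ds in simp)
  have "sign \<sigma> * koszul \<sigma> ds * msign (int l * (int (Suc n) - 1)) *
      (chi \<rho> (take l es) * chi \<tau> ((sum_list (take l es) + int l - 2) # drop l es)) =
    chi (inv \<pi>) ds * (msign (int l * int n) *
        msign ((int l + 1) * int (\<tau> 0) + int l * sum_list (take (\<tau> 0) (permute_list \<pi> ds))))"
    unfolding s chi\<pi> pl [symmetric] using chi_block_perm [OF \<rho> \<tau> l, of es] ds
      by (simp add: es_def mult_ac)
  \<comment> \<open>With \<open>q = \<tau> 0\<close>, the exponents \<open>l n + (l + 1) q\<close>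
    and \<open>(q + 1) (l + 1) + l (n + l)\<close> differ by \<open>l + 1 + l^2\<close> modulo 2,
    which is odd for every \<open>l\<close>. This is the origin of the global -1.\<close>
  also have "msign (int l * int n) * msign
      ((int l + 1) * int (\<tau> 0) + int l * sum_list (take (\<tau> 0) (permute_list \<pi> ds))) =
    - msign (int (Suc (\<tau> 0)) * (int l + 1) + int l * int (n + l) + int l *
        sum_list (take (\<tau> 0) (permute_list \<pi> ds)))"
    by (auto simp: msign_def)
  finally show ?thesis by simp
qed

end

section \<open>Matching the two identities\<close>

lemma finite_shuffles: "finite (shuffles_of l N)"
  by (rule finite_subset [OF _ finite_permutations [of "{..<N}"]]) (auto simp: shuffles_of_def)

text \<open>The outer arity is determined by the inner one; as iterated sums over \<open>l\<close>
  the two identities can be matched for one \<open>l\<close> at a time.\<close>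

lemma sum_splits:
  fixes F :: "nat \<times> nat \<times> 'i \<Rightarrow> 'b::comm_monoid_add"
  assumes "\<And>l. finite (B l)"
  shows "(\<Sum>x | (case x of (k, l, i) \<Rightarrow> 1 \<le> k \<and> 1 \<le> l \<and> k + l = N + 1 \<and> i \<in> B l). F x) =
    (\<Sum>l\<in>{1..N}. \<Sum>i\<in>B l. F (N + 1 - l, l, i))"
  unfolding sum.Sigma [OF finite_atLeastAtMost ballI [OF assms]]
  by (rule sum.reindex_bij_witness [of _ "\<lambda>(l, i). (N + 1 - l, l, i)" "\<lambda>(k, l, i). (l, i)"])
    (auto intro!: arg_cong [where f = F])

context A_infinity_pseudoalgebra
begin

abbreviation \<beta> :: "nat \<Rightarrow> 'a list \<Rightarrow> ('h list \<times> 'a \<Rightarrow>\<^sub>0 int) set" where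
  "\<beta> \<equiv> skew_symmetrization \<mu>"

lemma polylinear_beta: "1 \<le> k \<Longrightarrow> polylinear k (int k - 2) (\<beta> k)"
  by (rule polylinear_skew_symmetrization [where \<mu> = \<mu>]) (auto intro: polylinear_mu)

text \<open>A summand of the A-infinity identity for the arguments in the order
  \<open>\<pi>\<close>, with the tensor factors put back by \<open>inv \<pi>\<close>. Positions in
  the sign are counted from 1, hence \<open>Suc q\<close>.\<close>

definition A_term :: "nat \<Rightarrow> nat \<Rightarrow> nat \<Rightarrow> (nat \<Rightarrow> nat) \<Rightarrow> int list \<Rightarrow> 'a list \<Rightarrow> ('h list \<times> 'a \<Rightarrow>\<^sub>0 int)" where
  "A_term N l q \<pi> ds xs = frag_cmul (msign
      (int (Suc q) * (int l + 1) + int l * int N + int l * sum_list (take q (permute_list \<pi> ds))))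
     (tperm (inv \<pi>) (rep (compose l q (\<mu> (N + 1 - l)) (\<mu> l) (permute_list \<pi> xs))))"

text \<open>The identity is applied to the reordered arguments and degrees, and
  \<open>tperm (inv \<pi>)\<close> respects congruence to 0.\<close>

lemma A_term_sum:
  assumes N: "1 \<le> N" and xs: "length xs = N" and hom: "homogeneous ds xs" and \<pi>: "\<pi> permutes {..<N}"
  shows "eqv (trel N) (\<Sum>l\<in>{1..N}. \<Sum>q<N + 1 - l. A_term N l q \<pi> ds xs) 0"
proof -
  let ?xs = "permute_list \<pi> xs" and ?ds = "permute_list \<pi> ds"
  let ?c = "\<lambda>(k, l, q). msign (int q * (int l + 1) + int l * int N + int l *
      sum_list (take (q - 1) ?ds))"
  let ?F = "\<lambda>(k, l, q). frag_cmul (?c (k, l, q)) (rep (compose l (q - 1) (\<mu> k) (\<mu> l) ?xs))"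
  have "eqv (trel N) (rep (lincomb (trel N) {(k, l, q). 1 \<le> k \<and> 1 \<le> l \<and> k + l = N + 1 \<and> 1 \<le> q \<and> q \<le> k} ?c
      (\<lambda>(k, l, q). compose l (q - 1) (\<mu> k) (\<mu> l) ?xs))) 0"
    using rep_cls [of "trel N" 0] A_infinity_identity [OF N _ homogeneous_permute [OF _ hom, of \<pi>]] \<pi>
      xs by simp
  then have "eqv (trel N) (\<Sum>x\<in>{(k, l, q). 1 \<le> k \<and> 1 \<le> l \<and> k + l = N + 1 \<and> 1 \<le> q \<and> q \<le> k}.
      frag_cmul (?c x) (rep (case x of (k, l, q) \<Rightarrow> compose l (q - 1) (\<mu> k) (\<mu> l) ?xs))) 0"
    by (rule eqv_trans [OF eqv_sym [OF rep_lincomb]])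
  then have "eqv (trel N) (\<Sum>x\<in>{(k, l, q). 1 \<le> k \<and> 1 \<le> l \<and> k + l = N + 1 \<and> 1 \<le> q \<and> q \<le> k}. ?F x) 0"
    by (simp add: case_prod_unfold)
  also have "{(k, l, q). 1 \<le> k \<and> 1 \<le> l \<and> k + l = N + 1 \<and> 1 \<le> q \<and> q \<le> k} =
      {x. case x of (k, l, q) \<Rightarrow> 1 \<le> k \<and> 1 \<le> l \<and> k + l = N + 1 \<and> q \<in> {1..N + 1 - l}}"
    by auto
  also have "(\<Sum>x\<in>\<dots>. ?F x) = (\<Sum>l\<in>{1..N}. \<Sum>q\<in>{1..N + 1 - l}. ?F (N + 1 - l, l, q))"
    by (rule sum_splits) simp
  also have "\<dots> = (\<Sum>l\<in>{1..N}. \<Sum>q<N + 1 - l. ?F (N + 1 - l, l, Suc q))"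
    by (intro sum.cong refl sum.reindex_bij_witness [of _ Suc "\<lambda>q. q - 1"]) auto
  finally have "eqv (trel N) (tperm (inv \<pi>) (\<Sum>l\<in>{1..N}. \<Sum>q<N + 1 - l. ?F (N + 1 - l, l, Suc q)))
      (tperm (inv \<pi>) 0)"
    using N by (intro tperm_respects permutes_inv [OF \<pi>]) auto
  then show ?thesis
    by (simp add: A_term_def tperm_sum tperm_cmul)
qed

text \<open>The bijection between shuffles with inner and outer orderings and pairs
  \<open>(\<pi>, q)\<close> preserves the inner arity, so it is applied for fixed \<open>l\<close>;
  vanishing appears only after summation over \<open>l\<close>.\<close>

lemma L_term_sum:
  assumes xs: "length xs = N" and hom: "homogeneous ds xs" and l: "1 \<le> l" "l \<le> N"
  shows "eqv (trel N)
    (\<Sum>\<sigma>\<in>shuffles_of l N. frag_cmul (sign \<sigma> * koszul \<sigma> ds * msign (int l * (int (N + 1 - l) - 1)))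
       (rep (perm N (inv \<sigma>) (compose l 0 (\<beta> (N + 1 - l)) (\<beta> l) (permute_list \<sigma> xs)))))
    (\<Sum>\<pi> | \<pi> permutes {..<N}. \<Sum>q<N + 1 - l. frag_cmul (- chi (inv \<pi>) ds) (A_term N l q \<pi> ds xs))"
proof -
  obtain n where N: "N = n + l" using l by (metis le_add_diff_inverse2)
  have k: "N + 1 - l = Suc n" using N by simp
  have l0: "0 < l" and N0: "0 < n + l" using l by auto
  have ds: "length ds = n + l" using hom xs N by (simp add: homogeneous_nth)
  have f: "polylinear (Suc n) (int (Suc n) - 2) (\<mu> (Suc n))" by (rule polylinear_mu) simp
  have g: "polylinear l (int l - 2) (\<mu> l)" by (rule polylinear_mu) (use l in simp)
  let ?ys = "\<lambda>\<sigma>. permute_list \<sigma> xs" and ?es = "\<lambda>\<sigma>. permute_list \<sigma> ds"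
  let ?c = "\<lambda>\<sigma>. sign \<sigma> * koszul \<sigma> ds * msign (int l * (int (Suc n) - 1))"
  let ?d = "\<lambda>\<sigma> \<rho> \<tau>. chi \<rho> (take l (?es \<sigma>)) *
      chi \<tau> ((sum_list (take l (?es \<sigma>)) + int l - 2) # drop l (?es \<sigma>))"
  let ?C = "\<lambda>q. compose l q (\<mu> (Suc n)) (\<mu> l)"
  let ?G = "\<lambda>(\<pi>, q). frag_cmul (- chi (inv \<pi>) ds) (A_term N l q \<pi> ds xs)"
  let ?R = "{\<rho>. \<rho> permutes {..<l}}" and ?T = "{\<tau>. \<tau> permutes {..<Suc n}}"
  have "eqv (trel N) (\<Sum>\<sigma>\<in>shuffles_of l N. frag_cmul (?c \<sigma>)
      (rep (perm N (inv \<sigma>) (compose l 0 (\<beta> (Suc n)) (\<beta> l) (?ys \<sigma>)))))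
    (\<Sum>\<sigma>\<in>shuffles_of l N. \<Sum>\<rho>\<in>?R. \<Sum>\<tau>\<in>?T. ?G (\<sigma> \<circ> inv (block_perm l \<rho> \<tau>), \<tau> 0))"
  proof (rule eqv_sum)
    fix \<sigma> assume "\<sigma> \<in> shuffles_of l N"
    then have \<sigma>: "\<sigma> permutes {..<n + l}" by (simp add: shuffles_of_def N)
    let ?S = "\<Sum>\<rho>\<in>?R. \<Sum>\<tau>\<in>?T. frag_cmul (?d \<sigma> \<rho> \<tau>)
        (tperm (block_perm l \<rho> \<tau>) (rep (?C (\<tau> 0) (permute_list (inv (block_perm l \<rho> \<tau>)) (?ys \<sigma>)))))"
    have "eqv (trel (n + l)) (rep (perm N (inv \<sigma>) (compose l 0 (\<beta> (Suc n)) (\<beta> l) (?ys \<sigma>))))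
      (tperm (inv \<sigma>) (rep (compose l 0 (\<beta> (Suc n)) (\<beta> l) (?ys \<sigma>))))"
      unfolding perm_eq N by (rule rep_cls)
    also have "eqv (trel (n + l)) \<dots> (tperm (inv \<sigma>) ?S)"
    proof (intro tperm_respects permutes_inv [OF \<sigma>] N0 compose_frag_skew [OF f g l0 polylinear_beta])
      show "homogeneous (?es \<sigma>) (?ys \<sigma>)" by (rule homogeneous_permute [OF _ hom]) (use \<sigma> xs N in simp)
    qed (use xs N l0 rep_skew_symmetrization [where \<mu> = \<mu>, OF f] rep_skew_symmetrization
      [where \<mu> = \<mu>, OF g l0] in auto)
    also have "tperm (inv \<sigma>) ?S = (\<Sum>\<rho>\<in>?R. \<Sum>\<tau>\<in>?T. frag_cmul (?d \<sigma> \<rho> \<tau>)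
        (tperm (inv \<sigma>) (tperm (block_perm l \<rho> \<tau>)
            (rep (?C (\<tau> 0) (permute_list (inv (block_perm l \<rho> \<tau>)) (?ys \<sigma>)))))))"
      by (simp add: tperm_sum tperm_cmul)
    finally have "eqv (trel N) (frag_cmul (?c \<sigma>)
        (rep (perm N (inv \<sigma>) (compose l 0 (\<beta> (Suc n)) (\<beta> l) (?ys \<sigma>))))) (frag_cmul (?c \<sigma>) \<dots>)"
      unfolding N by (rule eqv_cmul)
    also have "frag_cmul (?c \<sigma>) (\<Sum>\<rho>\<in>?R. \<Sum>\<tau>\<in>?T. frag_cmul (?d \<sigma> \<rho> \<tau>)
        (tperm (inv \<sigma>) (tperm (block_perm l \<rho> \<tau>)
            (rep (?C (\<tau> 0) (permute_list (inv (block_perm l \<rho> \<tau>)) (?ys \<sigma>))))))) =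
      (\<Sum>\<rho>\<in>?R. \<Sum>\<tau>\<in>?T. ?G (\<sigma> \<circ> inv (block_perm l \<rho> \<tau>), \<tau> 0))"
      unfolding frag_cmul_sum
    proof (intro sum.cong refl, unfold mem_Collect_eq frag_cmul_cmul split A_term_def k)
      fix \<rho> \<tau> assume \<rho>: "\<rho> permutes {..<l}" and \<tau>: "\<tau> permutes {..<Suc n}"
      let ?\<theta> = "block_perm l \<rho> \<tau>"
      let ?\<pi> = "\<sigma> \<circ> inv ?\<theta>"
      have \<theta>: "?\<theta> permutes {..<n + l}" by (rule block_perm_permutes [OF \<rho> \<tau> l0])
      have inv\<pi>: "inv ?\<pi> = ?\<theta> \<circ> inv \<sigma>"
        using o_inv_distrib [OF permutes_bij [OF \<sigma>] permutes_bij [OF permutes_inv [OF \<theta>]]]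
        by (simp add: permutes_inv_inv [OF \<theta>])
      have pl: "permute_list (inv ?\<theta>) (?ys \<sigma>) = permute_list ?\<pi> xs"
        by (rule permute_list_compose [symmetric]) (use permutes_inv [OF \<theta>] xs N in simp)
      \<comment> \<open>Undoing the block permutation and then the shuffle is undoing
        \<open>?\<pi>\<close>, so apart from the sign the term depends on the triple only through
        \<open>?\<pi>\<close> and \<open>\<tau> 0\<close>.\<close>
      have "tperm (inv \<sigma>) (tperm ?\<theta> (rep (?C (\<tau> 0) (permute_list ?\<pi> xs)))) =
          tperm (inv ?\<pi>) (rep (?C (\<tau> 0) (permute_list ?\<pi> xs)))"
        unfolding inv\<pi>
        by (rule tperm_compose [OF permutes_inv [OF \<sigma>] keys_rep_compose [OF f g l0]])
          (use permutes_in_image [OF \<tau>, of 0] xs N in auto)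
      moreover have "?c \<sigma> * ?d \<sigma> \<rho> \<tau> =
        - chi (inv ?\<pi>) ds * msign (int (Suc (\<tau> 0)) * (int l + 1) + int l * int N + int l *
            sum_list (take (\<tau> 0) (permute_list ?\<pi> ds)))"
        unfolding N by (rule L_sign_eq_A_sign [OF \<sigma> \<rho> \<tau> l0 ds])
      ultimately show "frag_cmul (?c \<sigma> * ?d \<sigma> \<rho> \<tau>)
          (tperm (inv \<sigma>) (tperm ?\<theta> (rep (?C (\<tau> 0) (permute_list (inv ?\<theta>) (?ys \<sigma>)))))) =
        frag_cmul (- chi (inv ?\<pi>) ds * msign
            (int (Suc (\<tau> 0)) * (int l + 1) + int l * int N + int l *
            sum_list (take (\<tau> 0) (permute_list ?\<pi> ds))))
          (tperm (inv ?\<pi>) (rep (?C (\<tau> 0) (permute_list ?\<pi> xs))))"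
        unfolding pl by (rule arg_cong2 [where f = frag_cmul, rotated])
    qed
    finally show "eqv (trel N) (frag_cmul (?c \<sigma>)
        (rep (perm N (inv \<sigma>) (compose l 0 (\<beta> (Suc n)) (\<beta> l) (?ys \<sigma>)))))
      (\<Sum>\<rho>\<in>?R. \<Sum>\<tau>\<in>?T. ?G (\<sigma> \<circ> inv (block_perm l \<rho> \<tau>), \<tau> 0))" .
  qed
  also have "(\<Sum>\<sigma>\<in>shuffles_of l N. \<Sum>\<rho>\<in>?R. \<Sum>\<tau>\<in>?T. ?G (\<sigma> \<circ> inv (block_perm l \<rho> \<tau>), \<tau> 0)) =
    (\<Sum>x\<in>shuffles_of l N \<times> ?R \<times> ?T. ?G (case x of (\<sigma>, \<rho>, \<tau>) \<Rightarrow> (\<sigma> \<circ> inv (block_perm l \<rho> \<tau>), \<tau> 0)))"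
    by (simp only: sum.cartesian_product' split)
  also have "\<dots> = (\<Sum>x\<in>{\<pi>. \<pi> permutes {..<N}} \<times> {..<Suc n}. ?G x)"
    unfolding N by (rule sum.reindex_bij_betw [OF bij_betw_shuffle_block [OF l0]])
  also have "\<dots> = (\<Sum>\<pi> | \<pi> permutes {..<N}. \<Sum>q<Suc n. frag_cmul (- chi (inv \<pi>) ds) (A_term N l q \<pi> ds xs))"
    by (simp only: sum.cartesian_product' split)
  finally show ?thesis unfolding k .
qed

lemma L_infinity_skew_symmetrization: "L_infinity_pseudoalgebra scale \<Delta> \<epsilon> S act A \<beta>"
proof
  show "1 \<le> k \<Longrightarrow> polylinear k (int k - 2) (\<beta> k)" for k by (rule polylinear_beta)
  show "\<beta> k xs = cls (trel k) (frag_cmul (sign \<sigma> * koszul (inv \<sigma>) ds)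
      (rep (perm k \<sigma> (\<beta> k (permute_list (inv \<sigma>) xs)))))"
    if "1 \<le> k" "length xs = k" "homogeneous ds xs" "\<sigma> permutes {..<k}" for k xs ds \<sigma>
    using that skew_symmetrization_skew_symmetric [where \<mu> = \<mu>, OF polylinear_mu [OF that(1)]] by simp
  fix N ds and xs :: "'a list"
  assume N: "1 \<le> N" and xs: "length xs = N" and hom: "homogeneous ds xs"
  let ?I = "{x. case x of (k, l, \<sigma>) \<Rightarrow> 1 \<le> k \<and> 1 \<le> l \<and> k + l = N + 1 \<and> \<sigma> \<in> shuffles_of l N}"
  let ?F = "\<lambda>(k, l, \<sigma>). frag_cmul (sign \<sigma> * koszul \<sigma> ds * msign (int l * (int k - 1)))
       (rep (perm N (inv \<sigma>) (compose l 0 (\<beta> k) (\<beta> l) (permute_list \<sigma> xs))))"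
  have "(\<Sum>x\<in>?I. ?F x) = (\<Sum>l\<in>{1..N}. \<Sum>\<sigma>\<in>shuffles_of l N. ?F (N + 1 - l, l, \<sigma>))"
    by (rule sum_splits [OF finite_shuffles])
  also have "eqv (trel N) \<dots> (\<Sum>l\<in>{1..N}. \<Sum>\<pi> | \<pi> permutes {..<N}. \<Sum>q<N +
      1 - l. frag_cmul (- chi (inv \<pi>) ds) (A_term N l q \<pi> ds xs))"
    unfolding split by (intro eqv_sum L_term_sum [OF xs hom]) auto
  \<comment> \<open>With \<open>\<pi>\<close> outermost and its sign factored out, the inner double
    sum is a complete A-infinity identity for one ordering of the arguments.\<close>
  also have "\<dots> = (\<Sum>\<pi> | \<pi> permutes {..<N}. frag_cmul (- chi (inv \<pi>) ds)
      (\<Sum>l\<in>{1..N}. \<Sum>q<N + 1 - l. A_term N l q \<pi> ds xs))"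
    unfolding frag_cmul_sum by (rule sum.swap)
  also have "eqv (trel N) \<dots> (\<Sum>\<pi> | \<pi> permutes {..<N}. frag_cmul (- chi (inv \<pi>) ds) 0)"
    by (intro eqv_sum eqv_cmul A_term_sum [OF N xs hom]) auto
  finally have "eqv (trel N) (\<Sum>x\<in>?I. ?F x) 0" by simp
  then show "lincomb (trel N) {(k, l, \<sigma>). 1 \<le> k \<and> 1 \<le> l \<and> k + l = N + 1 \<and> \<sigma> \<in> shuffles_of l N}
        (\<lambda>(k, l, \<sigma>). sign \<sigma> * koszul \<sigma> ds * msign (int l * (int k - 1)))
        (\<lambda>(k, l, \<sigma>). perm N (inv \<sigma>) (compose l 0 (\<beta> k) (\<beta> l) (permute_list \<sigma> xs))) = cls (trel N) 0"
    unfolding lincomb_def cls_eq_iff by (simp add: case_prod_unfold)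
qed

end

theorem theorem4p8:
  fixes scale :: "'k::field \<Rightarrow> 'h::ring_1 \<Rightarrow> 'h"
    and \<Delta> :: "'h \<Rightarrow> ('h list \<Rightarrow>\<^sub>0 int) set"
    and \<epsilon> :: "'h \<Rightarrow> 'k"
    and S :: "'h \<Rightarrow> 'h"
    and act :: "'h \<Rightarrow> 'a::ab_group_add \<Rightarrow> 'a"
    and A :: "int \<Rightarrow> 'a set"
    and \<mu> :: "nat \<Rightarrow> 'a list \<Rightarrow> ('h list \<times> 'a \<Rightarrow>\<^sub>0 int) set"
  assumes "A_infinity_pseudoalgebra scale \<Delta> \<epsilon> S act A \<mu>"
  shows "let \<beta> = graded_hopf_module.skew_symmetrization scale \<Delta> act A \<mu> in
      (\<forall>k ds as. k \<ge> 1 \<longrightarrow> length as = k \<longrightarrow> graded_hopf_module.homogeneous A ds as \<longrightarrow>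
         \<beta> k as = lincomb (graded_hopf_module.trel scale \<Delta> act k) {\<sigma>. \<sigma> permutes {..<k}}
           (\<lambda>\<sigma>. sign \<sigma> * koszul (inv \<sigma>) ds)
           (\<lambda>\<sigma>. graded_hopf_module.perm scale \<Delta> act k \<sigma> (\<mu> k (permute_list (inv \<sigma>) as)))) \<and>
      L_infinity_pseudoalgebra scale \<Delta> \<epsilon> S act A \<beta>"
proof -
  interpret A_infinity_pseudoalgebra scale \<Delta> \<epsilon> S act A \<mu> by (rule assms)
  have "\<beta> k as = lincomb (trel k) {\<sigma>. \<sigma> permutes {..<k}} (\<lambda>\<sigma>. sign \<sigma> * koszul (inv \<sigma>) ds)
       (\<lambda>\<sigma>. perm k \<sigma> (\<mu> k (permute_list (inv \<sigma>) as)))"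
    if "1 \<le> k" "length as = k" "homogeneous ds as" for k ds as
    using skew_symmetrization_homogeneous [where \<mu> = \<mu>, OF polylinear_mu [OF that(1)] _ that(2,3)]
      that(1)
    by (simp add: skew_sum_def)
  then show ?thesis
    unfolding Let_def using L_infinity_skew_symmetrization by blast
qed

end
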